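(* A unital (real) subalgebra $\mathcal{A}\subseteq M_n(\mathbb{H})$ is quasi-triangularizable if and only if $\mathrm{Tr}([A,B]^3)=0$ for all $A,B\in\mathcal{A}$.
   Context: $\mathbb{H}$ is the division ring of real quaternions, with $\mathbb{C}=\{a+\mathsf{i}b:a,b\in\mathbb{R}\}\subset\mathbb{H}$, and $M_n(\mathbb{H})$ is the real algebra of $n\times n$ quaternionic matrices. A unital subalgebra is an $\mathbb{R}$-subalgebra containing $I_n$. The quaternionic trace of $A=[a_{ij}]\in M_n(\mathbb{H})$ is $\mathrm{Tr}(A)=\sum_{i=1}^n(a_{ii}+\overline{a_{ii}})=2\,\mathrm{Re}\left(\sum_i a_{ii}\right)\in\mathbb{R}$. $[A,B]=AB-BA$. A $\{1,2\}$-sequence is a finite sequence $\sigma=(\sigma_1,\dots,\sigma_m)$ of integers from $\{1,2\}$; its size is $|\sigma|=\sigma_1+\dots+\sigma_m$. If $|\sigma|=n$, $M_\sigma$ denotes the subalgebra of $M_n(\mathbb{H})$ consisting of all block upper triangular matrices $A=(A_{ij})_{1\le i,j\le m}$ (with $A_{ij}$ of size $\sigma_i\times\sigma_j$ and $A_{ij}=0$ for $i>j$), where the diagonal blocks $A_{ii}\in M_{\sigma_i}(\mathbb{H})$ are subject to the additional condition that $A_{ii}\in M_2(\mathbb{C})$ whenever $\sigma_i=2$, and the blocks $A_{ij}$ with $i<j$ are arbitrary quaternionic matrices. A collection $\mathcal{S}$ of $n\times n$ quaternionic matrices is quasi-triangularizable if $P\mathcal{S}P^{-1}\subseteq M_\sigma$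 for some $P\in\mathrm{GL}_n(\mathbb{H})$ and some $\{1,2\}$-sequence $\sigma$ of size $n$. *)

theory Defs
  imports Complex_Main "Jordan_Normal_Form.Matrix"
begin

(* Quat a b c d stands for a + b i + c j + d k. *)
datatype quat = Quat (qRe: real) (qIm1: real) (qIm2: real) (qIm3: real)

lemma quat_eq_iff:
  "x = y \<longleftrightarrow> qRe x = qRe y \<and> qIm1 x = qIm1 y \<and> qIm2 x = qIm2 y \<and> qIm3 x = qIm3 y"
  by (cases x; cases y) simp

instantiation quat :: ring_1
begin

definition zero_quat where "zero_quat = Quat 0 0 0 0"
definition one_quat where "one_quat = Quat 1 0 0 0"
definition plus_quat where
  "plus_quat x y = Quat (qRe x + qRe y) (qIm1 x + qIm1 y) (qIm2 x + qIm2 y) (qIm3 x + qIm3 y)"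
definition uminus_quat where
  "uminus_quat x = Quat (- qRe x) (- qIm1 x) (- qIm2 x) (- qIm3 x)"
definition minus_quat where
  "minus_quat x y = Quat (qRe x - qRe y) (qIm1 x - qIm1 y) (qIm2 x - qIm2 y) (qIm3 x - qIm3 y)"
definition times_quat where
  "times_quat x y = Quat
     (qRe x * qRe y - qIm1 x * qIm1 y - qIm2 x * qIm2 y - qIm3 x * qIm3 y)
     (qRe x * qIm1 y + qIm1 x * qRe y + qIm2 x * qIm3 y - qIm3 x * qIm2 y)
     (qRe x * qIm2 y - qIm1 x * qIm3 y + qIm2 x * qRe y + qIm3 x * qIm1 y)
     (qRe x * qIm3 y + qIm1 x * qIm2 y - qIm2 x * qIm1 y + qIm3 x * qRe y)"

instance
  by standard
    (simp_all add: quat_eq_iff zero_quat_def one_quat_def plus_quat_def uminus_quat_def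
      minus_quat_def times_quat_def algebra_simps)

end

lemma quat_sel_simps [simp]:
  "qRe 0 = 0" "qIm1 0 = 0" "qIm2 0 = 0" "qIm3 0 = 0"
  "qRe 1 = 1" "qIm1 1 = 0" "qIm2 1 = 0" "qIm3 1 = 0"
  "qRe (x + y) = qRe x + qRe y" "qIm1 (x + y) = qIm1 x + qIm1 y"
  "qIm2 (x + y) = qIm2 x + qIm2 y" "qIm3 (x + y) = qIm3 x + qIm3 y"
  "qRe (- x) = - qRe x" "qIm1 (- x) = - qIm1 x"
  "qIm2 (- x) = - qIm2 x" "qIm3 (- x) = - qIm3 x"
  "qRe (x - y) = qRe x - qRe y" "qIm1 (x - y) = qIm1 x - qIm1 y"
  "qIm2 (x - y) = qIm2 x - qIm2 y" "qIm3 (x - y) = qIm3 x - qIm3 y"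
  "qRe (x * y) = qRe x * qRe y - qIm1 x * qIm1 y - qIm2 x * qIm2 y - qIm3 x * qIm3 y"
  "qIm1 (x * y) = qRe x * qIm1 y + qIm1 x * qRe y + qIm2 x * qIm3 y - qIm3 x * qIm2 y"
  "qIm2 (x * y) = qRe x * qIm2 y - qIm1 x * qIm3 y + qIm2 x * qRe y + qIm3 x * qIm1 y"
  "qIm3 (x * y) = qRe x * qIm3 y + qIm1 x * qIm2 y - qIm2 x * qIm1 y + qIm3 x * qRe y"
  by (simp_all add: zero_quat_def one_quat_def plus_quat_def uminus_quat_def
      minus_quat_def times_quat_def)

definition qcnj :: "quat \<Rightarrow> quat" where
  "qcnj x = Quat (qRe x) (- qIm1 x) (- qIm2 x) (- qIm3 x)"

definition qnorm2 :: "quat \<Rightarrow> real" where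
  "qnorm2 x = (qRe x)\<^sup>2 + (qIm1 x)\<^sup>2 + (qIm2 x)\<^sup>2 + (qIm3 x)\<^sup>2"

lemma qnorm2_eq_0_iff: "qnorm2 x = 0 \<longleftrightarrow> x = 0"
  by (auto simp: qnorm2_def quat_eq_iff add_nonneg_eq_0_iff)

instantiation quat :: real_div_algebra
begin

definition scaleR_quat where
  "scaleR_quat c x = Quat (c * qRe x) (c * qIm1 x) (c * qIm2 x) (c * qIm3 x)"
definition inverse_quat where
  "inverse_quat x = (inverse (qnorm2 x) *\<^sub>R qcnj x :: quat)"
definition divide_quat where
  "divide_quat x y = (x * inverse y :: quat)"

instance
proof
  fix x y :: quat
  assume "x \<noteq> 0"
  then have n: "qnorm2 x \<noteq> 0" by (simp add: qnorm2_eq_0_iff)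
  have s: "inverse (qnorm2 x) * (qRe x)\<^sup>2 + inverse (qnorm2 x) * (qIm1 x)\<^sup>2
    + inverse (qnorm2 x) * (qIm2 x)\<^sup>2 + inverse (qnorm2 x) * (qIm3 x)\<^sup>2 = 1"
    using n by (simp add: qnorm2_def flip: distrib_left)
  show "inverse x * x = 1" "x * inverse x = 1"
    using s by (simp_all add: inverse_quat_def scaleR_quat_def qcnj_def quat_eq_iff
        power2_eq_square algebra_simps)
qed (simp_all add: inverse_quat_def divide_quat_def scaleR_quat_def quat_eq_iff
      qcnj_def algebra_simps)

end

lemma quat_units:
  defines "i \<equiv> Quat 0 1 0 0" and "j \<equiv> Quat 0 0 1 0" and "k \<equiv> Quat 0 0 0 1"
  shows "i * i = - 1" "j * j = - 1" "k * k = - 1"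
    "i * j = k" "j * k = i" "k * i = j" "j * i = - k" "k * j = - i" "i * k = - j"
    "Quat a b c d = of_real a + of_real b * i + of_real c * j + of_real d * k"
  unfolding i_def j_def k_def by (simp_all add: quat_eq_iff of_real_def scaleR_quat_def)

(* The copy {a + i b : a, b real} of the complex numbers inside the quaternions. *)
definition quat_complex :: "quat set" where
  "quat_complex = {Quat a b 0 0 | a b. True}"

definition qTr :: "quat mat \<Rightarrow> quat" where
  "qTr A = (\<Sum>i<dim_row A. A $$ (i, i) + qcnj (A $$ (i, i)))"

lemma qTr_real: "qTr A = of_real (2 * qRe (\<Sum>i<dim_row A. A $$ (i, i)))"
proof -
  have "(\<Sum>i<n. A $$ (i, i) + qcnj (A $$ (i, i))) = of_real (2 * qRe (\<Sum>i<n. A $$ (i, i)))" for n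
    by (induction n) (simp_all add: quat_eq_iff qcnj_def of_real_def scaleR_quat_def)
  then show ?thesis by (simp add: qTr_def)
qed

definition commutator :: "'a :: ring mat \<Rightarrow> 'a mat \<Rightarrow> 'a mat" where
  "commutator A B = A * B - B * A"

(* Scaling by c is multiplication of all entries by the central quaternion of_real c. *)
definition unital_real_subalgebra :: "nat \<Rightarrow> quat mat set \<Rightarrow> bool" where
  "unital_real_subalgebra n S \<longleftrightarrow>
     S \<subseteq> carrier_mat n n \<and> 1\<^sub>m n \<in> S \<and>
     (\<forall>A\<in>S. \<forall>B\<in>S. A + B \<in> S) \<and>
     (\<forall>A\<in>S. \<forall>B\<in>S. A * B \<in> S) \<and>
     (\<forall>c::real. \<forall>A\<in>S. of_real c \<cdot>\<^sub>m A \<in> S)"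

definition one_two_sequence :: "nat list \<Rightarrow> bool" where
  "one_two_sequence \<sigma> \<longleftrightarrow> set \<sigma> \<subseteq> {1, 2}"

(* The (i, j) block of A, with blocks numbered from 0, when rows and columns are both
   partitioned into consecutive intervals of lengths \<sigma> ! 0, \<sigma> ! 1, ... *)
definition block :: "nat list \<Rightarrow> 'a mat \<Rightarrow> nat \<Rightarrow> nat \<Rightarrow> 'a mat" where
  "block \<sigma> A i j = mat (\<sigma> ! i) (\<sigma> ! j)
     (\<lambda>(r, s). A $$ (sum_list (take i \<sigma>) + r, sum_list (take j \<sigma>) + s))"

definition M_seq :: "nat list \<Rightarrow> quat mat set" where
  "M_seq \<sigma> = {A \<in> carrier_mat (sum_list \<sigma>) (sum_list \<sigma>).
     (\<forall>i<length \<sigma>. \<forall>j<i. block \<sigma> A i j = 0\<^sub>m (\<sigma> ! i) (\<sigma> ! j)) \<and>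
     (\<forall>i<length \<sigma>. \<sigma> ! i = 2 \<longrightarrow> elements_mat (block \<sigma> A i i) \<subseteq> quat_complex)}"

(* Q is the two-sided inverse of P. *)
definition quasi_triangularizable :: "nat \<Rightarrow> quat mat set \<Rightarrow> bool" where
  "quasi_triangularizable n S \<longleftrightarrow>
     (\<exists>P\<in>carrier_mat n n. \<exists>Q\<in>carrier_mat n n. \<exists>\<sigma>.
        inverts_mat P Q \<and> inverts_mat Q P \<and>
        one_two_sequence \<sigma> \<and> sum_list \<sigma> = n \<and>
        (\<lambda>A. P * A * Q) ` S \<subseteq> M_seq \<sigma>)"

end

(* Let A have cubes of commutators of trace zero, and let S be the complex algebra spanned by A in the
   2n x 2n complex matrices.  The cubic condition extends to S, and polarizing it shows that
   [[X,Y]^2,X] lies in the radical of the trace form of S for all X, Y in S.  In characteristic zero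
   that radical is a nil ideal, so it acts as zero on every irreducible section W/U of the complex
   space H^n.  By density an irreducible section of dimension at least three would contain X, Y with
   [[X,Y]^2,X] nonzero; hence W/U has dimension at most two.  Starting from an invariant right
   H-subspace U and a minimal complex invariant W above it, either W = Wj, or the intersection of W
   and Wj is U.  In the first case W is U plus a quaternionic line; in the second a complex basis of
   W/U is an H-basis of (W + Wj)/U in which A acts by complex matrices of size at most two.
   Conversely, the trace of a cubed commutator in M_sigma is computed on the diagonal blocks, where
   the commutators are purely imaginary quaternions or traceless complex 2 x 2 matrices. *)
theory Submission
  imports Defs "Jordan_Normal_Form.Schur_Decomposition" "HOL-Library.Function_Algebras"
begin

section \<open>Trace and roots of complex matrices\<close>

text \<open>The square of a traceless complex 2 x 2 matrix is scalar by Cayley-Hamilton, so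
  [[X,Y]^2,X] = 0 is an identity of M_2(C). It fails for 3 x 3 matrices, which is why this element,
  produced by polarization, detects sections of dimension above two. Complex scalars are used
  because Schur's lemma then yields scalars; over the reals the commuting ring of a section could be
  larger. The price is that W is closed only under right multiplication by complex numbers. Since A
  acts from the left, its action commutes with right multiplication by j, so Wj is invariant too. As
  U = Uj lies in both, minimality of W decides the intersection. If it is U, then (W + Wj)/U is W/U
  with scalars extended from C to H, and this is the origin of the complex entries in blocks of size
  two. The action need not be semisimple: the radical is the part of S that traces cannot see, and
  nilpotence makes it vanish on irreducible sections. Quotients are never formed; equality in W/U
  means that a difference lies in U.\<close>

definition mat_trace :: "'a :: comm_monoid_add mat \<Rightarrow> 'a" where
  "mat_trace A = (\<Sum>i<dim_row A. A $$ (i, i))"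

lemma mat_mult_index_sum:
  "i < dim_row A \<Longrightarrow> j < dim_col B \<Longrightarrow> dim_col A = dim_row B \<Longrightarrow>
    (A * B) $$ (i, j) = (\<Sum>k<dim_row B. A $$ (i, k) * B $$ (k, j))"
  by (simp add: scalar_prod_def atLeast0LessThan)

lemma mat_trace_mult_comm:
  fixes A B :: "'a :: comm_semiring_0 mat"
  assumes A: "A \<in> carrier_mat n m" and B: "B \<in> carrier_mat m n"
  shows "mat_trace (A * B) = mat_trace (B * A)"
proof -
  have "mat_trace (A * B) = (\<Sum>i<n. \<Sum>k<m. A $$ (i, k) * B $$ (k, i))"
    unfolding mat_trace_def using A B by (simp add: mat_mult_index_sum del: index_mult_mat(1))
  also have "\<dots> = (\<Sum>k<m. \<Sum>i<n. B $$ (k, i) * A $$ (i, k))"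
    by (subst sum.swap) (simp add: mult.commute)
  also have "\<dots> = mat_trace (B * A)"
    unfolding mat_trace_def using A B by (simp add: mat_mult_index_sum del: index_mult_mat(1))
  finally show ?thesis .
qed

lemma mat_trace_add:
  "A \<in> carrier_mat n n \<Longrightarrow> B \<in> carrier_mat n n \<Longrightarrow> mat_trace (A + B) = mat_trace A + mat_trace B"
  by (simp add: mat_trace_def sum.distrib)

lemma mat_trace_minus:
  fixes A :: "'a :: ab_group_add mat"
  shows "A \<in> carrier_mat n n \<Longrightarrow> B \<in> carrier_mat n n \<Longrightarrow> mat_trace (A - B) = mat_trace A - mat_trace B"
  by (simp add: mat_trace_def sum_subtractf)

lemma mat_trace_smult:
  fixes A :: "'a :: semiring_0 mat"
  shows "A \<in> carrier_mat n n \<Longrightarrow> mat_trace (c \<cdot>\<^sub>m A) = c * mat_trace A"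
  by (simp add: mat_trace_def sum_distrib_left)

section \<open>Annihilating products of linear factors, and nilpotence from power traces\<close>

fun lin_prod :: "'a :: ring_1 mat \<Rightarrow> 'a list \<Rightarrow> 'a mat" where
  "lin_prod R [] = 1\<^sub>m (dim_row R)"
| "lin_prod R (e # es) = (R - e \<cdot>\<^sub>m 1\<^sub>m (dim_row R)) * lin_prod R es"

lemma lin_prod_carrier [simp]: "R \<in> carrier_mat n n \<Longrightarrow> lin_prod R es \<in> carrier_mat n n"
  by (induction es) auto

text \<open>Cayley-Hamilton for triangular matrices, generalized for the induction. If the first
  \<open>k\<close> columns of \<open>M\<close> vanish, multiplication by \<open>B - e\<close> with
  \<open>e = B $$ (k, k)\<close> kills column \<open>k\<close> as well: in that column
  \<open>B - e\<close> has nonzero entries only in rows above \<open>k\<close>, and these meet zero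
  columns of \<open>M\<close>. The case \<open>M = 1\<close>, \<open>k = 0\<close> is the theorem
  itself.\<close>

lemma lin_prod_upper_triangular:
  fixes B :: "'a :: idom mat"
  assumes B: "B \<in> carrier_mat n n" and ut: "upper_triangular B"
    and "M \<in> carrier_mat n n" and "k \<le> n" and "\<And>i j. i < n \<Longrightarrow> j < k \<Longrightarrow> M $$ (i, j) = 0"
  shows "M * lin_prod B (drop k (diag_mat B)) = 0\<^sub>m n n"
  using assms(3-5)
proof (induction "n - k" arbitrary: k M)
  case 0
  then have "M = 0\<^sub>m n n" by (intro eq_matI) auto
  then show ?case using B by (simp add: left_mult_zero_mat)
next
  case (Suc d)
  then have k: "k < n" by simp
  define e where "e = B $$ (k, k)"
  define N where "N = M * (B - e \<cdot>\<^sub>m 1\<^sub>m n)"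
  have N: "N \<in> carrier_mat n n" unfolding N_def using B Suc.prems(1) by auto
  have len: "length (diag_mat B) = n" using B by (simp add: diag_mat_def)
  have dr: "drop k (diag_mat B) = e # drop (Suc k) (diag_mat B)"
    using k B by (simp add: Cons_nth_drop_Suc[symmetric] len e_def diag_mat_def)
  have "M * lin_prod B (drop k (diag_mat B)) = N * lin_prod B (drop (Suc k) (diag_mat B))"
    unfolding dr N_def using B Suc.prems(1)
    by (simp add: assoc_mult_mat[of _ n n _ n _ n] minus_carrier_mat)
  also have "\<dots> = 0\<^sub>m n n"
  proof (rule Suc.hyps(1))
    show "d = n - Suc k" "Suc k \<le> n" using Suc.hyps(2) k by auto
    show "N \<in> carrier_mat n n" by fact
    fix i j assume i: "i < n" and j: "j < Suc k"
    then have jn: "j < n" using k by simp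
    have "N $$ (i, j) = (\<Sum>l<n. M $$ (i, l) * (B - e \<cdot>\<^sub>m 1\<^sub>m n) $$ (l, j))"
      unfolding N_def using B Suc.prems(1) i jn by (subst mat_mult_index_sum) auto
    also have "\<dots> = 0"
    proof (rule sum.neutral, safe)
      fix l assume l: "l < n"
      show "M $$ (i, l) * (B - e \<cdot>\<^sub>m 1\<^sub>m n) $$ (l, j) = 0"
      proof (cases "l < k")
        case True
        then show ?thesis using Suc.prems(3)[OF i True] by simp
      next
        case False
        show ?thesis
        proof (cases "l = j")
          case True
          then have "l = k" using False j by simp
          then show ?thesis using True B k by (simp add: e_def)
        next
          case neq: False
          then have "j < l" using False j by simp
          then have "B $$ (l, j) = 0" using ut B l by auto
          then show ?thesis using neq B l jn by simp
        qed
      qed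
    qed
    finally show "N $$ (i, j) = 0" .
  qed
  finally show ?case .
qed

lemma lin_prod_similar:
  fixes B :: "'a :: comm_ring_1 mat"
  assumes P: "P \<in> carrier_mat n n" and Q: "Q \<in> carrier_mat n n" and B: "B \<in> carrier_mat n n"
    and PQ: "P * Q = 1\<^sub>m n" and QP: "Q * P = 1\<^sub>m n"
  shows "lin_prod (P * B * Q) es = P * lin_prod B es * Q"
proof (induction es)
  case Nil
  then show ?case using assms by simp
next
  case (Cons e es)
  let ?E = "e \<cdot>\<^sub>m 1\<^sub>m n"
  let ?L = "lin_prod B es"
  have L: "?L \<in> carrier_mat n n" using B by simp
  have c: "B - ?E \<in> carrier_mat n n" by auto
  have "P * ?E * Q = ?E"
    using mult_smult_distrib[OF P one_carrier_mat, of e] mult_smult_assoc_mat[OF P Q, of e] P PQ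
    by simp
  then have "P * B * Q - ?E = P * (B - ?E) * Q"
    using P Q B by (simp add: mult_minus_distrib_mat[of _ n n] minus_mult_distrib_mat[of _ n n])
  then have "lin_prod (P * B * Q) (e # es) = (P * (B - ?E) * Q) * (P * ?L * Q)"
    using Cons.IH P by simp
  also have "\<dots> = P * (B - ?E) * (Q * P) * (?L * Q)"
    using P Q L c by (simp add: assoc_mult_mat[of _ n n _ n _ n])
  also have "\<dots> = P * ((B - ?E) * ?L) * Q"
    unfolding QP using P Q L c by (simp add: assoc_mult_mat[of _ n n _ n _ n])
  finally show ?case using B by simp
qed

lemma lin_prod_replicate_0:
  fixes R :: "'a :: comm_ring_1 mat"
  assumes R: "R \<in> carrier_mat n n"
  shows "lin_prod R (replicate k 0) = R ^\<^sub>m k"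
proof (induction k)
  case (Suc k)
  have "R - 0 \<cdot>\<^sub>m 1\<^sub>m n = R" using R by (intro eq_matI) auto
  moreover have "R * R ^\<^sub>m k = R ^\<^sub>m k * R"
  proof (induction k)
    case (Suc k)
    then show ?case using R by (metis assoc_mult_mat pow_carrier_mat pow_mat.simps(2))
  qed (use R in simp)
  ultimately show ?case using Suc R by simp
qed simp

lemma upper_triangular_pow:
  fixes B :: "'a :: comm_ring_1 mat"
  assumes B: "B \<in> carrier_mat n n" and ut: "upper_triangular B"
  shows "(\<forall>i<n. \<forall>j<i. (B ^\<^sub>m k) $$ (i, j) = 0) \<and> (\<forall>i<n. (B ^\<^sub>m k) $$ (i, i) = (B $$ (i, i)) ^ k)"
proof (induction k)
  case 0
  then show ?case using B by auto
next
  case (Suc k)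
  have Bk: "B ^\<^sub>m k \<in> carrier_mat n n" using B by simp
  have idx: "(B ^\<^sub>m Suc k) $$ (i, j) = (\<Sum>l<n. (B ^\<^sub>m k) $$ (i, l) * B $$ (l, j))"
    if "i < n" "j < n" for i j
    using that B Bk by (simp add: mat_mult_index_sum del: index_mult_mat(1))
  have 1: "(B ^\<^sub>m Suc k) $$ (i, j) = 0" if "i < n" "j < i" for i j
  proof -
    have "(B ^\<^sub>m k) $$ (i, l) * B $$ (l, j) = 0" if l: "l < n" for l
    proof (cases "l < i")
      case True then show ?thesis using Suc \<open>i < n\<close> by auto
    next
      case False
      then have "B $$ (l, j) = 0" using ut B l \<open>j < i\<close> by auto
      then show ?thesis by simp
    qed
    then show ?thesis using that by (subst idx) auto
  qed
  have 2: "(B ^\<^sub>m Suc k) $$ (i, i) = (B $$ (i, i)) ^ Suc k" if i: "i < n" for i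
  proof -
    have "(B ^\<^sub>m k) $$ (i, l) * B $$ (l, i) = 0" if l: "l < n" "l \<noteq> i" for l
    proof (cases "l < i")
      case True then show ?thesis using Suc i by auto
    next
      case False
      then have "B $$ (l, i) = 0" using ut B l by auto
      then show ?thesis by simp
    qed
    then have "(\<Sum>l<n. (B ^\<^sub>m k) $$ (i, l) * B $$ (l, i)) = (B ^\<^sub>m k) $$ (i, i) * B $$ (i, i)"
      using i by (subst sum.mono_neutral_right[of _ "{i}"]) auto
    then show ?thesis using Suc i by (subst idx) auto
  qed
  show ?case using 1 2 by blast
qed

text \<open>Schur triangularization serves both conclusions with the same list: the diagonal
  annihilates \<open>R\<close>, and its power sums are the traces of the powers. Sharing the list is
  what later turns vanishing traces into \<open>R ^\<^sub>m n = 0\<close>.\<close>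

lemma complex_mat_roots:
  fixes R :: "complex mat"
  assumes R: "R \<in> carrier_mat n n"
  obtains es where "length es = n" "lin_prod R es = 0\<^sub>m n n"
    "\<And>k. mat_trace (R ^\<^sub>m k) = (\<Sum>e\<leftarrow>es. e ^ k)"
proof -
  obtain es where es: "char_poly R = (\<Prod>a\<leftarrow>es. [:- a, 1:])" "length es = n"
    using char_poly_factorized[OF R] by blast
  obtain B P Q where BPQ: "schur_decomposition R es = (B, P, Q)"
    by (cases "schur_decomposition R es") auto
  from schur_decomposition[OF R es(1) BPQ] have w: "similar_mat_wit R B P Q"
    and ut: "upper_triangular B" and d: "diag_mat B = es" by auto
  from similar_mat_witD2[OF R w] have PQ: "P * Q = 1\<^sub>m n" "Q * P = 1\<^sub>m n" and RB: "R = P * B * Q"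
    and c: "B \<in> carrier_mat n n" "P \<in> carrier_mat n n" "Q \<in> carrier_mat n n" by auto
  show thesis
  proof (rule that[OF es(2)])
    have "lin_prod B es = 0\<^sub>m n n"
      using lin_prod_upper_triangular[OF c(1) ut one_carrier_mat, of 0] lin_prod_carrier[OF c(1), of es]
      by (simp add: d)
    then show "lin_prod R es = 0\<^sub>m n n"
      unfolding RB lin_prod_similar[OF c(2,3,1) PQ] using c by simp
    fix k
    have Bk: "B ^\<^sub>m k \<in> carrier_mat n n" using c by simp
    have "mat_trace (R ^\<^sub>m k) = mat_trace (P * (B ^\<^sub>m k * Q))"
      using similar_mat_wit_pow_id[OF w, of k] c Bk by (simp add: assoc_mult_mat[of _ n n _ n _ n])
    also have "\<dots> = mat_trace (B ^\<^sub>m k * Q * P)"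
      using c Bk by (intro mat_trace_mult_comm[of _ n n]) auto
    also have "B ^\<^sub>m k * Q * P = B ^\<^sub>m k"
      using c Bk PQ by (simp add: assoc_mult_mat[of _ n n _ n _ n])
    also have "mat_trace (B ^\<^sub>m k) = (\<Sum>i<n. (B $$ (i, i)) ^ k)"
      unfolding mat_trace_def using c upper_triangular_pow[OF c(1) ut, of k] by simp
    also have "\<dots> = (\<Sum>e\<leftarrow>es. e ^ k)"
      using c unfolding d[symmetric] diag_mat_def
      by (simp add: sum_list_map_eq_sum_count interv_sum_list_conv_sum_set_nat atLeast0LessThan comp_def)
    finally show "mat_trace (R ^\<^sub>m k) = (\<Sum>e\<leftarrow>es. e ^ k)" .
  qed
qed

text \<open>Interpolation replaces Newton's identities. A polynomial without constant term that
  vanishes on all roots except \<open>e0\<close> sums over \<open>es\<close> to a combination of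
  power sums, hence to zero; the same sum is the multiplicity of \<open>e0\<close> times a nonzero
  value. Characteristic zero enters through the multiplicity.\<close>

lemma power_sums_zero_imp_zero:
  fixes es :: "complex list"
  assumes ps: "\<And>k. k > 0 \<Longrightarrow> (\<Sum>e\<leftarrow>es. e ^ k) = 0" and e0: "e0 \<in> set es"
  shows "e0 = 0"
proof (rule ccontr)
  assume nz: "e0 \<noteq> 0"
  define p where "p = (\<Prod>m\<in>set es - {e0}. [:- m, 1:])"
  \<comment> \<open>The factor X removes the constant term, which would contribute the power sum of
    exponent 0, that is, the length of \<open>es\<close>.\<close>
  define q where "q = pCons 0 p"
  have "(\<Sum>e\<leftarrow>es. poly q e) = (\<Sum>e\<leftarrow>es. \<Sum>k\<le>degree q. coeff q k * e ^ k)"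
    by (simp add: poly_altdef)
  also have "\<dots> = (\<Sum>k\<le>degree q. coeff q k * (\<Sum>e\<leftarrow>es. e ^ k))"
    by (induction es) (simp_all add: sum.distrib distrib_left)
  also have "\<dots> = 0"
  proof (rule sum.neutral, safe)
    fix k show "coeff q k * (\<Sum>e\<leftarrow>es. e ^ k) = 0"
      using ps[of k] by (cases k) (auto simp: q_def)
  qed
  finally have z: "(\<Sum>e\<leftarrow>es. poly q e) = 0" .
  have "poly q e = (if e = e0 then poly q e0 else 0)" if "e \<in> set es" for e
    using that by (auto simp: q_def p_def poly_prod prod_zero_iff)
  then have "(\<Sum>e\<leftarrow>es. poly q e) = (\<Sum>e\<leftarrow>es. if e = e0 then poly q e0 else 0)"
    by (intro arg_cong[where f = sum_list] map_cong) auto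
  also have "\<dots> = of_nat (count_list es e0) * poly q e0"
    by (induction es) (auto simp: algebra_simps)
  finally have "of_nat (count_list es e0) * poly q e0 = 0" using z by simp
  moreover have "poly q e0 \<noteq> 0"
    using nz by (auto simp: q_def p_def poly_prod prod_zero_iff)
  moreover have "count_list es e0 \<noteq> 0" using e0 by (simp add: count_list_0_iff)
  ultimately show False by simp
qed

lemma nilpotent_if_power_traces_zero:
  fixes R :: "complex mat"
  assumes R: "R \<in> carrier_mat n n" and tr: "\<And>k. k > 0 \<Longrightarrow> mat_trace (R ^\<^sub>m k) = 0"
  shows "R ^\<^sub>m n = 0\<^sub>m n n"
proof -
  obtain es where es: "length es = n" "lin_prod R es = 0\<^sub>m n n"
    "\<And>k. mat_trace (R ^\<^sub>m k) = (\<Sum>e\<leftarrow>es. e ^ k)"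
    by (rule complex_mat_roots[OF R]) blast
  have "\<forall>e\<in>set es. e = 0"
    using power_sums_zero_imp_zero[of es] tr es(3) by metis
  then have "es = replicate n 0" using es(1) by (metis replicate_eqI)
  then show ?thesis using es(2) lin_prod_replicate_0[OF R, of n] by simp
qed

section \<open>The radical of the trace form\<close>

definition trace3 :: "complex mat \<Rightarrow> complex mat \<Rightarrow> complex mat \<Rightarrow> complex" where
  "trace3 A B C = mat_trace (A * B * C)"

lemma trace3_cyclic:
  assumes "A \<in> carrier_mat n n" "B \<in> carrier_mat n n" "C \<in> carrier_mat n n"
  shows "trace3 A B C = trace3 B C A"
  using mat_trace_mult_comm[of A n n "B * C"] assms
  by (simp add: trace3_def assoc_mult_mat[of _ n n _ n _ n])

lemma trace3_linear:
  assumes "A \<in> carrier_mat n n" "B \<in> carrier_mat n n" "C \<in> carrier_mat n n" "D \<in> carrier_mat n n"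
  shows "trace3 (A + s \<cdot>\<^sub>m D) B C = trace3 A B C + s * trace3 D B C"
    "trace3 A (B + s \<cdot>\<^sub>m D) C = trace3 A B C + s * trace3 A D C"
    "trace3 A B (C + s \<cdot>\<^sub>m D) = trace3 A B C + s * trace3 A B D"
proof -
  have *: "mat_trace ((A + s \<cdot>\<^sub>m D) * E) = mat_trace (A * E) + s * mat_trace (D * E)"
    if "A \<in> carrier_mat n n" "D \<in> carrier_mat n n" "E \<in> carrier_mat n n" for A D E
    using that
    by (simp add: add_mult_distrib_mat[of _ n n _ _ n] mult_smult_assoc_mat[of _ n n _ n]
        mat_trace_add[of _ n] mat_trace_smult[of _ n])
  have 1: "trace3 (A + s \<cdot>\<^sub>m D) B C = trace3 A B C + s * trace3 D B C"
    if "A \<in> carrier_mat n n" "B \<in> carrier_mat n n" "C \<in> carrier_mat n n" "D \<in> carrier_mat n n"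
    for A B C D
    using that *[of A D "B * C"] by (simp add: trace3_def assoc_mult_mat[of _ n n _ n _ n])
  show "trace3 (A + s \<cdot>\<^sub>m D) B C = trace3 A B C + s * trace3 D B C" using 1 assms by simp
  show "trace3 A (B + s \<cdot>\<^sub>m D) C = trace3 A B C + s * trace3 A D C"
    using 1[of B C A D] assms trace3_cyclic[of A n B C] trace3_cyclic[of A n D C]
      trace3_cyclic[of A n "B + s \<cdot>\<^sub>m D" C] by simp
  show "trace3 A B (C + s \<cdot>\<^sub>m D) = trace3 A B C + s * trace3 A B D"
    using 1[of C A B D] assms trace3_cyclic[of C n A B] trace3_cyclic[of D n A B]
      trace3_cyclic[of "C + s \<cdot>\<^sub>m D" n A B] by simp
qed

text \<open>Although \<open>A\<close> and \<open>B\<close> need not commute, cyclicity identifies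
  the three words with one \<open>B\<close>, and the three with two, so the expansion has the
  binomial form.\<close>

lemma trace3_cube:
  assumes "A \<in> carrier_mat n n" "B \<in> carrier_mat n n" "C = A + s \<cdot>\<^sub>m B"
  shows "trace3 C C C = trace3 A A A + 3 * s * trace3 A A B + 3 * s\<^sup>2 * trace3 A B B
    + s ^ 3 * trace3 B B B"
proof -
  have "trace3 C C C = trace3 A A A + s * trace3 A A B + s * (trace3 A B A + s * trace3 A B B)
      + s * (trace3 B A A + s * trace3 B A B + s * (trace3 B B A + s * trace3 B B B))"
    unfolding assms(3) using assms(1,2) by (simp add: trace3_linear[of _ n] algebra_simps)
  moreover have "trace3 B A A = trace3 A A B" "trace3 A B A = trace3 A A B"
    "trace3 B B A = trace3 A B B" "trace3 B A B = trace3 A B B"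
    using trace3_cyclic assms(1,2) by metis+
  ultimately show ?thesis
    by (simp add: power2_eq_square power3_eq_cube algebra_simps)
qed

lemma commutator_carrier [simp]:
  "A \<in> carrier_mat n n \<Longrightarrow> B \<in> carrier_mat n n \<Longrightarrow> commutator A B \<in> carrier_mat n n"
  by (auto simp: commutator_def)

lemma commutator_linear:
  fixes A B C :: "'a :: comm_ring_1 mat"
  assumes "A \<in> carrier_mat n n" "B \<in> carrier_mat n n" "C \<in> carrier_mat n n"
  shows "commutator (A + s \<cdot>\<^sub>m B) C = commutator A C + s \<cdot>\<^sub>m commutator B C"
    "commutator C (A + s \<cdot>\<^sub>m B) = commutator C A + s \<cdot>\<^sub>m commutator C B"
proof -
  have "(A + s \<cdot>\<^sub>m B) * C = A * C + s \<cdot>\<^sub>m (B * C)" "C * (A + s \<cdot>\<^sub>m B) = C * A + s \<cdot>\<^sub>m (C * B)"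
    using assms by (simp_all add: add_mult_distrib_mat[of _ n n _ _ n] mult_add_distrib_mat[of _ n n _ n]
        mult_smult_assoc_mat[of _ n n _ n] mult_smult_distrib[of _ n n _ n])
  then show "commutator (A + s \<cdot>\<^sub>m B) C = commutator A C + s \<cdot>\<^sub>m commutator B C"
    "commutator C (A + s \<cdot>\<^sub>m B) = commutator C A + s \<cdot>\<^sub>m commutator C B"
    using assms
    by (auto simp: commutator_def right_diff_distrib simp del: index_mult_mat(1) intro!: eq_matI)
qed

definition cube_trace_free :: "complex mat set \<Rightarrow> bool" where
  "cube_trace_free S \<longleftrightarrow>
    (\<forall>A\<in>S. \<forall>B\<in>S. trace3 (commutator A B) (commutator A B) (commutator A B) = 0)"

text \<open>As a function of the scalar the trace is a cubic polynomial, here with infinitely many zeros.\<close>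
lemma trace3_cube_complex:
  assumes AB: "A \<in> carrier_mat n n" "B \<in> carrier_mat n n"
    and z: "\<And>s :: real. trace3 (A + of_real s \<cdot>\<^sub>m B) (A + of_real s \<cdot>\<^sub>m B) (A + of_real s \<cdot>\<^sub>m B) = 0"
  shows "trace3 (A + c \<cdot>\<^sub>m B) (A + c \<cdot>\<^sub>m B) (A + c \<cdot>\<^sub>m B) = 0"
proof -
  have e: "trace3 A A A + 3 * of_real s * trace3 A A B + 3 * (of_real s)\<^sup>2 * trace3 A B B
    + (of_real s) ^ 3 * trace3 B B B = 0" for s :: real
    using z[of s] trace3_cube[OF AB refl, of "of_real s"] by simp
  \<comment> \<open>The values at 0, 1, -1 and 2 suffice for the four coefficients: the sum of the
    equations at 1 and -1 isolates the quadratic one, and the equation at 2 minus twice that at 1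
    then gives the cubic one.\<close>
  have 0: "trace3 A A A = 0" using e[of 0] by simp
  have 1: "3 * trace3 A A B + 3 * trace3 A B B + trace3 B B B = 0" using e[of 1] 0 by simp
  have 2: "- 3 * trace3 A A B + 3 * trace3 A B B - trace3 B B B = 0" using e[of "- 1"] 0 by simp
  have 3: "6 * trace3 A A B + 12 * trace3 A B B + 8 * trace3 B B B = 0" using e[of 2] 0 by simp
  have b: "trace3 A B B = 0" using arg_cong2[OF 1 2, of "(+)"] by simp
  have c: "trace3 B B B = 0" using arg_cong2[OF 3 arg_cong[OF 1, of "\<lambda>x. 2 * x"], of "(-)"] b by simp
  then have "trace3 A A B = 0" using 1 b by simp
  then show ?thesis using 0 b c trace3_cube[OF AB refl, of c] by simp
qed

section \<open>The trace radical of a complex matrix algebra\<close>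

locale complex_mat_algebra =
  fixes n :: nat and S :: "complex mat set"
  assumes carrier: "A \<in> S \<Longrightarrow> A \<in> carrier_mat n n"
    and one: "1\<^sub>m n \<in> S"
    and add: "A \<in> S \<Longrightarrow> B \<in> S \<Longrightarrow> A + B \<in> S"
    and mult: "A \<in> S \<Longrightarrow> B \<in> S \<Longrightarrow> A * B \<in> S"
    and smult: "A \<in> S \<Longrightarrow> c \<cdot>\<^sub>m A \<in> S"
begin

lemma minus: "A \<in> S \<Longrightarrow> B \<in> S \<Longrightarrow> A - B \<in> S"
proof -
  assume "A \<in> S" "B \<in> S"
  moreover from this have "A - B = A + (- 1) \<cdot>\<^sub>m B" using carrier[of A] carrier[of B] by (intro eq_matI) auto
  ultimately show ?thesis using add smult by metis
qed

lemma commutator: "A \<in> S \<Longrightarrow> B \<in> S \<Longrightarrow> commutator A B \<in> S"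
  by (simp add: commutator_def minus mult)

definition trace_radical :: "complex mat set" where
  "trace_radical = {W \<in> S. \<forall>Z\<in>S. mat_trace (W * Z) = 0}"

lemma trace_radical_add: "V \<in> trace_radical \<Longrightarrow> W \<in> trace_radical \<Longrightarrow> V + W \<in> trace_radical"
  unfolding trace_radical_def
  by (auto simp: add mult carrier add_mult_distrib_mat[of _ n n _ _ n] mat_trace_add[of _ n])

lemma trace_radical_left:
  assumes A: "A \<in> S" and W: "W \<in> trace_radical"
  shows "A * W \<in> trace_radical"
proof -
  have WS: "W \<in> S" using W by (simp add: trace_radical_def)
  have "mat_trace (A * W * Z) = 0" if Z: "Z \<in> S" for Z
  proof -
    have "mat_trace (A * W * Z) = trace3 W Z A"
      using A WS Z trace3_cyclic[of A n W Z] by (simp add: carrier trace3_def)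
    also have "\<dots> = mat_trace (W * (Z * A))"
      using A WS Z by (simp add: trace3_def carrier assoc_mult_mat[of _ n n _ n _ n])
    finally show ?thesis using W Z A by (simp add: trace_radical_def mult)
  qed
  then show ?thesis using A WS by (simp add: trace_radical_def mult)
qed

lemma trace_radical_right:
  assumes A: "A \<in> S" and W: "W \<in> trace_radical"
  shows "W * A \<in> trace_radical"
  using assms by (auto simp: trace_radical_def mult carrier assoc_mult_mat[of _ n n _ n _ n])

lemma pow: "A \<in> S \<Longrightarrow> A ^\<^sub>m k \<in> S"
proof (induction k)
  case 0
  then show ?case using carrier[of A] one by simp
qed (simp add: mult)

text \<open>Every positive power of \<open>W\<close> is \<open>W\<close> times a member of
  \<open>S\<close>, so all its power traces vanish. For the first power the other factor is the
  identity matrix, which lies in \<open>S\<close>.\<close>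

lemma trace_radical_nilpotent:
  assumes W: "W \<in> trace_radical"
  shows "W ^\<^sub>m n = 0\<^sub>m n n"
proof (rule nilpotent_if_power_traces_zero)
  have WS: "W \<in> S" using W by (simp add: trace_radical_def)
  show "W \<in> carrier_mat n n" using carrier WS .
  fix k :: nat assume "k > 0"
  then obtain m where m: "k = Suc m" using gr0_implies_Suc by blast
  have "mat_trace (W ^\<^sub>m k) = mat_trace (W * W ^\<^sub>m m)"
    unfolding m pow_mat.simps using pow[OF WS, of m] WS by (intro mat_trace_mult_comm[of _ n n]) (auto simp: carrier)
  also have "\<dots> = 0" using W pow[OF WS, of m] by (simp add: trace_radical_def)
  finally show "mat_trace (W ^\<^sub>m k) = 0" .
qed

text \<open>Polarizing the cubic condition gives \<open>tr ([X,Y]\<^sup>2 [X,Z]) = 0\<close>, and moving the outer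
  commutator across the trace turns this into \<open>tr ([[X,Y]\<^sup>2, X] Z) = 0\<close>.\<close>
lemma commutator_square_in_trace_radical:
  assumes free: "cube_trace_free S" and X: "X \<in> S" and Y: "Y \<in> S"
  shows "commutator (commutator X Y * commutator X Y) X \<in> trace_radical"
proof -
  let ?D = "commutator X Y"
  have D: "?D \<in> S" using commutator X Y .
  have "mat_trace (commutator (?D * ?D) X * Z) = 0" if Z: "Z \<in> S" for Z
  proof -
    let ?C = "commutator X Z"
    have C: "?C \<in> S" using commutator X Z .
    note c = carrier[OF C] carrier[OF D] carrier[OF X] carrier[OF Z]
    have eq: "trace3 ?C ?C ?C + 3 * s * trace3 ?C ?C ?D + 3 * s\<^sup>2 * trace3 ?C ?D ?D
        + s ^ 3 * trace3 ?D ?D ?D = 0" for s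
    proof -
      have "commutator X (Z + s \<cdot>\<^sub>m Y) = ?C + s \<cdot>\<^sub>m ?D"
        using commutator_linear(2)[of Z n Y X s] X Y Z by (simp add: carrier)
      moreover have "Z + s \<cdot>\<^sub>m Y \<in> S" using add smult Y Z by blast
      ultimately show ?thesis
        using free X trace3_cube[OF c(1,2) refl, of s] unfolding cube_trace_free_def by metis
    qed
    \<comment> \<open>Extracts the coefficient of \<open>s\<^sup>2\<close>: the odd terms cancel
      between \<open>s = 1\<close> and \<open>s = - 1\<close>, and \<open>s = 0\<close> removes the
      constant.\<close>
    have "trace3 ?C ?D ?D = 0"
      using eq[of 0] arg_cong2[OF eq[of 1] eq[of "- 1"], of "(+)"] by simp
    then have "trace3 ?D ?D ?C = 0" using trace3_cyclic[OF c(1,2,2)] by simp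
    moreover have "trace3 ?D ?D ?C = mat_trace (?D * ?D * X * Z) - mat_trace (?D * ?D * Z * X)"
      using c by (simp add: trace3_def commutator_def[of X Z] mult_minus_distrib_mat[of _ n n _ n]
          mat_trace_minus[of _ n] assoc_mult_mat[of _ n n _ n _ n])
    moreover have "mat_trace (?D * ?D * Z * X) = mat_trace (X * (?D * ?D) * Z)"
      using c mat_trace_mult_comm[of "?D * ?D * Z" n n X] by (simp add: assoc_mult_mat[of _ n n _ n _ n])
    moreover have "mat_trace (commutator (?D * ?D) X * Z)
        = mat_trace (?D * ?D * X * Z) - mat_trace (X * (?D * ?D) * Z)"
      using c by (simp add: commutator_def[of "?D * ?D" X] minus_mult_distrib_mat[of _ n n _ _ n]
          mat_trace_minus[of _ n] mult_carrier_mat[of _ n n _ n] assoc_mult_mat[of _ n n _ n _ n])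
    ultimately show ?thesis by simp
  qed
  then show ?thesis using commutator[OF mult[OF D D] X] by (simp add: trace_radical_def)
qed

end

section \<open>From real to complex coefficients\<close>

definition complex_span :: "complex mat set \<Rightarrow> complex mat set" where
  "complex_span R = {A + \<i> \<cdot>\<^sub>m B | A B. A \<in> R \<and> B \<in> R}"

text \<open>The condition is cubic, not linear, so it does not pass to spans automatically. It is
  extended in one argument at a time: for fixed second argument in \<open>R\<close> the trace is a
  cubic in the coefficient of the first, and afterwards the same holds for the second argument with
  the first one already complex.\<close>

lemma cube_trace_free_complex_span:
  assumes carr: "\<And>A. A \<in> R \<Longrightarrow> A \<in> carrier_mat n n"
    and lin: "\<And>A B s. A \<in> R \<Longrightarrow> B \<in> R \<Longrightarrow> A + of_real s \<cdot>\<^sub>m B \<in> R"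
    and free: "cube_trace_free R"
  shows "cube_trace_free (complex_span R)"
proof -
  have 1: "trace3 (commutator (A + c \<cdot>\<^sub>m A') B) (commutator (A + c \<cdot>\<^sub>m A') B) (commutator (A + c \<cdot>\<^sub>m A') B) = 0"
    if "A \<in> R" "A' \<in> R" "B \<in> R" for A A' B c
  proof -
    note c = that[THEN carr]
    show ?thesis unfolding commutator_linear(1)[OF c]
    proof (rule trace3_cube_complex[of _ n])
      fix s :: real
      show "trace3 (commutator A B + of_real s \<cdot>\<^sub>m commutator A' B)
         (commutator A B + of_real s \<cdot>\<^sub>m commutator A' B)
         (commutator A B + of_real s \<cdot>\<^sub>m commutator A' B) = 0"
        using free lin[OF that(1,2), of s] that(3)
        unfolding cube_trace_free_def commutator_linear(1)[OF c, symmetric] by blast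
    qed (use c in auto)
  qed
  have "trace3 (commutator X (B + c \<cdot>\<^sub>m B')) (commutator X (B + c \<cdot>\<^sub>m B')) (commutator X (B + c \<cdot>\<^sub>m B')) = 0"
    if X: "X = A + d \<cdot>\<^sub>m A'" and "A \<in> R" "A' \<in> R" "B \<in> R" "B' \<in> R" for X A A' B B' c d
  proof -
    have cX: "X \<in> carrier_mat n n" using that carr by auto
    note c = that(4,5)[THEN carr]
    show ?thesis unfolding commutator_linear(2)[OF c cX]
    proof (rule trace3_cube_complex[of _ n])
      fix s :: real
      show "trace3 (commutator X B + of_real s \<cdot>\<^sub>m commutator X B')
         (commutator X B + of_real s \<cdot>\<^sub>m commutator X B')
         (commutator X B + of_real s \<cdot>\<^sub>m commutator X B') = 0"
        using 1[OF that(2,3) lin[OF that(4,5), of s], of d] unfolding X[symmetric]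
        by (simp only: commutator_linear(2)[OF c cX])
    qed (use c cX in auto)
  qed
  then show ?thesis unfolding cube_trace_free_def complex_span_def by blast
qed

lemma complex_span_algebra:
  assumes carr: "\<And>A. A \<in> R \<Longrightarrow> A \<in> carrier_mat n n" and one: "1\<^sub>m n \<in> R"
    and add: "\<And>A B. A \<in> R \<Longrightarrow> B \<in> R \<Longrightarrow> A + B \<in> R"
    and mult: "\<And>A B. A \<in> R \<Longrightarrow> B \<in> R \<Longrightarrow> A * B \<in> R"
    and smult: "\<And>A s. A \<in> R \<Longrightarrow> of_real s \<cdot>\<^sub>m A \<in> R"
  shows "complex_mat_algebra n (complex_span R)"
proof
  show "A \<in> carrier_mat n n" if "A \<in> complex_span R" for A
    using that carr by (auto simp: complex_span_def)
  show "1\<^sub>m n \<in> complex_span R"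
  proof -
    have "1\<^sub>m n = 1\<^sub>m n + \<i> \<cdot>\<^sub>m (of_real 0 \<cdot>\<^sub>m 1\<^sub>m n)" by (intro eq_matI) auto
    then show ?thesis using one smult[OF one, of 0] unfolding complex_span_def by blast
  qed
  fix X Y assume "X \<in> complex_span R" "Y \<in> complex_span R"
  then obtain A B C D where X: "X = A + \<i> \<cdot>\<^sub>m B" and Y: "Y = C + \<i> \<cdot>\<^sub>m D"
    and R: "A \<in> R" "B \<in> R" "C \<in> R" "D \<in> R" unfolding complex_span_def by blast
  note c = R[THEN carr]
  have "X + Y = (A + C) + \<i> \<cdot>\<^sub>m (B + D)" unfolding X Y using c by (intro eq_matI) (auto simp: distrib_left)
  then show "X + Y \<in> complex_span R" using R add unfolding complex_span_def by blast
  have "X * Y = (A * C + \<i> \<cdot>\<^sub>m (B * C)) + (\<i> \<cdot>\<^sub>m (A * D) + \<i> \<cdot>\<^sub>m (\<i> \<cdot>\<^sub>m (B * D)))"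
    unfolding X Y using c
    by (simp add: add_mult_distrib_mat[of _ n n _ _ n] mult_add_distrib_mat[of _ n n _ n]
        mult_smult_assoc_mat[of _ n n _ n] mult_smult_distrib[of _ n n _ n] assoc_add_mat[of _ n n]
        add_smult_distrib_left_mat[of _ n n])
  also have "\<dots> = (A * C + of_real (- 1) \<cdot>\<^sub>m (B * D)) + \<i> \<cdot>\<^sub>m (A * D + B * C)"
    using c by (intro eq_matI) (auto simp: distrib_left simp del: index_mult_mat(1))
  finally show "X * Y \<in> complex_span R"
    using add[OF mult[OF R(1,3)] smult[OF mult[OF R(2,4)], of "- 1"]]
      add[OF mult[OF R(1,4)] mult[OF R(2,3)]]
    unfolding complex_span_def by blast
next
  fix X c assume "X \<in> complex_span R"
  then obtain A B where X: "X = A + \<i> \<cdot>\<^sub>m B" and R: "A \<in> R" "B \<in> R" unfolding complex_span_def by blast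
  note cc = R[THEN carr]
  have "c \<cdot>\<^sub>m X = (of_real (Re c) \<cdot>\<^sub>m A + of_real (- Im c) \<cdot>\<^sub>m B) + \<i> \<cdot>\<^sub>m (of_real (Re c) \<cdot>\<^sub>m B + of_real (Im c) \<cdot>\<^sub>m A)"
    unfolding X using cc by (intro eq_matI) (auto simp: complex_eq_iff algebra_simps)
  then show "c \<cdot>\<^sub>m X \<in> complex_span R"
    using add[OF smult[OF R(1), of "Re c"] smult[OF R(2), of "- Im c"]]
      add[OF smult[OF R(2), of "Re c"] smult[OF R(1), of "Im c"]]
    unfolding complex_span_def by blast
qed

section \<open>Irreducible sections of operator algebras\<close>

text \<open>Operators are functions on an abelian group; \<open>sc c\<close> is scaling by \<open>c\<close>.  The scalings
  belong to \<open>B\<close>, so \<open>B\<close>-invariant subgroups are complex subspaces.\<close>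
locale operator_algebra =
  fixes B :: "('v :: ab_group_add \<Rightarrow> 'v) set" and sc :: "complex \<Rightarrow> 'v \<Rightarrow> 'v"
  assumes diff: "T \<in> B \<Longrightarrow> T (x - y) = T x - T y"
    and closed_add: "T \<in> B \<Longrightarrow> S \<in> B \<Longrightarrow> (\<lambda>x. T x + S x) \<in> B"
    and closed_comp: "T \<in> B \<Longrightarrow> S \<in> B \<Longrightarrow> T \<circ> S \<in> B"
    and closed_sc: "sc c \<in> B"
    and sc_commute: "T \<in> B \<Longrightarrow> T (sc c x) = sc c (T x)"
    and sc_sc: "sc c (sc d x) = sc (c * d) x"
    and sc_add: "sc c x + sc d x = sc (c + d) x"
    and sc_zero: "sc 0 x = 0"
    and sc_one_image: "T \<in> B \<Longrightarrow> sc 1 (T x) = T x"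
begin

lemma zero: "T \<in> B \<Longrightarrow> T 0 = 0"
  using diff[of T 0 0] by simp

lemma uminus: "T \<in> B \<Longrightarrow> T (- x) = - T x"
  using diff[of T 0 x] zero[of T] by simp

lemma plus: "T \<in> B \<Longrightarrow> T (x + y) = T x + T y"
  using diff[of T x "- y"] uminus[of T y] by simp

lemma sc_minus: "- sc c x = sc (- c) x"
  using sc_add[of c x "- c"] by (simp add: sc_zero minus_unique)

lemma closed_sub_sc: "T \<in> B \<Longrightarrow> S \<in> B \<Longrightarrow> (\<lambda>x. T x - sc c (S x)) \<in> B"
  using closed_add[OF _ closed_comp[OF closed_sc], of T S "- c"] by (simp add: sc_minus[symmetric] o_def)

lemma closed_diff: "T \<in> B \<Longrightarrow> S \<in> B \<Longrightarrow> (\<lambda>x. T x - S x) \<in> B"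
  using closed_sub_sc[of T S 1] by (simp add: sc_one_image)

definition invariant :: "'v set \<Rightarrow> bool" where
  "invariant W \<longleftrightarrow> 0 \<in> W \<and> (\<forall>x\<in>W. \<forall>y\<in>W. x + y \<in> W) \<and> (\<forall>T\<in>B. \<forall>x\<in>W. T x \<in> W)"

definition left_ideal :: "('v \<Rightarrow> 'v) set \<Rightarrow> bool" where
  "left_ideal L \<longleftrightarrow> L \<subseteq> B \<and> L \<noteq> {} \<and> (\<forall>T\<in>L. \<forall>S\<in>L. (\<lambda>x. T x + S x) \<in> L) \<and> (\<forall>T\<in>B. \<forall>S\<in>L. T \<circ> S \<in> L)"

lemma invariant_uminus: "invariant W \<Longrightarrow> x \<in> W \<Longrightarrow> sc 1 x = x \<Longrightarrow> - x \<in> W"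
  using closed_sc[of "- 1"] sc_minus[of 1 x] unfolding invariant_def by metis

end

text \<open>The assumption \<open>roots\<close> says that every operator is annihilated by a product of linear factors.\<close>
locale irreducible_section = operator_algebra B sc for B :: "('v :: ab_group_add \<Rightarrow> 'v) set" and sc +
  fixes U W :: "'v set"
  assumes invU: "invariant U" and invW: "invariant W" and UW: "U \<subseteq> W"
    and sc_one: "x \<in> W \<Longrightarrow> sc 1 x = x"
    and irred: "\<And>W'. invariant W' \<Longrightarrow> U \<subseteq> W' \<Longrightarrow> W' \<subseteq> W \<Longrightarrow> W' = U \<or> W' = W"
    and roots: "\<And>R. R \<in> B \<Longrightarrow> \<exists>es. \<forall>x. foldr (\<lambda>e f y. R (f y) - sc e (f y)) es (sc 1) x = 0"
begin

lemma Wadd: "x \<in> W \<Longrightarrow> y \<in> W \<Longrightarrow> x + y \<in> W" using invW by (simp add: invariant_def)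
lemma WB: "T \<in> B \<Longrightarrow> x \<in> W \<Longrightarrow> T x \<in> W" using invW by (simp add: invariant_def)
lemma Wdiff: "x \<in> W \<Longrightarrow> y \<in> W \<Longrightarrow> x - y \<in> W"
  using Wadd[of x "- y"] invariant_uminus[OF invW, of y] sc_one[of y] by simp
lemma Uadd: "x \<in> U \<Longrightarrow> y \<in> U \<Longrightarrow> x + y \<in> U" using invU by (simp add: invariant_def)
lemma UB: "T \<in> B \<Longrightarrow> x \<in> U \<Longrightarrow> T x \<in> U" using invU by (simp add: invariant_def)
lemma U0: "0 \<in> U" using invU by (simp add: invariant_def)
lemma Uuminus: "x \<in> U \<Longrightarrow> - x \<in> U"
  using invariant_uminus[OF invU, of x] sc_one[of x] UW by auto
lemma Udiff: "x \<in> U \<Longrightarrow> y \<in> U \<Longrightarrow> x - y \<in> U"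
  using Uadd[of x "- y"] Uuminus[of y] by simp
lemma Udiff_iff: "x - y \<in> U \<Longrightarrow> x \<in> U \<longleftrightarrow> y \<in> U"
  using Uadd[of "x - y" y] Udiff[of x "x - y"] by auto

lemma left_ideal_minus:
  assumes "left_ideal L" "T \<in> L" "S \<in> L"
  shows "(\<lambda>x. T x - sc c (S x)) \<in> L"
proof -
  have "sc (- c) \<circ> S \<in> L" using assms closed_sc by (auto simp: left_ideal_def)
  then have "(\<lambda>x. T x + (sc (- c) \<circ> S) x) \<in> L" using assms unfolding left_ideal_def by blast
  then show ?thesis by (simp add: sc_minus[symmetric])
qed

lemma left_ideal_zero:
  assumes "left_ideal L" shows "\<exists>Z\<in>L. \<forall>x. Z x = 0"
proof -
  obtain T where "T \<in> L" using assms by (auto simp: left_ideal_def)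
  then have "sc 0 \<circ> T \<in> L" using assms closed_sc by (auto simp: left_ideal_def)
  then show ?thesis by (rule bexI[rotated]) (simp add: sc_zero)
qed

text \<open>The vectors congruent modulo \<open>U\<close> to some \<open>T u\<close> with
  \<open>T\<close> in \<open>L\<close> form an invariant subspace between \<open>U\<close> and
  \<open>W\<close>. It contains \<open>T0 u\<close>, hence is not \<open>U\<close>, and
  irreducibility makes it all of \<open>W\<close>.\<close>

lemma left_ideal_reaches:
  assumes L: "left_ideal L" and u: "u \<in> W" and T0: "T0 \<in> L" "T0 u \<notin> U" and w: "w \<in> W"
  obtains T where "T \<in> L" "T u - w \<in> U"
proof -
  have LB: "T \<in> B" if "T \<in> L" for T using L that by (auto simp: left_ideal_def)
  define W' where "W' = {y \<in> W. \<exists>T\<in>L. T u - y \<in> U}"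
  have inv: "invariant W'"
    unfolding invariant_def
  proof (intro conjI ballI)
    obtain Z where "Z \<in> L" "\<forall>x. Z x = 0" using left_ideal_zero[OF L] by blast
    then show "0 \<in> W'" unfolding W'_def using U0 UW by (auto intro!: bexI[of _ Z])
    fix x y assume "x \<in> W'" "y \<in> W'"
    then obtain T S where TS: "x \<in> W" "y \<in> W" "T \<in> L" "S \<in> L" "T u - x \<in> U" "S u - y \<in> U"
      unfolding W'_def by blast
    have "(T u + S u) - (x + y) \<in> U" using Uadd[OF TS(5,6)] by (simp add: algebra_simps)
    moreover have "(\<lambda>x. T x + S x) \<in> L" using L TS unfolding left_ideal_def by blast
    ultimately show "x + y \<in> W'" unfolding W'_def using TS Wadd by auto
  next
    fix T x assume T: "T \<in> B" and "x \<in> W'"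
    then obtain S where S: "x \<in> W" "S \<in> L" "S u - x \<in> U" unfolding W'_def by blast
    have "T (S u) - T x \<in> U" using UB[OF T S(3)] diff[OF T] by simp
    moreover have "T \<circ> S \<in> L" using L S T unfolding left_ideal_def by blast
    ultimately show "T x \<in> W'"
      unfolding W'_def using S T WB by (auto intro!: bexI[of _ "T \<circ> S"])
  qed
  have "U \<subseteq> W'"
  proof
    fix x assume x: "x \<in> U"
    obtain Z where "Z \<in> L" "\<forall>x. Z x = 0" using left_ideal_zero[OF L] by blast
    then show "x \<in> W'" unfolding W'_def using x Uuminus UW by (auto intro!: bexI[of _ Z])
  qed
  moreover have "T0 u \<in> W'" unfolding W'_def using T0 U0 WB[OF LB u] by force
  ultimately have "W' = W" using irred[OF inv] T0 unfolding W'_def by blast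
  then show thesis using w that unfolding W'_def by blast
qed

text \<open>Finds an eigenvalue without finite dimension. The outermost factor of the product is
  absorbed into \<open>T\<close>, giving \<open>T \<circ> R - e T\<close>, which is again in
  \<open>L\<close> because \<open>R\<close> is. At the start \<open>T u\<close> lies outside
  \<open>U\<close>, while \<open>T\<close> applied to the full product lies inside; the factor at
  which membership changes supplies \<open>e\<close>.\<close>

lemma foldr_roots:
  assumes L: "left_ideal L" and R: "R \<in> L" and T: "T \<in> L" "T u \<notin> U" and u: "u \<in> W"
    and "T (foldr (\<lambda>e f y. R (f y) - sc e (f y)) es (sc 1) u) \<in> U"
  shows "\<exists>T1\<in>L. \<exists>e. T1 u \<notin> U \<and> T1 (R u - sc e u) \<in> U"
  using T assms(6)
proof (induction es arbitrary: T)
  case Nil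
  then show ?case using sc_one[OF u] by simp
next
  case (Cons e es)
  have RB: "R \<in> B" and TB: "T \<in> B" using L R Cons.prems by (auto simp: left_ideal_def)
  define T' where "T' = (\<lambda>x. (T \<circ> R) x - sc e (T x))"
  have T': "T' \<in> L" unfolding T'_def
    using left_ideal_minus[OF L, of "T \<circ> R" T e] L R TB Cons.prems(1) by (auto simp: left_ideal_def)
  have eq: "T (R y - sc e y) = T' y" for y
    by (simp add: T'_def diff[OF TB] sc_commute[OF TB])
  show ?case
  proof (cases "T' u \<in> U")
    case True
    then show ?thesis using Cons.prems(1,2) eq[of u] by metis
  next
    case False
    then show ?thesis using Cons.IH[OF T' False] Cons.prems(3) eq by simp
  qed
qed

text \<open>Schur's lemma in disguise: if \<open>T u \<mapsto> T u'\<close> is well defined on \<open>L u\<close> modulo \<open>U\<close>, then it is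
  an endomorphism of the irreducible module \<open>W / U\<close>, hence a scalar.\<close>
lemma schur:
  assumes L: "left_ideal L" and u: "u \<in> W" and u': "u' \<in> W" and T0: "T0 \<in> L" "T0 u \<notin> U"
    and wd: "\<And>T. T \<in> L \<Longrightarrow> T u \<in> U \<Longrightarrow> T u' \<in> U"
  obtains e where "\<And>T. T \<in> L \<Longrightarrow> T (u' - sc e u) \<in> U"
proof -
  have LB: "T \<in> B" if "T \<in> L" for T using L that by (auto simp: left_ideal_def)
  \<comment> \<open>\<open>R\<close> carries \<open>u\<close> to \<open>u'\<close> modulo
    \<open>U\<close> and lies in \<open>L\<close>; an eigenvalue of \<open>R\<close> on
    \<open>u\<close>, as seen by some \<open>T1\<close>, is the candidate for the scalar.\<close>
  obtain R where R: "R \<in> L" "R u - u' \<in> U" by (rule left_ideal_reaches[OF L u T0 u'])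
  obtain es where "\<forall>x. foldr (\<lambda>e f y. R (f y) - sc e (f y)) es (sc 1) x = 0"
    using roots[OF LB[OF R(1)]] by blast
  then have "T0 (foldr (\<lambda>e f y. R (f y) - sc e (f y)) es (sc 1) u) \<in> U"
    using zero[OF LB[OF T0(1)]] U0 by simp
  from foldr_roots[OF L R(1) T0 u this] obtain T1 e where
    T1: "T1 \<in> L" "T1 u \<notin> U" "T1 (R u - sc e u) \<in> U" by blast
  have T1B: "T1 \<in> B" using T1 LB by blast
  have "T1 (u' - sc e u) \<in> U"
  proof -
    have "T1 (R u - sc e u) - T1 (u' - sc e u) = T1 (R u - u')"
      using T1B by (simp add: diff[symmetric])
    then show ?thesis using T1(3) UB[OF T1B R(2)] Udiff_iff by metis
  qed
  note T1' = this
  \<comment> \<open>A single \<open>T1\<close> in \<open>L\<close> kills \<open>u' - sc e u\<close>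
    modulo \<open>U\<close> without killing \<open>u\<close>. The left ideal of all such
    annihilators in \<open>L\<close> therefore still reaches every vector of \<open>W\<close> from
    \<open>u\<close>.\<close>
  let ?M = "{T \<in> L. T (u' - sc e u) \<in> U}"
  have M: "left_ideal ?M"
    unfolding left_ideal_def
  proof (intro conjI ballI)
    show "?M \<subseteq> B" using LB by blast
    show "?M \<noteq> {}" using T1(1) T1' by blast
    fix T S assume "T \<in> ?M" "S \<in> ?M"
    then show "(\<lambda>x. T x + S x) \<in> ?M" using L Uadd unfolding left_ideal_def by simp
  next
    fix T S assume "T \<in> B" "S \<in> ?M"
    then show "T \<circ> S \<in> ?M" using L UB unfolding left_ideal_def by simp
  qed
  have "T (u' - sc e u) \<in> U" if T: "T \<in> L" for T
  proof -
    have "T1 \<in> ?M" using T1(1) T1' by blast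
    \<comment> \<open>\<open>S\<close> kills \<open>u' - sc e u\<close> and agrees with
      \<open>T\<close> on \<open>u\<close>. By the hypothesis \<open>wd\<close> it then agrees with
      \<open>T\<close> on \<open>u'\<close> also, so \<open>T\<close> kills the same vector.\<close>
    from left_ideal_reaches[OF M u this T1(2) WB[OF LB[OF T] u]]
    obtain S where S: "S \<in> L" "S (u' - sc e u) \<in> U" "S u - T u \<in> U" by auto
    have TB: "T \<in> B" and SB: "S \<in> B" using LB T S by auto
    have "(\<lambda>x. S x - sc 1 (T x)) u \<in> U" using S(3) sc_one[OF WB[OF TB u]] by simp
    from wd[OF left_ideal_minus[OF L S(1) T] this] have "S u' - T u' \<in> U"
      using sc_one[OF WB[OF TB u']] by simp
    moreover have "S (sc e u) - T (sc e u) \<in> U"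
      using UB[OF closed_sc S(3), of e] by (simp add: sc_commute TB SB diff[OF closed_sc])
    ultimately have "S (u' - sc e u) - T (u' - sc e u) \<in> U"
      using Udiff by (force simp: diff TB SB algebra_simps)
    then show ?thesis using S(2) Udiff_iff by blast
  qed
  then show thesis by (rule that)
qed

section \<open>Density on three vectors\<close>

definition dependent3 :: "'v \<Rightarrow> 'v \<Rightarrow> 'v \<Rightarrow> bool" where
  "dependent3 x y z \<longleftrightarrow> (\<exists>a b c. (a \<noteq> 0 \<or> b \<noteq> 0 \<or> c \<noteq> 0) \<and> sc a x + sc b y + sc c z \<in> U)"

lemma dependent3I:
  "sc a x + sc b y + sc c z \<in> U \<Longrightarrow> a \<noteq> 0 \<or> b \<noteq> 0 \<or> c \<noteq> 0 \<Longrightarrow> dependent3 x y z"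
  unfolding dependent3_def by blast

lemma B_left_ideal: "left_ideal B"
  using closed_add closed_comp closed_sc by (auto simp: left_ideal_def)

lemma separate2:
  assumes u: "u1 \<in> W" "u2 \<in> W" and s: "\<And>T. T \<in> B \<Longrightarrow> T u1 \<in> U \<Longrightarrow> T u2 \<in> U"
  shows "u1 \<in> U \<or> (\<exists>e. u2 - sc e u1 \<in> U)"
proof (cases "u1 \<in> U")
  case False
  then have "sc 1 u1 \<notin> U" using sc_one u by simp
  from schur[OF B_left_ideal u closed_sc this] s
  obtain e where e: "\<And>T. T \<in> B \<Longrightarrow> T (u2 - sc e u1) \<in> U" by metis
  show ?thesis using e[OF closed_sc[of 1]] sc_one[OF Wdiff[OF u(2) WB[OF closed_sc u(1)]]] by auto
qed simp

lemma annihilator_left_ideal: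
  shows "left_ideal {T \<in> B. T u \<in> U}"
proof -
  have "sc 0 \<in> {T \<in> B. T u \<in> U}" using sc_zero U0 closed_sc by simp
  then show ?thesis using closed_add closed_comp Uadd UB unfolding left_ideal_def by auto
qed

text \<open>The inductive step of the density theorem. If no such \<open>T\<close> existed, Schur's
  lemma for the left ideal killing \<open>u1\<close> modulo \<open>U\<close> would make
  \<open>u3 - sc e u2\<close> vanish under everything that kills \<open>u1\<close>; by
  \<open>separate2\<close> it would be a multiple of \<open>u1\<close> modulo \<open>U\<close>, a
  dependence. That this ideal does not kill \<open>u2\<close> again follows from
  \<open>separate2\<close>.\<close>

lemma separate3:
  assumes u: "u1 \<in> W" "u2 \<in> W" "u3 \<in> W" and ind: "\<not> dependent3 u1 u2 u3"
  obtains T where "T \<in> B" "T u1 \<in> U" "T u2 \<in> U" "T u3 \<notin> U"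
proof (rule ccontr)
  assume "\<not> thesis"
  then have s: "\<And>T. T \<in> {T \<in> B. T u1 \<in> U} \<Longrightarrow> T u2 \<in> U \<Longrightarrow> T u3 \<in> U" using that by blast
  have one: "sc 1 u1 = u1" "sc 1 u2 = u2" "sc 1 u3 = u3" using sc_one u by auto
  have sub: "x - sc e y = x + sc (- e) y" for x y e by (simp add: sc_minus[symmetric])
  have u1: "u1 \<notin> U"
  proof
    assume "u1 \<in> U"
    then have "sc 1 u1 + sc 0 u2 + sc 0 u3 \<in> U" using Uadd by (simp add: one sc_zero)
    from dependent3I[OF this] show False using ind by simp
  qed
  have "\<nexists>e. u2 - sc e u1 \<in> U"
  proof
    assume "\<exists>e. u2 - sc e u1 \<in> U"
    then obtain e where "u2 - sc e u1 \<in> U" by blast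
    then have "sc (- e) u1 + sc 1 u2 + sc 0 u3 \<in> U" by (simp add: sub one sc_zero add.commute)
    from dependent3I[OF this] show False using ind by simp
  qed
  with separate2[OF u(1,2)] u1 obtain T0 where T0: "T0 \<in> B" "T0 u1 \<in> U" "T0 u2 \<notin> U" by blast
  then have T0': "T0 \<in> {T \<in> B. T u1 \<in> U}" by simp
  obtain e where e: "\<And>T. T \<in> {T \<in> B. T u1 \<in> U} \<Longrightarrow> T (u3 - sc e u2) \<in> U"
    by (rule schur[OF annihilator_left_ideal[of u1] u(2,3) T0' T0(3)]) (use s in auto)
  then have e: "\<And>T. T \<in> B \<Longrightarrow> T u1 \<in> U \<Longrightarrow> T (u3 - sc e u2) \<in> U" by simp
  have "u3 - sc e u2 \<in> W" using u Wdiff WB closed_sc by blast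
  from separate2[OF u(1) this] e u1 obtain d where "u3 - sc e u2 - sc d u1 \<in> U" by metis
  then have "sc (- d) u1 + sc (- e) u2 + sc 1 u3 \<in> U" by (simp add: sub one add_ac)
  from dependent3I[OF this] show False using ind by simp
qed

lemma dependent3_perm:
  "dependent3 y x z \<Longrightarrow> dependent3 x y z" "dependent3 x z y \<Longrightarrow> dependent3 x y z"
proof -
  show "dependent3 x y z" if d: "dependent3 y x z"
  proof -
    obtain a b c where "a \<noteq> 0 \<or> b \<noteq> 0 \<or> c \<noteq> 0" "sc a y + sc b x + sc c z \<in> U"
      using d unfolding dependent3_def by blast
    then have "b \<noteq> 0 \<or> a \<noteq> 0 \<or> c \<noteq> 0" "sc b x + sc a y + sc c z \<in> U" by (simp_all add: add_ac disj_commute disj_left_commute)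
    then show ?thesis by (intro dependent3I)
  qed
  show "dependent3 x y z" if d: "dependent3 x z y"
  proof -
    obtain a b c where "a \<noteq> 0 \<or> b \<noteq> 0 \<or> c \<noteq> 0" "sc a x + sc b z + sc c y \<in> U"
      using d unfolding dependent3_def by blast
    then have "a \<noteq> 0 \<or> c \<noteq> 0 \<or> b \<noteq> 0" "sc a x + sc c y + sc b z \<in> U" by (simp_all add: add_ac disj_commute disj_left_commute)
    then show ?thesis by (intro dependent3I)
  qed
qed

lemma prescribe1:
  assumes u: "u1 \<in> W" "u2 \<in> W" "u3 \<in> W" and ind: "\<not> dependent3 u1 u2 u3" and w: "w \<in> W"
  obtains T where "T \<in> B" "T u1 \<in> U" "T u2 \<in> U" "T u3 - w \<in> U"
proof -
  obtain T where T: "T \<in> B" "T u1 \<in> U" "T u2 \<in> U" "T u3 \<notin> U" by (rule separate3[OF u ind])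
  have "sc 1 (T u3) \<notin> U" using T WB u sc_one by simp
  from left_ideal_reaches[OF B_left_ideal WB[OF T(1) u(3)] closed_sc this w]
  obtain S where S: "S \<in> B" "S (T u3) - w \<in> U" .
  show thesis by (rule that[of "S \<circ> T"]) (use S T closed_comp UB in auto)
qed

text \<open>Jacobson density for three vectors: operators that kill two of the vectors modulo
  \<open>U\<close> and prescribe the image of the third are added up.\<close>

lemma prescribe3:
  assumes u: "u1 \<in> W" "u2 \<in> W" "u3 \<in> W" and ind: "\<not> dependent3 u1 u2 u3"
    and w: "w1 \<in> W" "w2 \<in> W" "w3 \<in> W"
  obtains T where "T \<in> B" "T u1 - w1 \<in> U" "T u2 - w2 \<in> U" "T u3 - w3 \<in> U"
proof -
  obtain T3 where T3: "T3 \<in> B" "T3 u1 \<in> U" "T3 u2 \<in> U" "T3 u3 - w3 \<in> U"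
    by (rule prescribe1[OF u ind w(3)])
  obtain T2 where T2: "T2 \<in> B" "T2 u1 \<in> U" "T2 u3 \<in> U" "T2 u2 - w2 \<in> U"
    using prescribe1[OF u(1,3,2) _ w(2)] ind dependent3_perm by metis
  obtain T1 where T1: "T1 \<in> B" "T1 u2 \<in> U" "T1 u3 \<in> U" "T1 u1 - w1 \<in> U"
    using prescribe1[OF u(2,3,1) _ w(1)] ind dependent3_perm by metis
  let ?T = "\<lambda>x. T1 x + (T2 x + T3 x)"
  have "?T \<in> B" using closed_add[OF T1(1) closed_add[OF T2(1) T3(1)]] .
  moreover have "?T u1 - w1 \<in> U" using Uadd[OF T1(4) Uadd[OF T2(2) T3(2)]] by (simp add: algebra_simps)
  moreover have "?T u2 - w2 \<in> U" using Uadd[OF T1(2) Uadd[OF T2(4) T3(3)]] by (simp add: algebra_simps)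
  moreover have "?T u3 - w3 \<in> U" using Uadd[OF T1(3) Uadd[OF T2(3) T3(4)]] by (simp add: algebra_simps)
  ultimately show thesis by (rule that)
qed

text \<open>If some \<open>x\<close> moved \<open>w\<close> outside \<open>U\<close>, the ideal
  would contain a \<open>y\<close> with \<open>y w\<close> congruent to \<open>w\<close>. All powers
  of \<open>y\<close> would then fix \<open>w\<close> modulo \<open>U\<close>, and nilpotence would
  put \<open>w\<close>, hence \<open>x w\<close>, into \<open>U\<close>.\<close>

lemma nil_ideal_acts_trivially:
  assumes J: "left_ideal J" and right: "\<And>x T. x \<in> J \<Longrightarrow> T \<in> B \<Longrightarrow> x \<circ> T \<in> J"
    and nil: "\<And>x. x \<in> J \<Longrightarrow> \<exists>k. \<forall>w. (x ^^ k) w = 0"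
    and x: "x \<in> J" and w: "w \<in> W"
  shows "x w \<in> U"
proof (rule ccontr)
  assume "x w \<notin> U"
  obtain y where y: "y \<in> J" "y w - w \<in> U"
    by (rule left_ideal_reaches[OF J w x \<open>x w \<notin> U\<close> w])
  have yB: "y \<in> B" using J y by (auto simp: left_ideal_def)
  have "(y ^^ k) w - w \<in> U" for k
  proof (induction k)
    case (Suc k)
    have "y ((y ^^ k) w) - y w \<in> U" using UB[OF yB Suc] diff[OF yB] by simp
    from Uadd[OF this y(2)] show ?case by simp
  qed (use U0 in simp)
  moreover obtain k where "(y ^^ k) w = 0" using nil[OF y(1)] by blast
  ultimately have "- w \<in> U" by (metis diff_0)
  then have "w \<in> U" using Uuminus by fastforce
  then have "x w \<in> U" using UB J x by (auto simp: left_ideal_def)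
  then show False using \<open>x w \<notin> U\<close> by simp
qed

text \<open>On three independent vectors one can prescribe \<open>X = e\<^sub>1\<^sub>2 + 2 e\<^sub>2\<^sub>3\<close> and \<open>Y = e\<^sub>2\<^sub>1 + e\<^sub>3\<^sub>2\<close>;
  then \<open>[X,Y] = diag(1,1,-2)\<close> and \<open>[[X,Y]\<^sup>2, X] = - 6 e\<^sub>2\<^sub>3\<close>.\<close>
lemma dependent3_if_identity:
  assumes id: "\<And>X Y w. X \<in> B \<Longrightarrow> Y \<in> B \<Longrightarrow> w \<in> W \<Longrightarrow>
      (let C = (\<lambda>v. X (Y v) - Y (X v)) in C (C (X w)) - X (C (C w))) \<in> U"
    and u: "u1 \<in> W" "u2 \<in> W" "u3 \<in> W"
  shows "dependent3 u1 u2 u3"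
proof (rule ccontr)
  assume ind: "\<not> dependent3 u1 u2 u3"
  have W0: "0 \<in> W" using U0 UW by blast
  have one: "sc 1 u2 = u2" "sc 1 u3 = u3" using sc_one u by auto
  have two: "sc 2 u2 \<in> W" using WB closed_sc u by blast
  obtain X where X: "X \<in> B" "X u1 - 0 \<in> U" "X u2 - u1 \<in> U" "X u3 - sc 2 u2 \<in> U"
    by (rule prescribe3[OF u ind W0 u(1) two])
  obtain Y where Y: "Y \<in> B" "Y u1 - u2 \<in> U" "Y u2 - u3 \<in> U" "Y u3 - 0 \<in> U"
    by (rule prescribe3[OF u ind u(2,3) W0])
  define C where "C = (\<lambda>v. X (Y v) - Y (X v))"
  have CB: "C \<in> B"
    using closed_diff[OF closed_comp[OF X(1) Y(1)] closed_comp[OF Y(1) X(1)]] by (simp add: C_def o_def)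
  have step: "T x - z \<in> U" if "T \<in> B" "x - y \<in> U" "T y - z \<in> U" for T x y z
    using Uadd[OF UB[OF that(1,2)] that(3)] diff[OF that(1)] by simp
  have C1: "C u1 - u1 \<in> U"
    using Udiff[OF step[OF X(1) Y(2) X(3)] step[OF Y(1) X(2), of 0]] U0 zero[OF Y(1)]
    by (simp add: C_def algebra_simps)
  have two_u2: "sc 2 u2 = u2 + u2" using sc_add[of 1 u2 1] one by simp
  have C2: "C u2 - u2 \<in> U"
    using Udiff[OF step[OF X(1) Y(3) X(4)] step[OF Y(1) X(3) Y(2)]]
    by (simp add: C_def two_u2 algebra_simps)
  have Y22: "Y (sc 2 u2) - sc 2 u3 \<in> U"
    using UB[OF closed_sc Y(3), of 2] by (simp add: diff[OF closed_sc] sc_commute Y(1))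
  have C3: "C u3 - sc (- 2) u3 \<in> U"
    using Udiff[OF step[OF X(1) Y(4), of 0] step[OF Y(1) X(4) Y22]] U0 zero[OF X(1)]
    by (simp add: C_def sc_minus[symmetric] algebra_simps)
  have scU: "T (sc c x) - sc c z \<in> U" if "T \<in> B" "T x - z \<in> U" for T c x z
    using UB[OF closed_sc that(2), of c] by (simp add: diff[OF closed_sc] sc_commute that(1))
  \<comment> \<open>The square of \<open>C\<close> has eigenvalue 4 on \<open>u3\<close> but 1 on
    \<open>u2\<close>, whereas \<open>X\<close> sends \<open>u3\<close> to twice \<open>u2\<close>;
    so the two orders of composition give 8 and 2 times \<open>u2\<close>.\<close>
  have "C (C u3) - sc (- 2) (sc (- 2) u3) \<in> U"
    by (rule step[OF CB C3 scU[OF CB C3]])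
  then have "C (C u3) - sc 4 u3 \<in> U" by (simp add: sc_sc)
  from step[OF X(1) this scU[OF X(1) X(4)]] have XCC: "X (C (C u3)) - sc 8 u2 \<in> U"
    by (simp add: sc_sc)
  have "C (X u3) - sc 2 u2 \<in> U" by (rule step[OF CB X(4) scU[OF CB C2]])
  from step[OF CB this scU[OF CB C2]] have "C (C (X u3)) - sc 2 u2 \<in> U" .
  from Udiff[OF this XCC] have "C (C (X u3)) - X (C (C u3)) - (sc 2 u2 - sc 8 u2) \<in> U"
    by (simp add: algebra_simps)
  moreover have "C (C (X u3)) - X (C (C u3)) \<in> U"
    using id[OF X(1) Y(1) u(3)] by (simp add: C_def Let_def)
  ultimately have "sc 2 u2 - sc 8 u2 \<in> U" using Udiff_iff by blast
  then have "sc 0 u1 + sc (- 6) u2 + sc 0 u3 \<in> U"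
    using sc_add[of 2 u2 "- 8"] by (simp add: sc_zero sc_minus[symmetric])
  from dependent3I[OF this] have "dependent3 u1 u2 u3" by simp
  with ind show False ..
qed

end

section \<open>Quaternionic matrices as complex matrices\<close>

definition qfst :: "quat \<Rightarrow> complex" where "qfst q = Complex (qRe q) (qIm1 q)"
definition qsnd :: "quat \<Rightarrow> complex" where "qsnd q = Complex (qIm2 q) (qIm3 q)"
definition qpair :: "complex \<Rightarrow> complex \<Rightarrow> quat" where
  "qpair a b = Quat (Re a) (Im a) (Re b) (Im b)"
abbreviation qj :: quat where "qj \<equiv> qpair 0 1"

lemmas qpair_defs = qfst_def qsnd_def qpair_def

lemma qpair_simps [simp]:
  "qfst (qpair a b) = a" "qsnd (qpair a b) = b" "qpair (qfst q) (qsnd q) = q"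
  by (simp_all add: qpair_defs quat_eq_iff)

lemma qpair_add [simp]: "qfst (x + y) = qfst x + qfst y" "qsnd (x + y) = qsnd x + qsnd y"
  by (simp_all add: qpair_defs complex_eq_iff)

lemma qpair_minus [simp]: "qfst (x - y) = qfst x - qfst y" "qsnd (x - y) = qsnd x - qsnd y"
  by (simp_all add: qpair_defs complex_eq_iff)

lemma qpair_0 [simp]: "qfst 0 = 0" "qsnd 0 = 0" "qfst 1 = 1" "qsnd 1 = 0" "qpair 0 0 = 0"
  by (simp_all add: qpair_defs complex_eq_iff quat_eq_iff)

text \<open>A quaternion is written \<open>a + b j\<close> with complex \<open>a\<close>, \<open>b\<close>; note \<open>j a = cnj a j\<close>.\<close>
lemma qpair_mult:
  "qfst (x * y) = qfst x * qfst y - qsnd x * cnj (qsnd y)"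
  "qsnd (x * y) = qfst x * qsnd y + qsnd x * cnj (qfst y)"
  by (simp_all add: qpair_defs complex_eq_iff algebra_simps)

lemma qpair_sum: "qfst (sum f A) = (\<Sum>x\<in>A. qfst (f x))" "qsnd (sum f A) = (\<Sum>x\<in>A. qsnd (f x))"
  by (induction A rule: infinite_finite_induct) simp_all

lemma quat_eq_qpair_iff: "x = y \<longleftrightarrow> qfst x = qfst y \<and> qsnd x = qsnd y"
  by (metis qpair_simps(3))

lemma qpair_of_real [simp]: "qfst (of_real c) = of_real c" "qsnd (of_real c) = 0"
  by (simp_all add: qpair_defs complex_eq_iff of_real_def scaleR_quat_def)

lemma sum_double: "(\<Sum>k<2 * n. f k) = (\<Sum>k<n. f k) + (\<Sum>k<n. f (n + k))" for f :: "nat \<Rightarrow> 'a :: comm_monoid_add"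
proof -
  have "{..<2 * n} = {..<n} \<union> {n..<n + n}" by auto
  then have "(\<Sum>k<2 * n. f k) = (\<Sum>k<n. f k) + sum f {n..<n + n}"
    by (simp add: sum.union_disjoint ivl_disj_int)
  also have "sum f {n..<n + n} = (\<Sum>k<n. f (n + k))"
    using sum.shift_bounds_nat_ivl[of f 0 n n] by (simp add: atLeast0LessThan add.commute)
  finally show ?thesis .
qed

lemma lt_double_cases:
  fixes i n :: nat
  assumes "i < 2 * n"
  obtains "i < n" | k where "k < n" "i = n + k"
  using assms by (metis add_diff_inverse_nat less_diff_conv2 mult_2 nat_add_left_cancel_less)

text \<open>For \<open>A = P + Q j\<close> with complex \<open>P\<close>, \<open>Q\<close> this is
  the standard embedding with rows of blocks \<open>P, Q\<close> and \<open>- cnj Q, cnj P\<close>: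
  the matrix of left multiplication by \<open>A\<close> in the right complex coordinates of
  \<open>venc\<close>.\<close>

definition qchi :: "nat \<Rightarrow> quat mat \<Rightarrow> complex mat" where
  "qchi n A = mat (2 * n) (2 * n) (\<lambda>(i, j).
     if i < n then (if j < n then qfst (A $$ (i, j)) else qsnd (A $$ (i, j - n)))
     else (if j < n then - cnj (qsnd (A $$ (i - n, j))) else cnj (qfst (A $$ (i - n, j - n)))))"

lemma qchi_carrier [simp]: "qchi n A \<in> carrier_mat (2 * n) (2 * n)"
  "dim_row (qchi n A) = 2 * n" "dim_col (qchi n A) = 2 * n"
  by (simp_all add: qchi_def)

lemma qchi_index:
  assumes "i < n" "j < n"
  shows "qchi n A $$ (i, j) = qfst (A $$ (i, j))" "qchi n A $$ (i, n + j) = qsnd (A $$ (i, j))"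
    "qchi n A $$ (n + i, j) = - cnj (qsnd (A $$ (i, j)))"
    "qchi n A $$ (n + i, n + j) = cnj (qfst (A $$ (i, j)))"
  using assms by (simp_all add: qchi_def)

lemma double_mat_eqI:
  assumes "A \<in> carrier_mat (2 * n) (2 * n)" "B \<in> carrier_mat (2 * n) (2 * n)"
    and "\<And>i j. i < n \<Longrightarrow> j < n \<Longrightarrow> A $$ (i, j) = B $$ (i, j) \<and> A $$ (i, n + j) = B $$ (i, n + j)
      \<and> A $$ (n + i, j) = B $$ (n + i, j) \<and> A $$ (n + i, n + j) = B $$ (n + i, n + j)"
  shows "A = B"
proof (rule eq_matI)
  fix i j assume "i < dim_row B" "j < dim_col B"
  then have "i < 2 * n" "j < 2 * n" using assms by auto
  then show "A $$ (i, j) = B $$ (i, j)"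
    by (elim lt_double_cases) (use assms(3) in auto)
qed (use assms in auto)

lemma qchi_mult:
  assumes "A \<in> carrier_mat n n" "B \<in> carrier_mat n n"
  shows "qchi n (A * B) = qchi n A * qchi n B"
proof (rule double_mat_eqI[of _ n])
  fix i j assume ij: "i < n" "j < n"
  have AB: "(A * B) $$ (i, j) = (\<Sum>k<n. A $$ (i, k) * B $$ (k, j))"
    using assms ij by (simp add: mat_mult_index_sum del: index_mult_mat(1))
  have idx: "(qchi n A * qchi n B) $$ (a, b) = (\<Sum>k<n. qchi n A $$ (a, k) * qchi n B $$ (k, b))
      + (\<Sum>k<n. qchi n A $$ (a, n + k) * qchi n B $$ (n + k, b))" if "a < 2 * n" "b < 2 * n" for a b
    using that by (simp add: mat_mult_index_sum sum_double del: index_mult_mat(1))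
  show "qchi n (A * B) $$ (i, j) = (qchi n A * qchi n B) $$ (i, j) \<and>
       qchi n (A * B) $$ (i, n + j) = (qchi n A * qchi n B) $$ (i, n + j) \<and>
       qchi n (A * B) $$ (n + i, j) = (qchi n A * qchi n B) $$ (n + i, j) \<and>
       qchi n (A * B) $$ (n + i, n + j) = (qchi n A * qchi n B) $$ (n + i, n + j)"
    using ij
    by (simp add: idx qchi_index AB qpair_sum qpair_mult sum.distrib sum_subtractf sum_negf
        del: index_mult_mat(1) cong: sum.cong_simp)
qed auto

lemma qchi_add:
  assumes "A \<in> carrier_mat n n" "B \<in> carrier_mat n n"
  shows "qchi n (A + B) = qchi n A + qchi n B"
  by (rule double_mat_eqI[of _ n]) (use assms in \<open>auto simp: qchi_index\<close>)

lemma qchi_minus: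
  assumes "A \<in> carrier_mat n n" "B \<in> carrier_mat n n"
  shows "qchi n (A - B) = qchi n A - qchi n B"
  by (rule double_mat_eqI[of _ n]) (use assms in \<open>auto simp: qchi_index intro!: minus_carrier_mat\<close>)

lemma qchi_smult:
  assumes "A \<in> carrier_mat n n"
  shows "qchi n (of_real c \<cdot>\<^sub>m A) = of_real c \<cdot>\<^sub>m qchi n A"
  by (rule double_mat_eqI[of _ n]) (use assms in \<open>auto simp: qchi_index qpair_mult\<close>)

lemma qchi_one: "qchi n (1\<^sub>m n) = 1\<^sub>m (2 * n)"
  by (rule double_mat_eqI[of _ n]) (auto simp: qchi_index)

lemma qchi_commutator:
  assumes "A \<in> carrier_mat n n" "B \<in> carrier_mat n n"
  shows "qchi n (commutator A B) = commutator (qchi n A) (qchi n B)"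
  using assms by (simp add: commutator_def qchi_minus qchi_mult)

text \<open>The two diagonal blocks contribute conjugate entries, so the complex trace is exactly
  the quaternionic one; every trace argument can be moved to commuting entries.\<close>

lemma mat_trace_qchi:
  assumes "A \<in> carrier_mat n n"
  shows "mat_trace (qchi n A) = of_real (2 * qRe (\<Sum>i<n. A $$ (i, i)))"
proof -
  have "mat_trace (qchi n A) = (\<Sum>i<n. qfst (A $$ (i, i)) + cnj (qfst (A $$ (i, i))))"
    by (simp add: mat_trace_def sum_double qchi_index sum.distrib)
  also have "\<dots> = of_real (\<Sum>i<n. 2 * qRe (A $$ (i, i)))"
    unfolding of_real_sum by (intro sum.cong refl) (simp add: qfst_def complex_eq_iff)
  also have "(\<Sum>i<n. 2 * qRe (A $$ (i, i))) = 2 * qRe (\<Sum>i<n. A $$ (i, i))"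
    by (induction n) simp_all
  finally show ?thesis .
qed

lemma qTr_eq_0_iff:
  assumes "A \<in> carrier_mat n n"
  shows "qTr A = 0 \<longleftrightarrow> mat_trace (qchi n A) = 0"
  using assms by (simp add: qTr_real mat_trace_qchi[OF assms])

text \<open>Vectors of length \<open>n\<close> are functions on the naturals vanishing from \<open>n\<close> on.\<close>
type_synonym qvec = "nat \<Rightarrow> quat"

definition qvecs :: "nat \<Rightarrow> qvec set" where "qvecs n = {v. \<forall>i\<ge>n. v i = 0}"

text \<open>Scalars act on the right, so that the left action of matrices is linear over the
  quaternions.\<close>

definition rscale :: "qvec \<Rightarrow> quat \<Rightarrow> qvec" (infixl "\<star>" 72) where "v \<star> q = (\<lambda>i. v i * q)"

definition qact :: "nat \<Rightarrow> quat mat \<Rightarrow> qvec \<Rightarrow> qvec" where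
  "qact n A v = (\<lambda>i. if i < n then \<Sum>j<n. A $$ (i, j) * v j else 0)"

lemma rscale_simps:
  "v \<star> (p + q) = v \<star> p + v \<star> q" "(v + w) \<star> q = v \<star> q + w \<star> q" "v \<star> p \<star> q = v \<star> (p * q)"
  "v \<star> 0 = 0" "v \<star> 1 = v" "0 \<star> q = 0" "v \<star> (- q) = - (v \<star> q)" "(- v) \<star> q = - (v \<star> q)"
  "(v - w) \<star> q = v \<star> q - w \<star> q" "v \<star> (p - q) = v \<star> p - v \<star> q"
  by (auto simp: rscale_def fun_eq_iff algebra_simps)

lemma sum_fun_apply: "sum f A i = (\<Sum>x\<in>A. f x i)"
  by (induction A rule: infinite_finite_induct) simp_all

lemma rscale_sum: "sum f A \<star> q = (\<Sum>x\<in>A. f x \<star> q)"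
  by (simp add: rscale_def fun_eq_iff sum_fun_apply sum_distrib_right)

lemma qvecs_closed:
  "0 \<in> qvecs n" "v \<in> qvecs n \<Longrightarrow> w \<in> qvecs n \<Longrightarrow> v + w \<in> qvecs n"
  "v \<in> qvecs n \<Longrightarrow> v \<star> q \<in> qvecs n" "qact n A v \<in> qvecs n"
  by (auto simp: qvecs_def rscale_def qact_def)

lemma qvecs_sum: "(\<And>x. x \<in> A \<Longrightarrow> f x \<in> qvecs n) \<Longrightarrow> sum f A \<in> qvecs n"
  by (induction A rule: infinite_finite_induct) (simp_all add: qvecs_closed)

lemma qact_add: "qact n A (v + w) = qact n A v + qact n A w"
  by (auto simp: qact_def fun_eq_iff distrib_left sum.distrib)

lemma qact_rscale: "qact n A (v \<star> q) = qact n A v \<star> q"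
  by (auto simp: qact_def rscale_def fun_eq_iff sum_distrib_right mult.assoc)

lemma qact_sum: "qact n A (sum f S) = (\<Sum>x\<in>S. qact n A (f x))"
proof -
  have "qact n A 0 = 0" by (auto simp: qact_def fun_eq_iff)
  then show ?thesis
    by (induction S rule: infinite_finite_induct) (simp_all add: qact_add)
qed

text \<open>From \<open>a + b j = a + (- j) (- cnj b)\<close> these are the coordinates relative to
  the right complex basis 1, -j. The pair \<open>(a, b)\<close> itself would not be linear under
  right multiplication by complex numbers, because \<open>j\<close> conjugates them.\<close>

definition venc :: "nat \<Rightarrow> qvec \<Rightarrow> complex vec" where
  "venc n v = vec (2 * n) (\<lambda>i. if i < n then qfst (v i) else - cnj (qsnd (v (i - n))))"

definition vdec :: "nat \<Rightarrow> complex vec \<Rightarrow> qvec" where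
  "vdec n y = (\<lambda>i. if i < n then qpair (y $ i) (- cnj (y $ (n + i))) else 0)"

lemma venc_carrier [simp]: "venc n v \<in> carrier_vec (2 * n)" "dim_vec (venc n v) = 2 * n"
  by (simp_all add: venc_def)

lemma venc_index: "i < n \<Longrightarrow> venc n v $ i = qfst (v i)"
  "i < n \<Longrightarrow> venc n v $ (n + i) = - cnj (qsnd (v i))"
  by (simp_all add: venc_def)

lemma vdec_qvecs: "vdec n y \<in> qvecs n"
  by (simp add: vdec_def qvecs_def)

lemma vdec_venc: "v \<in> qvecs n \<Longrightarrow> vdec n (venc n v) = v"
  by (auto simp: vdec_def venc_index qvecs_def fun_eq_iff)

lemma double_vec_eqI:
  assumes "v \<in> carrier_vec (2 * n)" "w \<in> carrier_vec (2 * n)"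
    and "\<And>i. i < n \<Longrightarrow> v $ i = w $ i \<and> v $ (n + i) = w $ (n + i)"
  shows "v = w"
proof (rule eq_vecI)
  fix i assume "i < dim_vec w"
  then have "i < 2 * n" using assms by auto
  then show "v $ i = w $ i" by (elim lt_double_cases) (use assms(3) in auto)
qed (use assms in auto)

lemma venc_vdec: "y \<in> carrier_vec (2 * n) \<Longrightarrow> venc n (vdec n y) = y"
  by (rule double_vec_eqI[of _ n]) (auto simp: venc_index vdec_def)

lemma venc_linear:
  "venc n (v + w) = venc n v + venc n w" "venc n (v - w) = venc n v - venc n w"
  "venc n (v \<star> qpair c 0) = c \<cdot>\<^sub>v venc n v" "venc n 0 = 0\<^sub>v (2 * n)"
  by (rule double_vec_eqI[of _ n]; auto simp: venc_index rscale_def qpair_mult)+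

lemma vdec_linear:
  assumes "y \<in> carrier_vec (2 * n)" "z \<in> carrier_vec (2 * n)"
  shows "vdec n (y + z) = vdec n y + vdec n z" "vdec n (y - z) = vdec n y - vdec n z"
  using assms by (auto simp: vdec_def fun_eq_iff quat_eq_qpair_iff)

lemma vdec_smult: "y \<in> carrier_vec (2 * n) \<Longrightarrow> vdec n (c \<cdot>\<^sub>v y) = vdec n y \<star> qpair c 0"
  by (auto simp: vdec_def fun_eq_iff rscale_def quat_eq_qpair_iff qpair_mult)

lemma vdec_zero: "vdec n (0\<^sub>v (2 * n)) = 0"
  by (auto simp: vdec_def fun_eq_iff)

text \<open>The action of \<open>M\<^sub>2\<^sub>n(\<complex>)\<close> on \<open>H\<^sup>n\<close>, viewed as a complex space by right multiplication.\<close>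
definition cop :: "nat \<Rightarrow> complex mat \<Rightarrow> qvec \<Rightarrow> qvec" where
  "cop n M v = vdec n (M *\<^sub>v venc n v)"

lemma cop_qvecs: "cop n M v \<in> qvecs n"
  by (simp add: cop_def vdec_qvecs)

lemma mult_mat_vec_index_sum:
  "i < dim_row A \<Longrightarrow> dim_col A = dim_vec v \<Longrightarrow> (A *\<^sub>v v) $ i = (\<Sum>j<dim_vec v. A $$ (i, j) * v $ j)"
  by (simp add: scalar_prod_def atLeast0LessThan)

lemma venc_qact: "venc n (qact n A v) = qchi n A *\<^sub>v venc n v"
proof (rule double_vec_eqI[of _ n])
  fix i assume i: "i < n"
  have idx: "(qchi n A *\<^sub>v venc n v) $ a = (\<Sum>k<n. qchi n A $$ (a, k) * venc n v $ k)
      + (\<Sum>k<n. qchi n A $$ (a, n + k) * venc n v $ (n + k))" if "a < 2 * n" for a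
    using that by (simp add: mult_mat_vec_index_sum sum_double del: index_mult_mat_vec)
  show "venc n (qact n A v) $ i = (qchi n A *\<^sub>v venc n v) $ i \<and>
    venc n (qact n A v) $ (n + i) = (qchi n A *\<^sub>v venc n v) $ (n + i)"
    using i by (simp add: idx qchi_index venc_index qact_def qpair_sum qpair_mult sum.distrib
        sum_subtractf sum_negf del: index_mult_mat_vec cong: sum.cong_simp)
qed (auto intro: carrier_vecI)

lemma cop_qchi: "cop n (qchi n A) v = qact n A v"
  unfolding cop_def venc_qact[symmetric] by (simp add: vdec_venc qvecs_closed)

lemma cop_add:
  assumes "M \<in> carrier_mat (2 * n) (2 * n)" "N \<in> carrier_mat (2 * n) (2 * n)"
  shows "cop n (M + N) v = cop n M v + cop n N v"
  using assms by (simp add: cop_def add_mult_distrib_mat_vec[of _ "2 * n" "2 * n"] vdec_linear)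

lemma cop_mult:
  assumes "M \<in> carrier_mat (2 * n) (2 * n)" "N \<in> carrier_mat (2 * n) (2 * n)"
  shows "cop n (M * N) v = cop n M (cop n N v)"
  using assms by (simp add: cop_def venc_vdec assoc_mult_mat_vec[of _ "2 * n" "2 * n"])

lemma cop_smult:
  assumes "M \<in> carrier_mat (2 * n) (2 * n)"
  shows "cop n (c \<cdot>\<^sub>m M) v = cop n M v \<star> qpair c 0"
proof -
  have "(c \<cdot>\<^sub>m M) *\<^sub>v venc n v = c \<cdot>\<^sub>v (M *\<^sub>v venc n v)"
    using assms by (intro eq_vecI) auto
  then show ?thesis using assms by (simp add: cop_def vdec_smult)
qed

lemma cop_diff_vec:
  assumes "M \<in> carrier_mat (2 * n) (2 * n)"
  shows "cop n M (v - w) = cop n M v - cop n M w"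
  using assms
  by (simp add: cop_def venc_linear mult_minus_distrib_mat_vec[of _ "2 * n" "2 * n"] vdec_linear)

lemma cop_zero: "cop n (0\<^sub>m (2 * n) (2 * n)) v = 0"
proof -
  have "0\<^sub>m (2 * n) (2 * n) *\<^sub>v venc n v = 0\<^sub>v (2 * n)" by (intro eq_vecI) auto
  then show ?thesis by (simp add: cop_def vdec_zero)
qed

lemma cop_one: "v \<in> qvecs n \<Longrightarrow> cop n (1\<^sub>m (2 * n)) v = v"
  by (simp add: cop_def vdec_venc)

lemma cop_minus:
  assumes "M \<in> carrier_mat (2 * n) (2 * n)" "N \<in> carrier_mat (2 * n) (2 * n)"
  shows "cop n (M - N) v = cop n M v - cop n N v"
proof -
  have "cop n (M - N + N) v = cop n (M - N) v + cop n N v"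
    using assms by (intro cop_add) auto
  moreover have "M - N + N = M" using assms by (intro eq_matI) auto
  ultimately show ?thesis by simp
qed

text \<open>Quaternionic matrices are tested by the complex determinant of \<open>qchi n P\<close>.
  A complex kernel vector decodes to a quaternionic one. Otherwise the columns of \<open>Q\<close>
  are the images of the unit vectors under the complex inverse \<open>Y\<close>, so it need not be
  shown beforehand that \<open>Y\<close> has the form \<open>qchi n Q\<close>.\<close>

lemma quat_mat_kernel_or_inverse:
  assumes P: "P \<in> carrier_mat n n"
  shows "(\<exists>x\<in>qvecs n. x \<noteq> 0 \<and> qact n P x = 0) \<or>
    (\<exists>Q\<in>carrier_mat n n. P * Q = 1\<^sub>m n \<and> Q * P = 1\<^sub>m n)"
proof (cases "\<exists>x\<in>qvecs n. x \<noteq> 0 \<and> qact n P x = 0")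
  case False
  let ?M = "qchi n P"
  have "det ?M \<noteq> 0"
  proof
    assume "det ?M = 0"
    then obtain y where y: "y \<in> carrier_vec (2 * n)" "y \<noteq> 0\<^sub>v (2 * n)" "?M *\<^sub>v y = 0\<^sub>v (2 * n)"
      using det_0_iff_vec_prod_zero_field[of ?M "2 * n"] by auto
    have "qact n P (vdec n y) = 0"
      unfolding cop_qchi[symmetric] cop_def venc_vdec[OF y(1)] y(3) by (rule vdec_zero)
    moreover have "vdec n y \<noteq> 0" using y venc_vdec[OF y(1)] by (metis venc_linear(4))
    ultimately show False using False vdec_qvecs by blast
  qed
  then obtain Y where Y: "Y \<in> carrier_mat (2 * n) (2 * n)" "?M * Y = 1\<^sub>m (2 * n)"
    using det_non_zero_imp_unit[of ?M "2 * n" undefined] by (auto simp: Units_def ring_mat_def)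
  define e :: "nat \<Rightarrow> qvec" where "e = (\<lambda>k i. if i = k then 1 else 0)"
  define Q where "Q = mat n n (\<lambda>(i, k). cop n Y (e k) i)"
  have Q: "Q \<in> carrier_mat n n" by (simp add: Q_def)
  have PQ: "P * Q = 1\<^sub>m n"
  proof (rule eq_matI)
    fix i k assume "i < dim_row (1\<^sub>m n :: quat mat)" "k < dim_col (1\<^sub>m n :: quat mat)"
    then have ik: "i < n" "k < n" by auto
    have "qact n P (cop n Y (e k)) = e k"
      unfolding cop_qchi[symmetric] using ik Y
      by (simp add: cop_mult[symmetric] cop_one qvecs_def e_def)
    moreover have "(P * Q) $$ (i, k) = qact n P (cop n Y (e k)) i"
      using ik P Q by (simp add: mat_mult_index_sum qact_def Q_def del: index_mult_mat(1))
    ultimately show "(P * Q) $$ (i, k) = 1\<^sub>m n $$ (i, k)" using ik by (auto simp: e_def)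
  qed (use P Q in auto)
  have "Q * P = 1\<^sub>m n"
  proof -
    \<comment> \<open>A right inverse is a left inverse over the complex numbers; the two upper
      blocks of \<open>qchi\<close> determine the quaternionic entries, which brings the equation
      back.\<close>
    have "?M * qchi n Q = 1\<^sub>m (2 * n)" using PQ P Q by (simp add: qchi_mult[symmetric] qchi_one)
    then have "qchi n Q * ?M = 1\<^sub>m (2 * n)" 
      by (rule mat_mult_left_right_inverse[OF qchi_carrier(1) qchi_carrier(1)])
    then have e: "qchi n (Q * P) = qchi n (1\<^sub>m n)" using P Q by (simp add: qchi_mult qchi_one)
    show ?thesis
    proof (rule eq_matI)
      fix i j assume "i < dim_row (1\<^sub>m n :: quat mat)" "j < dim_col (1\<^sub>m n :: quat mat)"
      then have "i < n" "j < n" by auto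
      then show "(Q * P) $$ (i, j) = 1\<^sub>m n $$ (i, j)"
        using qchi_index(1,2)[of i n j "Q * P"] qchi_index(1,2)[of i n j "1\<^sub>m n"]
        unfolding e quat_eq_qpair_iff by simp
    qed (use P Q in auto)
  qed
  with PQ Q show ?thesis by blast
qed simp

lemma complex_dependence:
  assumes w: "\<And>k. k \<le> 2 * n \<Longrightarrow> w k \<in> qvecs n"
  obtains c where "\<exists>k\<le>2 * n. c k \<noteq> (0 :: complex)" "(\<Sum>k\<le>2 * n. w k \<star> qpair (c k) 0) = 0"
proof -
  let ?N = "Suc (2 * n)"
  \<comment> \<open>The encoded vectors are the columns; a last row of zeros makes the matrix square
    and its determinant zero, so a kernel vector gives the coefficients.\<close>
  define D where "D = mat ?N ?N (\<lambda>(i, k). if i < 2 * n then venc n (w k) $ i else 0)"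
  have D: "D \<in> carrier_mat ?N ?N" by (simp add: D_def)
  have "D = mat\<^sub>r ?N ?N (\<lambda>i. if i = 2 * n then 0\<^sub>v ?N else row D i)"
    by (rule eq_matI) (auto simp: D_def)
  moreover have "det (mat\<^sub>r ?N ?N (\<lambda>i. if i = 2 * n then 0\<^sub>v ?N else row D i)) = 0"
    using D by (intro det_row_0) auto
  ultimately have "det D = 0" by simp
  then obtain y where y: "y \<in> carrier_vec ?N" "y \<noteq> 0\<^sub>v ?N" "D *\<^sub>v y = 0\<^sub>v ?N"
    using det_0_iff_vec_prod_zero_field[OF D] by blast
  show thesis
  proof (rule that)
    show "\<exists>k\<le>2 * n. y $ k \<noteq> 0"
    proof (rule ccontr)
      assume "\<not> ?thesis"
      then have "y = 0\<^sub>v ?N" using y(1) by (intro eq_vecI) auto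
      then show False using y by simp
    qed
    let ?s = "\<Sum>k\<le>2 * n. w k \<star> qpair (y $ k) 0"
    have enc: "venc n (\<Sum>k\<in>K. w k \<star> qpair (y $ k) 0) $ i = (\<Sum>k\<in>K. y $ k * venc n (w k) $ i)"
      if "finite K" "i < 2 * n" for K i
      using that by (induction K rule: finite_induct) (simp_all add: venc_linear)
    have "venc n ?s = 0\<^sub>v (2 * n)"
    proof (rule eq_vecI)
      fix i assume "i < dim_vec (0\<^sub>v (2 * n) :: complex vec)"
      then have i: "i < 2 * n" by simp
      have "(D *\<^sub>v y) $ i = (\<Sum>k<?N. D $$ (i, k) * y $ k)"
        using i y(1) D by (subst mult_mat_vec_index_sum) auto
      also have "\<dots> = (\<Sum>k\<le>2 * n. y $ k * venc n (w k) $ i)"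
        unfolding lessThan_Suc_atMost using i by (intro sum.cong refl) (simp add: D_def)
      finally show "venc n ?s $ i = 0\<^sub>v (2 * n) $ i" using i y(3) enc[of "{..2 * n}" i] by simp
    qed simp
    moreover have "?s \<in> qvecs n" using w by (intro qvecs_sum) (auto intro: qvecs_closed)
    ultimately show "?s = 0" using vdec_venc[of ?s n] by (simp add: vdec_zero)
  qed
qed

section \<open>Minimal complex invariant subspaces\<close>

lemma qpair_mult_pair:
  "qpair a 0 * qpair b 0 = qpair (a * b) 0" "qpair a 0 * qj = qpair 0 a" "qj * qpair a 0 = qpair (cnj a) 0 * qj"
  "qj * qj = - 1" "qpair a 0 + qpair b 0 = qpair (a + b) 0" "qpair a 0 + qpair 0 b = qpair a b"
  "qpair 1 0 = 1"
  by (simp_all add: quat_eq_qpair_iff qpair_mult) (simp_all add: qpair_defs complex_eq_iff)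

lemma qpair_eq_0_iff: "qpair a b = 0 \<longleftrightarrow> a = 0 \<and> b = 0"
  by (simp add: quat_eq_qpair_iff)

locale cube_free_quat_algebra =
  fixes n :: nat and A :: "quat mat set"
  assumes alg: "unital_real_subalgebra n A"
    and cube_free: "\<And>X Y. X \<in> A \<Longrightarrow> Y \<in> A \<Longrightarrow> qTr (commutator X Y ^\<^sub>m 3) = 0"
begin

lemma A_carrier: "X \<in> A \<Longrightarrow> X \<in> carrier_mat n n"
  using alg by (auto simp: unital_real_subalgebra_def)

definition S :: "complex mat set" where "S = complex_span (qchi n ` A)"

lemma S_eq: "S = {qchi n X + \<i> \<cdot>\<^sub>m qchi n Y | X Y. X \<in> A \<and> Y \<in> A}"
  unfolding S_def complex_span_def by blast

lemma S_algebra: "complex_mat_algebra (2 * n) S"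
  unfolding S_def
proof (rule complex_span_algebra)
  note a = alg[unfolded unital_real_subalgebra_def]
  show "1\<^sub>m (2 * n) \<in> qchi n ` A" using a qchi_one[of n] by (metis imageI)
  fix M N c assume M: "M \<in> qchi n ` A"
  then obtain X where X: "X \<in> A" "M = qchi n X" by blast
  show "M \<in> carrier_mat (2 * n) (2 * n)" using X by simp
  have "of_real c \<cdot>\<^sub>m M = qchi n (of_real c \<cdot>\<^sub>m X)" using X A_carrier by (simp add: qchi_smult)
  then show "of_real c \<cdot>\<^sub>m M \<in> qchi n ` A" using a X by blast
  assume "N \<in> qchi n ` A"
  then obtain Y where Y: "Y \<in> A" "N = qchi n Y" by blast
  have "M + N = qchi n (X + Y)" "M * N = qchi n (X * Y)"
    using X Y A_carrier by (simp_all add: qchi_add qchi_mult)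
  then show "M + N \<in> qchi n ` A" "M * N \<in> qchi n ` A" using a X Y by blast+
qed

lemma S_cube_free: "cube_trace_free S"
  unfolding S_def
proof (rule cube_trace_free_complex_span)
  note a = alg[unfolded unital_real_subalgebra_def]
  show "M \<in> carrier_mat (2 * n) (2 * n)" if "M \<in> qchi n ` A" for M using that by auto
  show "M + of_real s \<cdot>\<^sub>m N \<in> qchi n ` A" if MN: "M \<in> qchi n ` A" "N \<in> qchi n ` A" for M N s
  proof -
    obtain X Y where XY: "X \<in> A" "Y \<in> A" "M = qchi n X" "N = qchi n Y" using MN by blast
    have "M + of_real s \<cdot>\<^sub>m N = qchi n (X + of_real s \<cdot>\<^sub>m Y)"
      using XY A_carrier by (simp add: qchi_add qchi_smult)
    moreover have "X + of_real s \<cdot>\<^sub>m Y \<in> A" using a XY by blast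
    ultimately show ?thesis by blast
  qed
  show "cube_trace_free (qchi n ` A)"
    unfolding cube_trace_free_def
  proof safe
    fix X Y assume XY: "X \<in> A" "Y \<in> A"
    let ?C = "commutator X Y"
    have C: "?C \<in> carrier_mat n n" using XY A_carrier by simp
    have "?C ^\<^sub>m 3 = ?C * ?C * ?C" using C by (simp add: numeral_3_eq_3)
    then have "mat_trace (qchi n (?C * ?C * ?C)) = 0"
      using cube_free[OF XY] qTr_eq_0_iff[of "?C ^\<^sub>m 3" n] C by simp
    then show "trace3 (commutator (qchi n X) (qchi n Y)) (commutator (qchi n X) (qchi n Y))
        (commutator (qchi n X) (qchi n Y)) = 0"
      
      using C XY A_carrier
      by (simp add: trace3_def qchi_mult[of _ n] qchi_commutator assoc_mult_mat[of _ "2 * n" "2 * n" _ "2 * n" _ "2 * n"])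
  qed
qed

sublocale mats: complex_mat_algebra "2 * n" S by (rule S_algebra)

definition B :: "(qvec \<Rightarrow> qvec) set" where "B = cop n ` S"
text \<open>Right multiplication by \<open>c\<close>, written through a scalar matrix so that it
  belongs to \<open>B\<close>. Outside \<open>qvecs n\<close> it also cuts off the coordinates from
  \<open>n\<close> on; \<open>sc 1\<close> is the identity only on \<open>qvecs n\<close>, hence the
  restricted axiom \<open>sc_one_image\<close>.\<close>

definition sc :: "complex \<Rightarrow> qvec \<Rightarrow> qvec" where "sc c = cop n (c \<cdot>\<^sub>m 1\<^sub>m (2 * n))"

lemma sc_rscale: "v \<in> qvecs n \<Longrightarrow> sc c v = v \<star> qpair c 0"
  unfolding sc_def by (subst cop_smult) (simp_all add: cop_one)

lemma sc_image: "sc c v \<in> qvecs n" "sc c v = sc 1 v \<star> qpair c 0"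
  unfolding sc_def by (rule cop_qvecs) (simp add: cop_smult qpair_mult_pair rscale_simps)

lemma cop_sc: "M \<in> S \<Longrightarrow> cop n M (sc c v) = cop n M v \<star> qpair c 0"
proof -
  assume "M \<in> S"
  then have M: "M \<in> carrier_mat (2 * n) (2 * n)" by (rule mats.carrier)
  have "M * (c \<cdot>\<^sub>m 1\<^sub>m (2 * n)) = c \<cdot>\<^sub>m M"
    using M mult_smult_distrib[OF M one_carrier_mat, of c] by simp
  then show ?thesis 
    unfolding sc_def using cop_mult[OF M, of "c \<cdot>\<^sub>m 1\<^sub>m (2 * n)" v] M by (metis cop_smult one_carrier_mat smult_carrier_mat)
qed

sublocale ops: operator_algebra B sc
proof
  fix T U :: "qvec \<Rightarrow> qvec" and x y :: qvec and c d :: complex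
  assume "T \<in> B"
  then obtain M where M: "M \<in> S" "T = cop n M" unfolding B_def by blast
  note cM = mats.carrier[OF M(1)]
  show "T (x - y) = T x - T y" using M cM by (simp add: cop_diff_vec)
  show "T (sc c x) = sc c (T x)" using M by (simp add: cop_sc sc_rscale cop_qvecs)
  show "sc 1 (T x) = T x" using M by (simp add: sc_rscale cop_qvecs qpair_mult_pair rscale_simps)
  assume "U \<in> B"
  then obtain N where N: "N \<in> S" "U = cop n N" unfolding B_def by blast
  note cN = mats.carrier[OF N(1)]
  have "(\<lambda>x. T x + U x) = cop n (M + N)" using M N cM cN by (auto simp: cop_add)
  then show "(\<lambda>x. T x + U x) \<in> B" unfolding B_def using mats.add[OF M(1) N(1)] by simp
  have "T \<circ> U = cop n (M * N)" using M N cM cN by (auto simp: cop_mult)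
  then show "T \<circ> U \<in> B" unfolding B_def using mats.mult[OF M(1) N(1)] by simp
next
  fix x :: qvec and c d :: complex
  show "sc c \<in> B" unfolding B_def sc_def using mats.smult[OF mats.one] by blast
  have "sc c (sc d x) = sc 1 x \<star> (qpair d 0 * qpair c 0)"
    by (metis sc_image sc_rscale rscale_simps(3))
  also have "\<dots> = sc (c * d) x" by (metis sc_image(2) qpair_mult_pair(1) mult.commute)
  finally show "sc c (sc d x) = sc (c * d) x" .
  have "sc c x + sc d x = sc 1 x \<star> (qpair c 0 + qpair d 0)"
    by (metis sc_image(2) rscale_simps(1))
  then show "sc c x + sc d x = sc (c + d) x" by (metis sc_image(2) qpair_mult_pair(5))
  show "sc 0 x = 0" by (metis sc_image(2) qpair_0(5) rscale_simps(4))
qed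

lemma B_cases:
  assumes "T \<in> B"
  obtains X Y where "X \<in> A" "Y \<in> A" "\<And>v. T v = qact n X v + qact n Y v \<star> qpair \<i> 0"
proof -
  obtain X Y where XY: "X \<in> A" "Y \<in> A" "T = cop n (qchi n X + \<i> \<cdot>\<^sub>m qchi n Y)"
    using assms unfolding B_def S_eq by blast
  have "T v = qact n X v + qact n Y v \<star> qpair \<i> 0" for v
    unfolding XY by (subst cop_add) (simp_all add: cop_smult cop_qchi)
  with XY(1,2) show thesis by (rule that)
qed

lemma qact_in_B: "X \<in> A \<Longrightarrow> qact n X \<in> B"
proof -
  assume X: "X \<in> A"
  have "of_real 0 \<cdot>\<^sub>m X \<in> A" using alg X unfolding unital_real_subalgebra_def by blast
  then have "qchi n X + \<i> \<cdot>\<^sub>m qchi n (of_real 0 \<cdot>\<^sub>m X) \<in> S" unfolding S_eq using X by blast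
  moreover have "qchi n (of_real 0 \<cdot>\<^sub>m X) = of_real 0 \<cdot>\<^sub>m qchi n X"
    using A_carrier[OF X] by (rule qchi_smult)
  moreover have "qchi n X + \<i> \<cdot>\<^sub>m (of_real 0 \<cdot>\<^sub>m qchi n X) = qchi n X" by (intro eq_matI) auto
  ultimately have "qchi n X \<in> S" by simp
  then show ?thesis unfolding B_def using cop_qchi[of n X] by (metis ext image_eqI)
qed

lemma cop_roots:
  assumes M: "M \<in> carrier_mat (2 * n) (2 * n)"
  shows "foldr (\<lambda>e f y. cop n M (f y) - sc e (f y)) es (sc 1) x = cop n (lin_prod M es) x"
proof (induction es)
  case Nil
  have "1 \<cdot>\<^sub>m 1\<^sub>m (2 * n) = (1\<^sub>m (2 * n) :: complex mat)" by (intro eq_matI) auto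
  then show ?case using M by (simp add: sc_def)
next
  case (Cons e es)
  let ?E = "e \<cdot>\<^sub>m 1\<^sub>m (2 * n)"
  have c: "lin_prod M es \<in> carrier_mat (2 * n) (2 * n)" "?E \<in> carrier_mat (2 * n) (2 * n)" using M by auto
  have "cop n (lin_prod M (e # es)) x = cop n (M - ?E) (cop n (lin_prod M es) x)"
    using M c by (simp add: cop_mult minus_carrier_mat)
  then show ?case using Cons M c by (simp add: cop_minus sc_def)
qed

lemma trace_radical_left_ideal: "ops.left_ideal (cop n ` mats.trace_radical)"
  unfolding ops.left_ideal_def
proof (intro conjI ballI)
  have RS: "mats.trace_radical \<subseteq> S" by (auto simp: mats.trace_radical_def)
  show "cop n ` mats.trace_radical \<subseteq> B" unfolding B_def using RS by blast
  have "0\<^sub>m (2 * n) (2 * n) \<in> mats.trace_radical"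
  proof -
    have "0 \<cdot>\<^sub>m 1\<^sub>m (2 * n) = (0\<^sub>m (2 * n) (2 * n) :: complex mat)" by (intro eq_matI) auto
    then have "0\<^sub>m (2 * n) (2 * n) \<in> S" using mats.smult[OF mats.one] by metis
    moreover have "mat_trace (0\<^sub>m (2 * n) (2 * n) * Z) = 0" if "Z \<in> S" for Z :: "complex mat"
      using mats.carrier[OF that] by (simp add: mat_trace_def)
    ultimately show ?thesis by (simp add: mats.trace_radical_def)
  qed
  then show "cop n ` mats.trace_radical \<noteq> {}" by blast
  fix T U assume T: "T \<in> cop n ` mats.trace_radical" and U: "U \<in> cop n ` mats.trace_radical"
  obtain M N where M: "M \<in> mats.trace_radical" "T = cop n M" and N: "N \<in> mats.trace_radical" "U = cop n N"
    using T U by blast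
  have "(\<lambda>x. T x + U x) = cop n (M + N)"
    using M N RS mats.carrier by (auto simp: cop_add subset_iff)
  then show "(\<lambda>x. T x + U x) \<in> cop n ` mats.trace_radical" using mats.trace_radical_add M N by simp
next
  have RS: "mats.trace_radical \<subseteq> S" by (auto simp: mats.trace_radical_def)
  fix T U assume T: "T \<in> B" and U: "U \<in> cop n ` mats.trace_radical"
  obtain M N where M: "M \<in> S" "T = cop n M" and N: "N \<in> mats.trace_radical" "U = cop n N"
    using T U B_def by blast
  have "T \<circ> U = cop n (M * N)"
    using M N RS mats.carrier by (auto simp: cop_mult subset_iff)
  then show "T \<circ> U \<in> cop n ` mats.trace_radical" using mats.trace_radical_left M N by simp
qed

lemma commutator_op:
  assumes "M \<in> S" "N \<in> S"
  shows "cop n (commutator M N) v = cop n M (cop n N v) - cop n N (cop n M v)"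
  using assms[THEN mats.carrier] by (simp add: commutator_def cop_minus cop_mult)

text \<open>The bound on the dimension is recorded as a dependence of any three vectors because it
  is applied to two chosen vectors and an image \<open>qact n X v\<close>, for which the relation is
  then solved.\<close>

lemma section_dependent:
  assumes U: "ops.invariant U" and W: "ops.invariant W" "U \<subseteq> W" "W \<subseteq> qvecs n"
    and irred: "\<And>W'. ops.invariant W' \<Longrightarrow> U \<subseteq> W' \<Longrightarrow> W' \<subseteq> W \<Longrightarrow> W' = U \<or> W' = W"
    and u: "u1 \<in> W" "u2 \<in> W" "u3 \<in> W"
  shows "\<exists>a b c. (a \<noteq> 0 \<or> b \<noteq> 0 \<or> c \<noteq> 0) \<and> u1 \<star> qpair a 0 + u2 \<star> qpair b 0 + u3 \<star> qpair c 0 \<in> U"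
proof -
  interpret irreducible_section B sc U W
  proof
    show "sc 1 x = x" if "x \<in> W" for x
      using that W(3) by (auto simp: sc_rscale qpair_mult_pair rscale_simps)
    show "\<exists>es. \<forall>x. foldr (\<lambda>e f y. R (f y) - sc e (f y)) es (sc 1) x = 0" if R: "R \<in> B" for R
    proof -
      obtain M where M: "M \<in> S" "R = cop n M" using R unfolding B_def by blast
      note c = mats.carrier[OF M(1)]
      obtain es where "lin_prod M es = 0\<^sub>m (2 * n) (2 * n)" by (rule complex_mat_roots[OF c]) blast
      then have "\<forall>x. foldr (\<lambda>e f y. R (f y) - sc e (f y)) es (sc 1) x = 0"
        using cop_roots[OF c, of es] by (simp add: M(2) cop_zero)
      then show ?thesis ..
    qed
  qed (use U W irred in auto)
  have "dependent3 u1 u2 u3"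
  proof (rule dependent3_if_identity[OF _ u])
    fix X Y w assume XY: "X \<in> B" "Y \<in> B" and w: "w \<in> W"
    obtain M N where M: "M \<in> S" "X = cop n M" and N: "N \<in> S" "Y = cop n N"
      using XY unfolding B_def by blast
    let ?D = "commutator M N"
    have D: "?D \<in> S" using mats.commutator M N by blast
    let ?F = "commutator (?D * ?D) M"
    have F: "?F \<in> mats.trace_radical"
      using mats.commutator_square_in_trace_radical[OF S_cube_free M(1) N(1)] .
    have "cop n ?F w \<in> U"
    proof (rule nil_ideal_acts_trivially[OF trace_radical_left_ideal _ _ imageI[OF F] w])
      fix x assume "x \<in> cop n ` mats.trace_radical"
      then obtain R where R: "R \<in> mats.trace_radical" "x = cop n R" by blast
      then have RS: "R \<in> S" by (simp add: mats.trace_radical_def)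
      note c = mats.carrier[OF RS]
      show "x \<circ> T \<in> cop n ` mats.trace_radical" if "T \<in> B" for T
      proof -
        obtain Q where Q: "Q \<in> S" "T = cop n Q" using \<open>T \<in> B\<close> unfolding B_def by blast
        have "x \<circ> T = cop n (R * Q)" using R Q c mats.carrier[OF Q(1)] by (auto simp: cop_mult)
        then show ?thesis using mats.trace_radical_right[OF Q(1) R(1)] by simp
      qed
      \<comment> \<open>Exponent 0 is excluded: \<open>x ^^ 0\<close> is the identity on all
        functions, while the identity matrix acts as truncation. Hence also the exponent
        \<open>Suc (2 * n)\<close> below.\<close>
      have pow: "(x ^^ Suc k) v = cop n (R ^\<^sub>m Suc k) v" for k v
      proof (induction k arbitrary: v)
        case 0
        then show ?case using R c by simp
      next
        case (Suc k)
        have "(x ^^ Suc (Suc k)) v = (x ^^ Suc k) (x v)" by (simp add: funpow_swap1)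
        also have "\<dots> = cop n (R ^\<^sub>m Suc k) (cop n R v)" using Suc R by simp
        also have "\<dots> = cop n (R ^\<^sub>m Suc k * R) v" using c by (subst cop_mult) auto
        finally show ?case by simp
      qed
      have "R ^\<^sub>m Suc (2 * n) = 0\<^sub>m (2 * n) (2 * n)"
        using mats.trace_radical_nilpotent[OF R(1)] c by simp
      then have "(x ^^ Suc (2 * n)) v = 0" for v
        unfolding pow by (simp add: cop_zero)
      then show "\<exists>k. \<forall>w. (x ^^ k) w = 0" by blast
    qed
    then show "(let C = (\<lambda>v. X (Y v) - Y (X v)) in C (C (X w)) - X (C (C w))) \<in> U"
      using M N D mats.mult[OF D D] mats.carrier[OF D]
      by (simp add: commutator_op[OF mats.mult[OF D D] M(1)] commutator_op[OF M(1) N(1)] cop_mult)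
  qed
  then obtain a b c where "a \<noteq> 0 \<or> b \<noteq> 0 \<or> c \<noteq> 0" "sc a u1 + sc b u2 + sc c u3 \<in> U"
    unfolding dependent3_def by blast
  moreover have "sc a u1 + sc b u2 + sc c u3 = u1 \<star> qpair a 0 + u2 \<star> qpair b 0 + u3 \<star> qpair c 0"
    using u W(3) by (simp add: sc_rscale subset_iff)
  ultimately show ?thesis by metis
qed

section \<open>Closure properties and the descending chain condition\<close>

lemma invariant_closed:
  assumes W: "ops.invariant W" "W \<subseteq> qvecs n"
  shows "0 \<in> W" "v \<in> W \<Longrightarrow> w \<in> W \<Longrightarrow> v + w \<in> W" "v \<in> W \<Longrightarrow> v \<star> qpair c 0 \<in> W"
    "v \<in> W \<Longrightarrow> X \<in> A \<Longrightarrow> qact n X v \<in> W" "v \<in> W \<Longrightarrow> - v \<in> W" "v \<in> W \<Longrightarrow> w \<in> W \<Longrightarrow> v - w \<in> W"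
proof -
  show "0 \<in> W" using W by (simp add: ops.invariant_def)
  show add: "v + w \<in> W" if "v \<in> W" "w \<in> W" for v w using W that by (simp add: ops.invariant_def)
  show sc: "v \<star> qpair c 0 \<in> W" if "v \<in> W" for v c
  proof -
    have "sc c v \<in> W" using that W ops.closed_sc[of c] unfolding ops.invariant_def by blast
    then show ?thesis using that W(2) sc_rscale[of v c] by auto
  qed
  show "v \<in> W \<Longrightarrow> X \<in> A \<Longrightarrow> qact n X v \<in> W" using W qact_in_B by (simp add: ops.invariant_def)
  have "qpair (- 1) 0 = - 1" by (simp add: qpair_defs quat_eq_iff)
  then show neg: "- v \<in> W" if "v \<in> W" for v using sc[OF that, of "- 1"] by (simp add: rscale_simps)
  show "v \<in> W \<Longrightarrow> w \<in> W \<Longrightarrow> v - w \<in> W" using add[of v "- w"] neg[of w] by simp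
qed

text \<open>Every operator in \<open>B\<close> is \<open>X\<close> plus \<open>Y\<close> followed by
  right multiplication by the imaginary unit, with \<open>X\<close>, \<open>Y\<close> in
  \<open>A\<close>. Real multiples are already provided by \<open>A\<close>.\<close>

lemma invariantI:
  assumes "0 \<in> W" "\<And>v w. v \<in> W \<Longrightarrow> w \<in> W \<Longrightarrow> v + w \<in> W"
    "\<And>v. v \<in> W \<Longrightarrow> v \<star> qpair \<i> 0 \<in> W" "\<And>v X. v \<in> W \<Longrightarrow> X \<in> A \<Longrightarrow> qact n X v \<in> W"
  shows "ops.invariant W"
  unfolding ops.invariant_def
proof (intro conjI ballI)
  fix T x assume "T \<in> B" "x \<in> W"
  then show "T x \<in> W" using assms by (metis B_cases)
qed (use assms in auto)

text \<open>In a strictly descending chain choose \<open>w i\<close> in \<open>f i\<close> outside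
  \<open>f (Suc i)\<close>. Among \<open>2 * n + 1\<close> of these there is a complex relation;
  solved at the least index \<open>k\<close> with nonzero coefficient, it places \<open>w k\<close>
  in \<open>f (Suc k)\<close>.\<close>

lemma wf_invariant:
  "wf {(X, Y). X \<subset> Y \<and> ops.invariant X \<and> Y \<subseteq> qvecs n}" (is "wf ?R")
  unfolding wf_iff_no_infinite_down_chain
proof
  assume "\<exists>f. \<forall>i. (f (Suc i), f i) \<in> ?R"
  then obtain f where "\<forall>i. f (Suc i) \<subset> f i \<and> ops.invariant (f (Suc i)) \<and> f i \<subseteq> qvecs n" by auto
  then have f: "\<And>i. f (Suc i) \<subset> f i" "\<And>i. ops.invariant (f (Suc i))" "\<And>i. f i \<subseteq> qvecs n" by auto
  have mono: "f j \<subseteq> f i" if "i \<le> j" for i j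
    using that by (induction rule: dec_induct) (use f(1) in blast)+
  obtain w where w: "\<And>i. w i \<in> f i" "\<And>i. w i \<notin> f (Suc i)"
  proof -
    have "\<forall>i. \<exists>x. x \<in> f i \<and> x \<notin> f (Suc i)" using f(1) by blast
    then show thesis using that by metis
  qed
  obtain c where c: "\<exists>k\<le>2 * n. c k \<noteq> (0 :: complex)" "(\<Sum>k\<le>2 * n. w k \<star> qpair (c k) 0) = 0"
    using complex_dependence[of n w] w f(3) by blast
  define k where "k = (LEAST k. k \<le> 2 * n \<and> c k \<noteq> 0)"
  have k: "k \<le> 2 * n" "c k \<noteq> 0" using LeastI_ex[OF c(1)] by (auto simp: k_def)
  have less: "c i = 0" if "i < k" for i
    using not_less_Least[of i "\<lambda>k. k \<le> 2 * n \<and> c k \<noteq> 0"] that k(1) by (auto simp: k_def)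
  note cl = invariant_closed[OF f(2)[of k] f(3)]
  have e: "(\<Sum>i\<le>2 * n. w i \<star> qpair (c i) 0) = w k \<star> qpair (c k) 0 + (\<Sum>i\<in>{..2 * n} - {k}. w i \<star> qpair (c i) 0)"
    using k by (subst sum.remove[of _ k]) auto
  have sm: "(\<Sum>i\<in>K. w i \<star> qpair (c i) 0) \<in> f (Suc k)" if "finite K" "k \<notin> K" for K
    using that
  proof (induction K rule: finite_induct)
    case (insert i K)
    have "w i \<star> qpair (c i) 0 \<in> f (Suc k)"
    proof (cases "i < k")
      case True
      then show ?thesis using less cl(1) by (simp add: rscale_simps)
    next
      case False
      then have "w i \<in> f (Suc k)" using insert.prems w(1)[of i] mono[of "Suc k" i] by auto
      then show ?thesis by (rule cl(3))
    qed
    moreover have "(\<Sum>i\<in>K. w i \<star> qpair (c i) 0) \<in> f (Suc k)"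
      by (rule insert.IH) (use insert.prems in simp)
    ultimately show ?case unfolding sum.insert[OF insert.hyps(1,2)] by (rule cl(2))
  qed (use cl(1) in simp)
  have "(\<Sum>i\<in>{..2 * n} - {k}. w i \<star> qpair (c i) 0) \<in> f (Suc k)" by (rule sm) auto
  moreover have "(\<Sum>i\<in>{..2 * n} - {k}. w i \<star> qpair (c i) 0) = - (w k \<star> qpair (c k) 0)"
    by (rule add_eq_0_iff[THEN iffD1], unfold e[symmetric], rule c(2))
  ultimately have "- (w k \<star> qpair (c k) 0) \<in> f (Suc k)" by (rule back_subst)
  from cl(3)[OF cl(5)[OF this], of "inverse (c k)"]
  have "w k \<star> qpair (c k) 0 \<star> qpair (inverse (c k)) 0 \<in> f (Suc k)" by simp
  then show False using w(2) k(2) by (simp add: rscale_simps qpair_mult_pair)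
qed

lemma minimal_invariant:
  assumes U: "ops.invariant U" "U \<subset> qvecs n"
  obtains W where "ops.invariant W" "U \<subset> W" "W \<subseteq> qvecs n"
    "\<And>W'. ops.invariant W' \<Longrightarrow> U \<subseteq> W' \<Longrightarrow> W' \<subseteq> W \<Longrightarrow> W' = U \<or> W' = W"
proof -
  let ?F = "{W. ops.invariant W \<and> U \<subset> W \<and> W \<subseteq> qvecs n}"
  have "qvecs n \<in> ?F" using U(2) by (auto intro!: invariantI qvecs_closed)
  then obtain W where W: "W \<in> ?F" and
    min: "\<And>W'. (W', W) \<in> {(X, Y). X \<subset> Y \<and> ops.invariant X \<and> Y \<subseteq> qvecs n} \<Longrightarrow> W' \<notin> ?F"
    by (rule wfE_min[OF wf_invariant]) blast
  show thesis
  proof (rule that[of W])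
    fix W' assume "ops.invariant W'" "U \<subseteq> W'" "W' \<subseteq> W"
    then show "W' = U \<or> W' = W" using W min[of W'] by blast
  qed (use W in auto)
qed

end

section \<open>Extending invariant subspaces\<close>

definition lcomb :: "qvec list \<Rightarrow> (nat \<Rightarrow> quat) \<Rightarrow> qvec" where
  "lcomb bs c = (\<Sum>t<length bs. bs ! t \<star> c t)"

definition rindep :: "qvec list \<Rightarrow> bool" where
  "rindep bs \<longleftrightarrow> (\<forall>c. lcomb bs c = 0 \<longrightarrow> (\<forall>t<length bs. c t = 0))"

lemma lcomb_cong: "(\<And>t. t < length bs \<Longrightarrow> c t = d t) \<Longrightarrow> lcomb bs c = lcomb bs d"
  unfolding lcomb_def by (intro sum.cong) auto

lemma lcomb_Nil: "lcomb [] c = 0"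
  by (simp add: lcomb_def)

lemma lcomb_add: "lcomb bs c + lcomb bs d = lcomb bs (\<lambda>t. c t + d t)"
  by (simp add: lcomb_def rscale_simps sum.distrib)

lemma lcomb_rscale: "lcomb bs c \<star> q = lcomb bs (\<lambda>t. c t * q)"
  by (simp add: lcomb_def rscale_sum rscale_simps)

lemma lcomb_qvecs: "set bs \<subseteq> qvecs n \<Longrightarrow> lcomb bs c \<in> qvecs n"
  unfolding lcomb_def by (intro qvecs_sum qvecs_closed) (auto simp: subset_iff)

lemma lcomb_zero: "lcomb bs (\<lambda>_. 0) = 0"
  unfolding lcomb_def rscale_simps by (rule sum.neutral_const)

lemma lcomb_append: "lcomb (bs @ vs) c = lcomb bs c + lcomb vs (\<lambda>t. c (length bs + t))"
proof (induction vs rule: rev_induct)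
  case (snoc u vs)
  have step: "lcomb (ws @ [u]) d = lcomb ws d + u \<star> d (length ws)" for ws d
  proof -
    have "(\<Sum>t<length ws. (ws @ [u]) ! t \<star> d t) = (\<Sum>t<length ws. ws ! t \<star> d t)"
      by (intro sum.cong) (auto simp: nth_append)
    then show ?thesis unfolding lcomb_def by simp
  qed
  show ?case using step[of "bs @ vs" c] step[of vs] snoc by (simp add: add.assoc)
qed (simp add: lcomb_Nil)

lemma lcomb_take: "lcomb (take p bs) c = lcomb bs (\<lambda>t. if t < p then c t else 0)"
proof (cases "p \<le> length bs")
  case True
  have "lcomb (take p bs @ drop p bs) (\<lambda>t. if t < p then c t else 0)
      = lcomb (take p bs) (\<lambda>t. if t < p then c t else 0) + lcomb (drop p bs) (\<lambda>_. 0)"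
    unfolding lcomb_append using True by simp
  also have "lcomb (take p bs) (\<lambda>t. if t < p then c t else 0) = lcomb (take p bs) c"
    using True by (intro lcomb_cong) simp
  finally show ?thesis by (simp add: lcomb_zero)
next
  case False
  then show ?thesis by (auto intro!: lcomb_cong)
qed

text \<open>Padding by zero columns keeps the matrix square, so that
  \<open>quat_mat_kernel_or_inverse\<close> applies to shorter lists. Since \<open>lcomb\<close>
  reads only the first \<open>length bs\<close> values, a vector serves directly as a coefficient
  function.\<close>

definition col_mat :: "nat \<Rightarrow> qvec list \<Rightarrow> quat mat" where
  "col_mat m bs = mat m m (\<lambda>(i, t). if t < length bs then (bs ! t) i else 0)"

lemma col_mat_carrier: "col_mat m bs \<in> carrier_mat m m"
  by (simp add: col_mat_def)

lemma qact_col_mat: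
  assumes bs: "set bs \<subseteq> qvecs m" and len: "length bs \<le> m"
  shows "qact m (col_mat m bs) x = lcomb bs x"
proof
  fix i
  have s: "lcomb bs x i = (\<Sum>t<length bs. (bs ! t) i * x t)"
    by (simp add: lcomb_def sum_fun_apply rscale_def)
  show "qact m (col_mat m bs) x i = lcomb bs x i"
  proof (cases "i < m")
    case True
    have "qact m (col_mat m bs) x i = (\<Sum>t<m. if t < length bs then (bs ! t) i * x t else 0)"
      unfolding qact_def using True by (auto simp: col_mat_def intro!: sum.cong)
    also have "\<dots> = (\<Sum>t<length bs. if t < length bs then (bs ! t) i * x t else 0)"
      using len by (intro sum.mono_neutral_right) auto
    finally show ?thesis unfolding s by simp
  next
    case False
    have "(bs ! t) i = 0" if "t < length bs" for t
      using bs nth_mem[OF that] False by (auto simp: qvecs_def)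
    then have "(\<Sum>t<length bs. (bs ! t) i * x t) = 0" by (intro sum.neutral) auto
    then show ?thesis unfolding s using False by (simp add: qact_def)
  qed
qed

lemma mat_mult_index_qact:
  assumes "P \<in> carrier_mat n n" "Q \<in> carrier_mat n n" "i < n" "j < n"
  shows "(P * Q) $$ (i, j) = qact n P (\<lambda>k. Q $$ (k, j)) i"
  using assms by (simp add: mat_mult_index_sum qact_def del: index_mult_mat(1))

text \<open>More than \<open>n\<close> vectors are read as vectors of length \<open>m > n\<close> by
  zero padding. Independence excludes a kernel of their square matrix, but its row \<open>n\<close>
  is zero, so it has no right inverse either.\<close>

lemma rindep_length_le:
  assumes bs: "set bs \<subseteq> qvecs n" and ind: "rindep bs"
  shows "length bs \<le> n"
proof (rule ccontr)
  assume "\<not> length bs \<le> n"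
  then have n: "n < length bs" by simp
  define m where "m = length bs"
  let ?P = "col_mat m bs"
  have bsm: "set bs \<subseteq> qvecs m" using bs n by (auto simp: qvecs_def m_def)
  note qa = qact_col_mat[OF bsm, unfolded m_def[symmetric], OF order_refl]
  from quat_mat_kernel_or_inverse[OF col_mat_carrier, of m bs] show False
  proof
    assume "\<exists>x\<in>qvecs m. x \<noteq> 0 \<and> qact m ?P x = 0"
    then obtain x where x: "x \<in> qvecs m" "x \<noteq> 0" "lcomb bs x = 0" unfolding qa by blast
    then have "\<forall>t<m. x t = 0" using ind unfolding rindep_def m_def by blast
    then have "x t = 0" for t using x(1) by (cases "t < m") (auto simp: qvecs_def)
    then show False using x(2) by (auto simp: fun_eq_iff)
  next
    assume "\<exists>Q\<in>carrier_mat m m. ?P * Q = 1\<^sub>m m \<and> Q * ?P = 1\<^sub>m m"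
    then obtain Q where Q: "Q \<in> carrier_mat m m" "?P * Q = 1\<^sub>m m" by blast
    have nm: "n < m" using n m_def by simp
    have "(?P * Q) $$ (n, n) = 0"
      unfolding mat_mult_index_qact[OF col_mat_carrier Q(1) nm nm] qa
      using lcomb_qvecs[OF bs] by (simp add: qvecs_def)
    then show False unfolding Q(2) using nm by simp
  qed
qed

text \<open>Coefficients of the unit vectors would form a right inverse \<open>Q\<close> of the
  padded column matrix \<open>P\<close>. Then \<open>Q\<close> is also a left inverse, contradicting
  the zero last column of \<open>P\<close>.\<close>

lemma short_list_not_spanning:
  assumes bs: "set bs \<subseteq> qvecs n" and len: "length bs < n"
  shows "range (lcomb bs) \<noteq> qvecs n"
proof
  assume span: "range (lcomb bs) = qvecs n"
  let ?e = "\<lambda>k i. if i = k then 1 else (0 :: quat)"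
  have "\<forall>k. \<exists>c. k < n \<longrightarrow> lcomb bs c = ?e k"
  proof
    fix k
    have "?e k \<in> range (lcomb bs)" if "k < n" using that unfolding span by (auto simp: qvecs_def)
    then show "\<exists>c. k < n \<longrightarrow> lcomb bs c = ?e k" by fastforce
  qed
  then obtain c where c: "\<And>k. k < n \<Longrightarrow> lcomb bs (c k) = ?e k" by metis
  define P where "P = col_mat n bs"
  define Q where "Q = mat n n (\<lambda>(t, k). c k t)"
  have P: "P \<in> carrier_mat n n" and Q: "Q \<in> carrier_mat n n" by (simp_all add: P_def Q_def col_mat_def)
  have "lcomb bs (\<lambda>t. Q $$ (t, k)) = lcomb bs (c k)" if "k < n" for k
    using len that by (intro lcomb_cong) (simp add: Q_def)
  then have PQ: "P * Q = 1\<^sub>m n"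
    using P Q c len
    by (intro eq_matI) (auto simp: mat_mult_index_qact P_def qact_col_mat[OF bs] simp del: index_mult_mat(1))
  have "\<not> (\<exists>x\<in>qvecs n. x \<noteq> 0 \<and> qact n Q x = 0)"
  proof safe
    fix x assume x: "x \<in> qvecs n" "x \<noteq> 0" "qact n Q x = 0"
    have "qact n (P * Q) x = qact n P (qact n Q x)"
      unfolding cop_qchi[symmetric] using P Q by (simp add: qchi_mult cop_mult)
    also have "\<dots> = 0" unfolding x(3) by (auto simp: qact_def fun_eq_iff)
    finally have "cop n (1\<^sub>m (2 * n)) x = 0" unfolding PQ cop_qchi[symmetric] qchi_one .
    then show False using x cop_one by auto
  qed
  then obtain R where R: "R \<in> carrier_mat n n" "Q * R = 1\<^sub>m n"
    using quat_mat_kernel_or_inverse[OF Q] by blast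
  have "P = P * (Q * R)" using R P by simp
  also have "\<dots> = R" using P Q R PQ by (metis assoc_mult_mat left_mult_one_mat)
  finally have QP: "Q * P = 1\<^sub>m n" using R by simp
  have n: "n - 1 < n" using len by simp
  have "(\<lambda>k. if k < n then P $$ (k, n - 1) else 0) = (0 :: qvec)"
    using len by (auto simp: P_def col_mat_def fun_eq_iff)
  then have "(Q * P) $$ (n - 1, n - 1) = 0"
    unfolding mat_mult_index_qact[OF Q P n n] qact_def using n
    by (auto simp: fun_eq_iff intro!: sum.neutral split: if_splits)
  then show False unfolding QP using n by simp
qed

section \<open>Enlarging a stable right subspace by one block\<close>

context cube_free_quat_algebra
begin

definition stable_subspace :: "qvec set \<Rightarrow> bool" where
  "stable_subspace U \<longleftrightarrow> U \<subseteq> qvecs n \<and> 0 \<in> U \<and> (\<forall>v\<in>U. \<forall>w\<in>U. v + w \<in> U) \<and>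
    (\<forall>v\<in>U. \<forall>q. v \<star> q \<in> U) \<and> (\<forall>v\<in>U. \<forall>X\<in>A. qact n X v \<in> U)"

text \<open>The alternatives supply a diagonal block of size one or two. In the second, independence
  modulo \<open>U\<close> is over the quaternions while the coefficients of the images are complex;
  both together describe a complex 2 x 2 block.\<close>

lemma extend_stable_subspace:
  assumes U: "stable_subspace U" "U \<noteq> qvecs n"
  shows "(\<exists>u\<in>qvecs n. u \<notin> U \<and> (\<forall>X\<in>A. \<exists>q. qact n X u - u \<star> q \<in> U)) \<or>
    (\<exists>u1\<in>qvecs n. \<exists>u2\<in>qvecs n. (\<forall>p q. u1 \<star> p + u2 \<star> q \<in> U \<longrightarrow> p = 0 \<and> q = 0) \<and>
      (\<forall>X\<in>A. \<forall>v\<in>{u1, u2}. \<exists>a b. qact n X v - (u1 \<star> qpair a 0 + u2 \<star> qpair b 0) \<in> U))"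
proof -
  have UV: "U \<subseteq> qvecs n" and U0: "0 \<in> U" and Uadd: "\<And>v w. v \<in> U \<Longrightarrow> w \<in> U \<Longrightarrow> v + w \<in> U"
    and Usc: "\<And>v q. v \<in> U \<Longrightarrow> v \<star> q \<in> U" and Uact: "\<And>v X. v \<in> U \<Longrightarrow> X \<in> A \<Longrightarrow> qact n X v \<in> U"
    using U(1) by (auto simp: stable_subspace_def)
  have invU: "ops.invariant U" using U0 Uadd Usc Uact by (intro invariantI)
  have Udiff: "\<And>v w. v \<in> U \<Longrightarrow> w \<in> U \<Longrightarrow> v - w \<in> U" using invariant_closed(6)[OF invU UV] .
  have "U \<subset> qvecs n" using UV U(2) by blast
  from minimal_invariant[OF invU this] obtain W where W: "ops.invariant W" "U \<subset> W" "W \<subseteq> qvecs n"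
    and irred: "\<And>W'. ops.invariant W' \<Longrightarrow> U \<subseteq> W' \<Longrightarrow> W' \<subseteq> W \<Longrightarrow> W' = U \<or> W' = W" by blast
  note cl = invariant_closed[OF W(1,3)]
  have UW: "U \<subseteq> W" using W(2) by blast
  have dep: "\<exists>a b c. (a \<noteq> 0 \<or> b \<noteq> 0 \<or> c \<noteq> 0) \<and>
      v1 \<star> qpair a 0 + v2 \<star> qpair b 0 + v3 \<star> qpair c 0 \<in> U"
    if "v1 \<in> W" "v2 \<in> W" "v3 \<in> W" for v1 v2 v3
    using section_dependent[OF invU W(1) UW W(3) _ that] irred by blast
  define Wj where "Wj = (\<lambda>v. v \<star> qj) ` W"
  have WjV: "Wj \<subseteq> qvecs n" using W(3) by (auto simp: Wj_def subset_iff intro: qvecs_closed)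
  have jj: "qj * qj = - 1" by (rule qpair_mult_pair)
  have "ops.invariant Wj"
  proof (rule invariantI)
    show "0 \<in> Wj" unfolding Wj_def using cl(1) by (force simp: rscale_simps)
    show "v + w \<in> Wj" if "v \<in> Wj" "w \<in> Wj" for v w
      using that cl(2) by (auto simp: Wj_def rscale_simps(2)[symmetric])
    show "v \<star> qpair \<i> 0 \<in> Wj" if v: "v \<in> Wj" for v
    proof -
      obtain w where w: "w \<in> W" "v = w \<star> qj" using v unfolding Wj_def by blast
      have "v \<star> qpair \<i> 0 = w \<star> qpair (cnj \<i>) 0 \<star> qj"
        unfolding w rscale_simps(3) by (simp only: qpair_mult_pair(3))
      then show ?thesis unfolding Wj_def using cl(3)[OF w(1)] by blast
    qed
    show "qact n X v \<in> Wj" if "v \<in> Wj" "X \<in> A" for v X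
      using that cl(4) by (auto simp: Wj_def qact_rscale)
  qed
  note clj = invariant_closed[OF this WjV]
  have invI: "ops.invariant (W \<inter> Wj)"
    by (rule invariantI) (auto intro: cl clj)
  have UI: "U \<subseteq> W \<inter> Wj"
  proof
    fix u assume u: "u \<in> U"
    \<comment> \<open>\<open>U\<close> is closed under all quaternionic scalars, so every element of
      \<open>U\<close> is an element of \<open>U\<close>, hence of \<open>W\<close>, times
      \<open>j\<close>.\<close>
    have "u = u \<star> (- qj) \<star> qj" by (simp add: rscale_simps jj)
    then show "u \<in> W \<inter> Wj" unfolding Wj_def using u Usc[OF u, of "- qj"] UW by blast
  qed
  obtain u1 where u1: "u1 \<in> W" "u1 \<notin> U" using W(2) by blast
  have u1V: "u1 \<in> qvecs n" using u1 W(3) by blast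
  have u1q: "q = 0" if "u1 \<star> q \<in> U" for q
  proof (rule ccontr)
    assume "q \<noteq> 0"
    then have "u1 \<star> q \<star> inverse q = u1" by (simp add: rscale_simps)
    then show False using Usc[OF that, of "inverse q"] u1 by simp
  qed
  consider "W \<inter> Wj = W" | "W \<inter> Wj = U" using irred[OF invI UI] by blast
  then show ?thesis
  proof cases
    case 1
    then obtain w where w: "w \<in> W" "u1 = w \<star> qj" using u1 unfolding Wj_def by blast
    \<comment> \<open>With \<open>u1 \<star> qj\<close> also in \<open>W\<close>, the whole
      quaternionic line of \<open>u1\<close> lies in \<open>W\<close>. A relation between
      \<open>u1\<close>, \<open>u1 \<star> qj\<close> and the image of \<open>u1\<close> can be
      solved for the image, because no nonzero multiple of \<open>u1\<close> lies in
      \<open>U\<close>.\<close>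
    have "u1 \<star> qj = - w" unfolding w(2) by (simp add: rscale_simps jj)
    then have u1j: "u1 \<star> qj \<in> W" using cl(5)[OF w(1)] by simp
    have "\<exists>q. qact n X u1 - u1 \<star> q \<in> U" if X: "X \<in> A" for X
    proof -
      let ?x = "qact n X u1"
      obtain a b c where abc: "a \<noteq> 0 \<or> b \<noteq> 0 \<or> c \<noteq> 0"
        "u1 \<star> qpair a 0 + u1 \<star> qj \<star> qpair b 0 + ?x \<star> qpair c 0 \<in> U"
        using dep[OF u1(1) u1j cl(4)[OF u1(1) X]] by blast
      define q where "q = qpair a 0 + qj * qpair b 0"
      have q: "u1 \<star> q + ?x \<star> qpair c 0 \<in> U" using abc(2) by (simp add: q_def rscale_simps)
      have "c \<noteq> 0"
      proof
        assume c: "c = 0"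
        then have "q = 0" using q u1q by (simp add: rscale_simps)
        then show False using abc(1) c by (auto simp: q_def quat_eq_qpair_iff qpair_mult)
      qed
      then have ci: "qpair c 0 * qpair (inverse c) 0 = 1" by (simp add: qpair_mult_pair)
      have "?x - u1 \<star> (- (q * qpair (inverse c) 0)) = (u1 \<star> q + ?x \<star> qpair c 0) \<star> qpair (inverse c) 0"
        by (simp add: rscale_simps ci)
      then show ?thesis using Usc[OF q] by metis
    qed
    then show ?thesis using u1(2) u1V by blast
  next
    case 2
    show ?thesis
    \<comment> \<open>A section of complex dimension one yields a block of size one even when
      \<open>W\<close> and \<open>Wj\<close> meet only in \<open>U\<close>.\<close>
    proof (cases "\<forall>w\<in>W. \<exists>c. w - u1 \<star> qpair c 0 \<in> U")
      case True
      then have "\<exists>q. qact n X u1 - u1 \<star> q \<in> U" if "X \<in> A" for X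
        using cl(4)[OF u1(1) that] by blast
      then show ?thesis using u1(2) u1V by blast
    next
      case False
      then obtain u2 where u2: "u2 \<in> W" "\<And>c. u2 - u1 \<star> qpair c 0 \<notin> U" by blast
      have cind: "a = 0 \<and> b = 0" if ab: "u1 \<star> qpair a 0 + u2 \<star> qpair b 0 \<in> U" for a b
      proof -
        have b: "b = 0"
        proof (rule ccontr)
          assume "b \<noteq> 0"
          then have bi: "qpair b 0 * qpair (inverse b) 0 = 1" by (simp add: qpair_mult_pair)
          have "qpair (- (a * inverse b)) 0 = - (qpair a 0 * qpair (inverse b) 0)"
            by (simp add: qpair_mult_pair) (simp add: qpair_def quat_eq_iff)
          then have "u2 - u1 \<star> qpair (- (a * inverse b)) 0 = (u1 \<star> qpair a 0 + u2 \<star> qpair b 0) \<star> qpair (inverse b) 0"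
            by (simp add: rscale_simps bi)
          then show False using Usc[OF ab] u2(2) by metis
        qed
        then have "u1 \<star> qpair a 0 \<in> U" using ab by (simp add: rscale_simps)
        then have "qpair a 0 = 0" by (rule u1q)
        then show ?thesis using b by (simp add: qpair_eq_0_iff)
      qed
      have u2V: "u2 \<in> qvecs n" using u2 W(3) by blast
      have ind: "p = 0 \<and> q = 0" if pq: "u1 \<star> p + u2 \<star> q \<in> U" for p q
      proof -
        \<comment> \<open>Splitting \<open>p\<close> and \<open>q\<close> as \<open>a + b j\<close>
          writes the combination as \<open>?w1 + ?w2 \<star> qj\<close> with both vectors in
          \<open>W\<close>. If it lies in \<open>U\<close>, then \<open>?w1\<close> belongs to
          \<open>W \<inter> Wj = U\<close>, hence \<open>?w2\<close> is in \<open>U\<close> too, and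
          complex independence applies to each.\<close>
        let ?w1 = "u1 \<star> qpair (qfst p) 0 + u2 \<star> qpair (qfst q) 0"
        let ?w2 = "u1 \<star> qpair (qsnd p) 0 + u2 \<star> qpair (qsnd q) 0"
        have split: "r = qpair (qfst r) 0 + qpair (qsnd r) 0 * qj" for r
          by (simp add: quat_eq_qpair_iff qpair_mult)
        have w: "?w1 \<in> W" "?w2 \<in> W" using cl u1 u2 by auto
        have eq: "u1 \<star> p + u2 \<star> q = ?w1 + ?w2 \<star> qj"
          by (subst split[of p], subst split[of q]) (simp add: rscale_simps)
        define u where "u = u1 \<star> p + u2 \<star> q"
        have uU: "u \<in> U" using pq u_def by simp
        have w1u: "?w1 = (u \<star> (- qj) - ?w2) \<star> qj"
        proof -
          have "u \<star> (- qj) \<star> qj = u" by (simp add: rscale_simps(3,5) jj)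
          then have "(u \<star> (- qj) - ?w2) \<star> qj = u - ?w2 \<star> qj" by (simp only: rscale_simps(9))
          then show ?thesis unfolding u_def eq by simp
        qed
        have "u \<star> (- qj) - ?w2 \<in> W" using cl(6)[OF _ w(2)] Usc[OF uU] UW by blast
        then have "?w1 \<in> Wj" unfolding Wj_def w1u by (rule imageI)
        then have w1U: "?w1 \<in> U" using 2 w(1) by blast
        have "u - ?w1 = ?w2 \<star> qj" unfolding u_def eq by simp
        then have "?w2 \<star> qj \<in> U" using Udiff[OF uU w1U] by simp
        then have "?w2 \<star> qj \<star> (- qj) \<in> U" by (rule Usc)
        moreover have "?w2 \<star> qj \<star> (- qj) = ?w2" by (simp only: rscale_simps(3,5) mult_minus_right jj minus_minus)
        ultimately have w2U: "?w2 \<in> U" by simp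
        show ?thesis using cind[OF w1U] cind[OF w2U] by (simp add: quat_eq_qpair_iff)
      qed
      have "\<exists>a b. qact n X v - (u1 \<star> qpair a 0 + u2 \<star> qpair b 0) \<in> U"
        if X: "X \<in> A" and v: "v \<in> {u1, u2}" for X v
      proof -
        let ?x = "qact n X v"
        have "?x \<in> W" using X v cl(4) u1 u2 by blast
        then obtain a b c where abc: "a \<noteq> 0 \<or> b \<noteq> 0 \<or> c \<noteq> 0"
          "u1 \<star> qpair a 0 + u2 \<star> qpair b 0 + ?x \<star> qpair c 0 \<in> U"
          using dep[OF u1(1) u2(1)] by blast
        have "c \<noteq> 0"
        proof
          assume "c = 0"
          then have "u1 \<star> qpair a 0 + u2 \<star> qpair b 0 \<in> U" using abc(2) by (simp add: rscale_simps)
          from cind[OF this] abc(1) \<open>c = 0\<close> show False by simp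
        qed
        then have ci: "qpair c 0 * qpair (inverse c) 0 = 1" by (simp add: qpair_mult_pair)
        have neg: "qpair (- (d * inverse c)) 0 = - (qpair d 0 * qpair (inverse c) 0)" for d
          by (simp add: qpair_mult_pair) (simp add: qpair_def quat_eq_iff)
        have "?x - (u1 \<star> qpair (- (a * inverse c)) 0 + u2 \<star> qpair (- (b * inverse c)) 0)
          = (u1 \<star> qpair a 0 + u2 \<star> qpair b 0 + ?x \<star> qpair c 0) \<star> qpair (inverse c) 0"
          unfolding neg by (simp add: rscale_simps ci)
        then show ?thesis using Usc[OF abc(2)] by metis
      qed
      then show ?thesis using u1V u2V ind by blast
    qed
  qed
qed

end

section \<open>Block flags\<close>

abbreviation boff :: "nat list \<Rightarrow> nat \<Rightarrow> nat" where
  "boff \<sigma> i \<equiv> sum_list (take i \<sigma>)"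

lemma boff_Suc: "i < length \<sigma> \<Longrightarrow> boff \<sigma> (Suc i) = boff \<sigma> i + \<sigma> ! i"
  by (simp add: take_Suc_conv_app_nth)

lemma boff_mono:
  assumes "i \<le> j"
  shows "boff \<sigma> i \<le> boff \<sigma> j"
proof -
  have "boff \<sigma> j = sum_list (take i (take j \<sigma>)) + sum_list (drop i (take j \<sigma>))"
    by (metis append_take_drop_id sum_list.append)
  then show ?thesis using assms by (simp add: min_def)
qed

lemma boff_le: "boff \<sigma> i \<le> sum_list \<sigma>"
  using boff_mono[of i "max i (length \<sigma>)" \<sigma>] by simp

lemma boff_less:
  assumes "i < length \<sigma>" "s < \<sigma> ! i"
  shows "boff \<sigma> i + s < boff \<sigma> (Suc i)" "boff \<sigma> i + s < sum_list \<sigma>"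
  using assms boff_Suc[of i \<sigma>] boff_le[of "Suc i" \<sigma>] by simp_all

context cube_free_quat_algebra
begin

text \<open>A partial solution of the problem: for \<open>length bs = n\<close> the coefficient
  functions \<open>c\<close> are the columns of the matrices of \<open>A\<close> in the basis
  \<open>bs\<close>, and the last clause is membership in \<open>M_seq \<sigma>\<close>.\<close>

definition block_flag :: "qvec list \<Rightarrow> nat list \<Rightarrow> bool" where
  "block_flag bs \<sigma> \<longleftrightarrow> set bs \<subseteq> qvecs n \<and> length bs = sum_list \<sigma> \<and> one_two_sequence \<sigma> \<and> rindep bs \<and>
     (\<forall>X\<in>A. \<forall>t<length bs. qact n X (bs ! t) \<in> range (lcomb bs)) \<and>
     (\<forall>X\<in>A. \<forall>i<length \<sigma>. \<forall>s<\<sigma> ! i. \<exists>c. qact n X (bs ! (boff \<sigma> i + s)) = lcomb (take (boff \<sigma> (Suc i)) bs) c \<and>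
        (\<sigma> ! i = 2 \<longrightarrow> (\<forall>r<2. c (boff \<sigma> i + r) \<in> quat_complex)))"

text \<open>Both hypotheses on \<open>vs\<close> are modulo the span of \<open>bs\<close>:
  contributions from that span enter the new columns only above the diagonal block, where
  \<open>M_seq\<close> imposes nothing.\<close>

lemma block_flag_append:
  assumes f: "block_flag bs \<sigma>" and vs: "set vs \<subseteq> qvecs n" "length vs = 1 \<or> length vs = 2"
    and ind: "\<And>d. lcomb vs d \<in> range (lcomb bs) \<Longrightarrow> \<forall>s<length vs. d s = 0"
    and act: "\<And>X s. X \<in> A \<Longrightarrow> s < length vs \<Longrightarrow>
      \<exists>d. qact n X (vs ! s) - lcomb vs d \<in> range (lcomb bs) \<and>
        (length vs = 2 \<longrightarrow> (\<forall>r<2. d r \<in> quat_complex))"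
  shows "block_flag (bs @ vs) (\<sigma> @ [length vs])"
  unfolding block_flag_def
proof (intro conjI ballI allI impI)
  let ?m = "length bs"
  have m: "?m = sum_list \<sigma>" and bs: "set bs \<subseteq> qvecs n" and rb: "rindep bs"
    and old: "\<And>X t. X \<in> A \<Longrightarrow> t < ?m \<Longrightarrow> qact n X (bs ! t) \<in> range (lcomb bs)"
    using f by (auto simp: block_flag_def)
  show "set (bs @ vs) \<subseteq> qvecs n" using bs vs by simp
  show "length (bs @ vs) = sum_list (\<sigma> @ [length vs])" using m by simp
  show "one_two_sequence (\<sigma> @ [length vs])"
    using f vs(2) by (auto simp: block_flag_def one_two_sequence_def)
  show "rindep (bs @ vs)"
    unfolding rindep_def
  proof (intro allI impI)
    fix c t assume z: "lcomb (bs @ vs) c = 0" and t: "t < length (bs @ vs)"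
    let ?d = "\<lambda>s. c (?m + s)"
    have s: "lcomb bs c + lcomb vs ?d = 0" using z by (simp add: lcomb_append)
    have "lcomb vs ?d = lcomb bs c \<star> (- 1)"
      using s by (simp add: rscale_simps add_eq_0_iff)
    then have "lcomb vs ?d \<in> range (lcomb bs)" unfolding lcomb_rscale by blast
    from ind[OF this] have d: "\<forall>s<length vs. c (?m + s) = 0" .
    then have "lcomb vs ?d = lcomb vs (\<lambda>_. 0)" by (intro lcomb_cong) simp
    then have "lcomb bs c = 0" using s by (simp add: lcomb_zero)
    then have "\<forall>t<?m. c t = 0" using rb by (simp add: rindep_def)
    then show "c t = 0" using d t by (metis add_diff_inverse_nat length_append nat_add_left_cancel_less)
  qed
  have glue: "\<exists>e. x = lcomb (bs @ vs) e \<and> (\<forall>s<length vs. e (?m + s) = d s)"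
    if x: "x - lcomb vs d \<in> range (lcomb bs)" for x d
  proof -
    obtain c where c: "x - lcomb vs d = lcomb bs c" using x by blast
    let ?e = "\<lambda>t. if t < ?m then c t else d (t - ?m)"
    have "lcomb bs ?e = lcomb bs c" by (intro lcomb_cong) simp
    moreover have "lcomb vs (\<lambda>t. ?e (?m + t)) = lcomb vs d" by (intro lcomb_cong) simp
    ultimately have "lcomb (bs @ vs) ?e = lcomb bs c + lcomb vs d" by (simp add: lcomb_append)
    then have "x = lcomb (bs @ vs) ?e" using c by (simp add: diff_eq_eq)
    moreover have "\<forall>s<length vs. ?e (?m + s) = d s" by simp
    ultimately show ?thesis by blast
  qed
  show "qact n X ((bs @ vs) ! t) \<in> range (lcomb (bs @ vs))"
    if X: "X \<in> A" and t: "t < length (bs @ vs)" for X t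
  proof (cases "t < ?m")
    case True
    then have "qact n X ((bs @ vs) ! t) \<in> range (lcomb bs)" using old[OF X] by (simp add: nth_append)
    then have "qact n X ((bs @ vs) ! t) - lcomb vs (\<lambda>_. 0) \<in> range (lcomb bs)" by (simp add: lcomb_zero)
    from glue[OF this] show ?thesis by blast
  next
    case False
    then have tv: "(bs @ vs) ! t = vs ! (t - ?m)" "t - ?m < length vs" using t by (auto simp: nth_append)
    from act[OF X tv(2)] obtain d where "qact n X (vs ! (t - ?m)) - lcomb vs d \<in> range (lcomb bs)" by blast
    from glue[OF this] show ?thesis unfolding tv by blast
  qed
  fix X i s assume X: "X \<in> A" and i: "i < length (\<sigma> @ [length vs])" and s: "s < (\<sigma> @ [length vs]) ! i"
  show "\<exists>c. qact n X ((bs @ vs) ! (boff (\<sigma> @ [length vs]) i + s)) =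
      lcomb (take (boff (\<sigma> @ [length vs]) (Suc i)) (bs @ vs)) c \<and>
      ((\<sigma> @ [length vs]) ! i = 2 \<longrightarrow> (\<forall>r<2. c (boff (\<sigma> @ [length vs]) i + r) \<in> quat_complex))"
  proof (cases "i < length \<sigma>")
    case True
    then have s': "s < \<sigma> ! i" using s by (simp add: nth_append)
    have "boff \<sigma> i + s < ?m" using boff_less[OF True s'] m by simp
    moreover have "boff \<sigma> (Suc i) \<le> ?m" using boff_le m by simp
    moreover have "\<exists>c. qact n X (bs ! (boff \<sigma> i + s)) = lcomb (take (boff \<sigma> (Suc i)) bs) c \<and>
        (\<sigma> ! i = 2 \<longrightarrow> (\<forall>r<2. c (boff \<sigma> i + r) \<in> quat_complex))"
      using f X True s' unfolding block_flag_def by blast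
    ultimately show ?thesis using True by (simp add: nth_append)
  next
    case False
    then have i': "i = length \<sigma>" using i by simp
    then have s': "s < length vs" using s by simp
    from act[OF X s'] obtain d where d: "qact n X (vs ! s) - lcomb vs d \<in> range (lcomb bs)"
      "length vs = 2 \<longrightarrow> (\<forall>r<2. d r \<in> quat_complex)" by blast
    from glue[OF d(1)] obtain e where e: "qact n X (vs ! s) = lcomb (bs @ vs) e"
      "\<forall>s<length vs. e (?m + s) = d s" by blast
    have "length vs = 2 \<longrightarrow> (\<forall>r<2. e (?m + r) \<in> quat_complex)" using d(2) e(2) by simp
    then show ?thesis using e(1) s' unfolding i' by (auto simp: m[symmetric] nth_append)
  qed
qed

lemma block_flag_extend:
  assumes f: "block_flag bs \<sigma>" and len: "length bs < n"
  shows "\<exists>bs' \<sigma>'. block_flag bs' \<sigma>' \<and> length bs < length bs'"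
proof -
  let ?U = "range (lcomb bs)"
  have bs: "set bs \<subseteq> qvecs n"
    and act: "\<And>X t. X \<in> A \<Longrightarrow> t < length bs \<Longrightarrow> qact n X (bs ! t) \<in> ?U"
    using f by (auto simp: block_flag_def)
  have add: "v + w \<in> ?U" if "v \<in> ?U" "w \<in> ?U" for v w using that by (auto simp: lcomb_add)
  have sc: "v \<star> q \<in> ?U" if "v \<in> ?U" for v q using that by (auto simp: lcomb_rscale)
  have z: "0 \<in> ?U" using lcomb_zero by (metis rangeI)
  have "stable_subspace ?U"
    unfolding stable_subspace_def
  proof (intro conjI ballI allI)
    show "?U \<subseteq> qvecs n" using lcomb_qvecs[OF bs] by blast
    fix v X assume "v \<in> ?U" and X: "X \<in> A"
    then obtain c where v: "v = lcomb bs c" by blast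
    have "(\<Sum>t\<in>T. qact n X (bs ! t) \<star> c t) \<in> ?U" if "T \<subseteq> {..<length bs}" for T
      using finite_subset[OF that finite_lessThan] that
    proof (induction T rule: finite_induct)
      case empty
      show ?case unfolding sum.empty by (rule z)
    next
      case (insert t T)
      have 1: "qact n X (bs ! t) \<star> c t \<in> ?U" using insert.prems act[OF X] sc by simp
      have 2: "(\<Sum>t\<in>T. qact n X (bs ! t) \<star> c t) \<in> ?U" using insert.IH insert.prems by simp
      show ?case unfolding sum.insert[OF insert.hyps(1,2)] using add[OF 1 2] .
    qed
    then have "(\<Sum>t<length bs. qact n X (bs ! t) \<star> c t) \<in> ?U" by blast
    then show "qact n X v \<in> ?U" unfolding v lcomb_def qact_sum qact_rscale .
  qed (use add sc z in blast)+
  from extend_stable_subspace[OF this short_list_not_spanning[OF bs len]] show ?thesis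
  proof (elim disjE bexE conjE)
    fix u assume u: "u \<in> qvecs n" "u \<notin> ?U" "\<forall>X\<in>A. \<exists>q. qact n X u - u \<star> q \<in> ?U"
    have l1: "lcomb [u] d = u \<star> d 0" for d by (simp add: lcomb_def)
    have "block_flag (bs @ [u]) (\<sigma> @ [length [u]])"
    proof (rule block_flag_append[OF f])
      fix d assume "lcomb [u] d \<in> ?U"
      then have ud: "u \<star> d 0 \<in> ?U" by (simp add: l1)
      have "d 0 = 0"
      proof (rule ccontr)
        assume "d 0 \<noteq> 0"
        then have "u \<star> d 0 \<star> inverse (d 0) = u" by (simp add: rscale_simps)
        then show False using sc[OF ud, of "inverse (d 0)"] u by simp
      qed
      then show "\<forall>s<length [u]. d s = 0" by simp
    next
      fix X s assume "X \<in> A" and s: "s < length [u]"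
      then obtain q where "qact n X u - u \<star> q \<in> ?U" using u(3) by blast
      then have "qact n X ([u] ! s) - lcomb [u] (\<lambda>_. q) \<in> ?U" using s by (simp add: l1)
      then show "\<exists>d. qact n X ([u] ! s) - lcomb [u] d \<in> ?U \<and> (length [u] = 2 \<longrightarrow> (\<forall>r<2. d r \<in> quat_complex))"
        by (intro exI[of _ "\<lambda>_. q"]) simp
    qed (use u in auto)
    then show ?thesis by (intro exI conjI) auto
  next
    fix u1 u2 assume u: "u1 \<in> qvecs n" "u2 \<in> qvecs n" "\<forall>p q. u1 \<star> p + u2 \<star> q \<in> ?U \<longrightarrow> p = 0 \<and> q = 0"
      "\<forall>X\<in>A. \<forall>v\<in>{u1, u2}. \<exists>a b. qact n X v - (u1 \<star> qpair a 0 + u2 \<star> qpair b 0) \<in> ?U"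
    have l2: "lcomb [u1, u2] d = u1 \<star> d 0 + u2 \<star> d 1" for d
      by (simp add: lcomb_def numeral_2_eq_2 lessThan_Suc add.commute)
    have "block_flag (bs @ [u1, u2]) (\<sigma> @ [length [u1, u2]])"
    proof (rule block_flag_append[OF f])
      fix d assume "lcomb [u1, u2] d \<in> ?U"
      then have "d 0 = 0 \<and> d 1 = 0" using u(3) unfolding l2 by blast
      then show "\<forall>s<length [u1, u2]. d s = 0" by (simp add: less_Suc_eq numeral_2_eq_2)
    next
      fix X s assume X: "X \<in> A" and s: "s < length [u1, u2]"
      have "[u1, u2] ! s \<in> {u1, u2}" using s by (auto simp: less_Suc_eq)
      then obtain a b where ab: "qact n X ([u1, u2] ! s) - (u1 \<star> qpair a 0 + u2 \<star> qpair b 0) \<in> ?U"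
        using u(4) X by blast
      let ?d = "\<lambda>r :: nat. if r = 0 then qpair a 0 else qpair b 0"
      have "qact n X ([u1, u2] ! s) - lcomb [u1, u2] ?d \<in> ?U" using ab by (simp add: l2)
      moreover have "?d r \<in> quat_complex" for r by (auto simp: quat_complex_def qpair_def)
      ultimately show "\<exists>d. qact n X ([u1, u2] ! s) - lcomb [u1, u2] d \<in> ?U \<and>
          (length [u1, u2] = 2 \<longrightarrow> (\<forall>r<2. d r \<in> quat_complex))"
        by (intro exI[of _ ?d] conjI) auto
    qed (use u in auto)
    then show ?thesis by (intro exI conjI) auto
  qed
qed

text \<open>Independence bounds the length of a flag by \<open>n\<close>, so a flag of greatest
  length exists; a shorter one than \<open>n\<close> could be extended.\<close>

lemma full_block_flag:
  obtains bs \<sigma> where "block_flag bs \<sigma>" "length bs = n"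
proof -
  have le: "length bs \<le> n" if "block_flag bs \<sigma>" for bs \<sigma>
    using that rindep_length_le[of bs n] by (auto simp: block_flag_def)
  have "block_flag [] []" by (simp add: block_flag_def one_two_sequence_def rindep_def)
  then have "\<exists>bs. (\<exists>\<sigma>. block_flag bs \<sigma>) \<and> (\<forall>bs'. (\<exists>\<sigma>. block_flag bs' \<sigma>) \<longrightarrow> length bs' \<le> length bs)"
    using le by (intro ex_has_greatest_nat[of _ "[]" _ "Suc n"]) (auto simp: less_Suc_eq_le)
  then obtain bs \<sigma> where f: "block_flag bs \<sigma>"
    and max: "\<And>bs' \<sigma>'. block_flag bs' \<sigma>' \<Longrightarrow> length bs' \<le> length bs" by blast
  have "\<not> length bs < n" using block_flag_extend[OF f] max by fastforce
  then have "length bs = n" using le[OF f] by simp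
  with f show thesis by (rule that)
qed

lemma quasi_triangularizable: "quasi_triangularizable n A"
proof -
  obtain bs \<sigma> where f: "block_flag bs \<sigma>" and len: "length bs = n" by (rule full_block_flag)
  have bs: "set bs \<subseteq> qvecs n" and n: "sum_list \<sigma> = n" and ots: "one_two_sequence \<sigma>" and ind: "rindep bs"
    using f len by (auto simp: block_flag_def)
  let ?P = "col_mat n bs"
  note P = col_mat_carrier[of n bs]
  have qP: "qact n ?P x = lcomb bs x" for x using qact_col_mat[OF bs] len by simp
  have "\<not> (\<exists>x\<in>qvecs n. x \<noteq> 0 \<and> qact n ?P x = 0)"
  proof safe
    fix x assume x: "x \<in> qvecs n" "x \<noteq> 0" "qact n ?P x = 0"
    then have "\<forall>t<n. x t = 0" using ind unfolding qP rindep_def len by blast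
    then have "x t = 0" for t using x(1) by (cases "t < n") (auto simp: qvecs_def)
    then show False using x(2) by (auto simp: fun_eq_iff)
  qed
  then obtain Q where Q: "Q \<in> carrier_mat n n" "?P * Q = 1\<^sub>m n" "Q * ?P = 1\<^sub>m n"
    using quat_mat_kernel_or_inverse[OF P] by blast
  have "Q * X * ?P \<in> M_seq \<sigma>" if X: "X \<in> A" for X
  proof -
    note cX = A_carrier[OF X]
    define C where "C = Q * X * ?P"
    have C: "C \<in> carrier_mat n n" using Q(1) cX P by (simp add: C_def)
    have "?P * C = ?P * Q * (X * ?P)"
      unfolding C_def using Q(1) cX P by (simp add: assoc_mult_mat[of _ n n _ n _ n])
    then have PC: "?P * C = X * ?P" unfolding Q(2) using cX P by simp
    have col: "lcomb bs (\<lambda>k. C $$ (k, j)) = qact n X (bs ! j)" if j: "j < n" for j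
    proof
      fix i
      show "lcomb bs (\<lambda>k. C $$ (k, j)) i = qact n X (bs ! j) i"
      proof (cases "i < n")
        case True
        have "lcomb bs (\<lambda>k. C $$ (k, j)) i = (?P * C) $$ (i, j)"
          unfolding mat_mult_index_qact[OF P C True j] qP ..
        also have "\<dots> = qact n X (\<lambda>k. ?P $$ (k, j)) i"
          unfolding PC mat_mult_index_qact[OF cX P True j] ..
        also have "\<dots> = qact n X (bs ! j) i"
          using j len by (simp add: qact_def col_mat_def)
        finally show ?thesis .
      next
        case False
        then show ?thesis
          using lcomb_qvecs[OF bs, of "\<lambda>k. C $$ (k, j)"] by (simp add: qvecs_def qact_def)
      qed
    qed
    have entries: "(\<forall>t<n. boff \<sigma> (Suc i) \<le> t \<longrightarrow> C $$ (t, boff \<sigma> i + s) = 0) \<and>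
        (\<sigma> ! i = 2 \<longrightarrow> (\<forall>r<2. C $$ (boff \<sigma> i + r, boff \<sigma> i + s) \<in> quat_complex))"
      if i: "i < length \<sigma>" and s: "s < \<sigma> ! i" for i s
    proof -
      let ?j = "boff \<sigma> i + s"
      have j: "?j < n" using boff_less(2)[OF i s] n by simp
      obtain c where c: "qact n X (bs ! ?j) = lcomb (take (boff \<sigma> (Suc i)) bs) c"
        "\<sigma> ! i = 2 \<longrightarrow> (\<forall>r<2. c (boff \<sigma> i + r) \<in> quat_complex)"
        using f X i s unfolding block_flag_def by blast
      let ?c = "\<lambda>t. if t < boff \<sigma> (Suc i) then c t else 0"
      \<comment> \<open>Column \<open>?j\<close> of \<open>C\<close> and the truncated
        \<open>c\<close> are both coordinates of the image of \<open>bs ! ?j\<close>; independence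
        makes them equal, and truncation gives the zeros below the block.\<close>
      have "lcomb bs (\<lambda>k. C $$ (k, ?j)) + lcomb bs ?c \<star> (- 1) = 0"
        unfolding col[OF j] c(1) lcomb_take by (simp add: rscale_simps)
      then have "lcomb bs (\<lambda>k. C $$ (k, ?j) + ?c k * (- 1)) = 0"
        unfolding lcomb_rscale lcomb_add .
      then have "\<forall>t<n. C $$ (t, ?j) + ?c t * (- 1) = 0"
        using ind unfolding rindep_def len by blast
      then have Cc: "C $$ (t, ?j) = ?c t" if "t < n" for t using that by auto
      have "C $$ (boff \<sigma> i + r, ?j) \<in> quat_complex" if "\<sigma> ! i = 2" "r < 2" for r
      proof -
        have r: "r < \<sigma> ! i" using that by simp
        show ?thesis using Cc[of "boff \<sigma> i + r"] boff_less[OF i r] n c(2) that by simp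
      qed
      then show ?thesis using Cc by auto
    qed
    have "block \<sigma> C i j = 0\<^sub>m (\<sigma> ! i) (\<sigma> ! j)" if ij: "i < length \<sigma>" "j < i" for i j
    proof (rule eq_matI)
      fix r s assume "r < dim_row (0\<^sub>m (\<sigma> ! i) (\<sigma> ! j) :: quat mat)" "s < dim_col (0\<^sub>m (\<sigma> ! i) (\<sigma> ! j) :: quat mat)"
      then have rs: "r < \<sigma> ! i" "s < \<sigma> ! j" by auto
      have "boff \<sigma> (Suc j) \<le> boff \<sigma> i" using ij by (intro boff_mono) simp
      moreover have "boff \<sigma> i + r < n" using boff_less(2)[OF ij(1) rs(1)] n by simp
      ultimately have "C $$ (boff \<sigma> i + r, boff \<sigma> j + s) = 0"
        using entries[of j s] ij rs by simp
      then show "block \<sigma> C i j $$ (r, s) = 0\<^sub>m (\<sigma> ! i) (\<sigma> ! j) $$ (r, s)"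
        using rs by (simp add: block_def)
    qed (simp_all add: block_def)
    moreover have "elements_mat (block \<sigma> C i i) \<subseteq> quat_complex" if i: "i < length \<sigma>" "\<sigma> ! i = 2" for i
    proof
      fix x assume "x \<in> elements_mat (block \<sigma> C i i)"
      then obtain r s where "r < dim_row (block \<sigma> C i i)" "s < dim_col (block \<sigma> C i i)"
        "x = block \<sigma> C i i $$ (r, s)" using elements_matD by blast
      then show "x \<in> quat_complex" using entries[OF i(1), of s] i by (simp add: block_def)
    qed
    ultimately show ?thesis using C n unfolding M_seq_def C_def[symmetric] by blast
  qed
  \<comment> \<open>The roles are exchanged: the conjugating matrix is \<open>Q\<close>, the inverse
    of the matrix whose columns are the basis.\<close>
  then show ?thesis
    unfolding quasi_triangularizable_def inverts_mat_def
    using Q P ots n by (intro bexI[of _ Q] bexI[of _ ?P] exI[of _ \<sigma>]) auto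
qed

end

section \<open>Block triangular matrices\<close>

lemma sum_boff: "(\<Sum>t<sum_list \<sigma>. f t) = (\<Sum>i<length \<sigma>. \<Sum>r<\<sigma> ! i. f (boff \<sigma> i + r))"
  for f :: "nat \<Rightarrow> 'a :: comm_monoid_add"
proof (induction \<sigma> rule: rev_induct)
  case (snoc k \<sigma>)
  have split: "(\<Sum>t<m + k. f t) = (\<Sum>t<m. f t) + (\<Sum>r<k. f (m + r))" for m k
    by (induction k) (simp_all add: add.assoc)
  have "(\<Sum>i<length \<sigma>. \<Sum>r<(\<sigma> @ [k]) ! i. f (boff (\<sigma> @ [k]) i + r))
      = (\<Sum>i<length \<sigma>. \<Sum>r<\<sigma> ! i. f (boff \<sigma> i + r))"
    by (intro sum.cong) (auto simp: nth_append)
  then show ?case using split[of "sum_list \<sigma>" k] snoc by simp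
qed simp

text \<open>Only the zero pattern of \<open>M_seq\<close>. The condition on diagonal blocks is kept
  apart and used entrywise, where the size of the block is known.\<close>

definition block_upper :: "nat list \<Rightarrow> 'a :: zero mat \<Rightarrow> bool" where
  "block_upper \<sigma> A \<longleftrightarrow> A \<in> carrier_mat (sum_list \<sigma>) (sum_list \<sigma>) \<and>
    (\<forall>i<length \<sigma>. \<forall>j<i. \<forall>r<\<sigma> ! i. \<forall>s<\<sigma> ! j. A $$ (boff \<sigma> i + r, boff \<sigma> j + s) = 0)"

lemma M_seq_block_upper: "A \<in> M_seq \<sigma> \<Longrightarrow> block_upper \<sigma> A"
  unfolding block_upper_def
proof (intro conjI allI impI)
  assume A: "A \<in> M_seq \<sigma>"
  then show "A \<in> carrier_mat (sum_list \<sigma>) (sum_list \<sigma>)" by (simp add: M_seq_def)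
  fix i j r s assume ij: "i < length \<sigma>" "j < i" and rs: "r < \<sigma> ! i" "s < \<sigma> ! j"
  then have "block \<sigma> A i j $$ (r, s) = 0" using A by (simp add: M_seq_def)
  then show "A $$ (boff \<sigma> i + r, boff \<sigma> j + s) = 0" using rs by (simp add: block_def)
qed

lemma M_seq_diag:
  assumes A: "A \<in> M_seq \<sigma>" and i: "i < length \<sigma>" "\<sigma> ! i = 2" and rs: "r < 2" "s < 2"
  shows "A $$ (boff \<sigma> i + r, boff \<sigma> i + s) \<in> quat_complex"
proof -
  have "block \<sigma> A i i $$ (r, s) \<in> elements_mat (block \<sigma> A i i)"
    using i rs by (intro elements_matI[of _ 2 2 r s]) (auto simp: block_def)
  then have "block \<sigma> A i i $$ (r, s) \<in> quat_complex" using A i by (auto simp: M_seq_def)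
  then show ?thesis using i rs by (simp add: block_def)
qed

lemma block_upper_minus:
  fixes A B :: "'a :: ab_group_add mat"
  shows "block_upper \<sigma> A \<Longrightarrow> block_upper \<sigma> B \<Longrightarrow> block_upper \<sigma> (A - B)"
  unfolding block_upper_def
proof (intro conjI allI impI)
  fix i j r s assume ij: "i < length \<sigma>" "j < i" and rs: "r < \<sigma> ! i" "s < \<sigma> ! j"
    and A: "A \<in> carrier_mat (sum_list \<sigma>) (sum_list \<sigma>) \<and>
      (\<forall>i<length \<sigma>. \<forall>j<i. \<forall>r<\<sigma> ! i. \<forall>s<\<sigma> ! j. A $$ (boff \<sigma> i + r, boff \<sigma> j + s) = 0)"
    and B: "B \<in> carrier_mat (sum_list \<sigma>) (sum_list \<sigma>) \<and>
      (\<forall>i<length \<sigma>. \<forall>j<i. \<forall>r<\<sigma> ! i. \<forall>s<\<sigma> ! j. B $$ (boff \<sigma> i + r, boff \<sigma> j + s) = 0)"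
  have "j < length \<sigma>" using ij by simp
  then show "(A - B) $$ (boff \<sigma> i + r, boff \<sigma> j + s) = 0"
    using conjunct2[OF A] conjunct2[OF B] carrier_matD[OF conjunct1[OF B]] ij rs
      boff_less(2)[OF ij(1) rs(1)] boff_less(2)[of j \<sigma> s]
    by (simp add: index_minus_mat(1))
qed auto

text \<open>In the sum over intermediate blocks \<open>l\<close>, the factor from \<open>A\<close>
  vanishes for \<open>l < i\<close> and that from \<open>B\<close> for \<open>l > j\<close>. With
  \<open>j \<le> i\<close> only \<open>l = i = j\<close> survives, so diagonal blocks multiply among
  themselves.\<close>

lemma block_mult_index:
  fixes A B :: "'a :: semiring_0 mat"
  assumes A: "block_upper \<sigma> A" and B: "block_upper \<sigma> B"
    and ij: "i < length \<sigma>" "j \<le> i" and rs: "r < \<sigma> ! i" "s < \<sigma> ! j"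
  shows "(A * B) $$ (boff \<sigma> i + r, boff \<sigma> j + s) = (if j < i then 0 else
    \<Sum>q<\<sigma> ! i. A $$ (boff \<sigma> i + r, boff \<sigma> i + q) * B $$ (boff \<sigma> i + q, boff \<sigma> i + s))"
proof -
  let ?n = "sum_list \<sigma>"
  have c: "A \<in> carrier_mat ?n ?n" "B \<in> carrier_mat ?n ?n" using A B by (auto simp: block_upper_def)
  have j: "j < length \<sigma>" using ij by simp
  have "(A * B) $$ (boff \<sigma> i + r, boff \<sigma> j + s)
      = (\<Sum>t<?n. A $$ (boff \<sigma> i + r, t) * B $$ (t, boff \<sigma> j + s))"
    using c boff_less(2)[OF ij(1) rs(1)] boff_less(2)[OF j rs(2)]
    by (subst mat_mult_index_sum) auto
  also have "\<dots> = (\<Sum>l<length \<sigma>. \<Sum>q<\<sigma> ! l. A $$ (boff \<sigma> i + r, boff \<sigma> l + q) * B $$ (boff \<sigma> l + q, boff \<sigma> j + s))"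
    by (rule sum_boff)
  also have "\<dots> = (\<Sum>l<length \<sigma>. if l = i then (if j < i then 0 else
    \<Sum>q<\<sigma> ! i. A $$ (boff \<sigma> i + r, boff \<sigma> i + q) * B $$ (boff \<sigma> i + q, boff \<sigma> i + s)) else 0)"
  proof (intro sum.cong refl)
    fix l assume "l \<in> {..<length \<sigma>}"
    then have l: "l < length \<sigma>" by simp
    have z: "A $$ (boff \<sigma> i + r, boff \<sigma> l + q) * B $$ (boff \<sigma> l + q, boff \<sigma> j + s) = 0"
      if "q < \<sigma> ! l" "l < i \<or> j < l" for q
      using that A B ij l rs unfolding block_upper_def by auto
    show "(\<Sum>q<\<sigma> ! l. A $$ (boff \<sigma> i + r, boff \<sigma> l + q) * B $$ (boff \<sigma> l + q, boff \<sigma> j + s))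
      = (if l = i then (if j < i then 0 else
    \<Sum>q<\<sigma> ! i. A $$ (boff \<sigma> i + r, boff \<sigma> i + q) * B $$ (boff \<sigma> i + q, boff \<sigma> i + s)) else 0)"
    proof (cases "l = i \<and> \<not> j < i")
      case True
      then have "j = i" using ij by simp
      then show ?thesis using True by simp
    next
      case False
      then have "l < i \<or> j < l" using ij by auto
      then have "(\<Sum>q<\<sigma> ! l. A $$ (boff \<sigma> i + r, boff \<sigma> l + q) * B $$ (boff \<sigma> l + q, boff \<sigma> j + s)) = 0"
        using z by (intro sum.neutral) auto
      then show ?thesis using False by auto
    qed
  qed
  also have "\<dots> = (if j < i then 0 else
    \<Sum>q<\<sigma> ! i. A $$ (boff \<sigma> i + r, boff \<sigma> i + q) * B $$ (boff \<sigma> i + q, boff \<sigma> i + s))"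
    using ij(1) by (subst sum.delta) auto
  finally show ?thesis .
qed

lemma block_upper_mult:
  fixes A B :: "'a :: semiring_0 mat"
  assumes A: "block_upper \<sigma> A" and B: "block_upper \<sigma> B"
  shows "block_upper \<sigma> (A * B)"
  unfolding block_upper_def
proof (intro conjI allI impI)
  show "A * B \<in> carrier_mat (sum_list \<sigma>) (sum_list \<sigma>)" using A B by (auto simp: block_upper_def)
qed (simp add: block_mult_index[OF A B])

section \<open>Cubed commutators have trace zero on the diagonal blocks\<close>

lemma quat_complexD: "x \<in> quat_complex \<Longrightarrow> qsnd x = 0"
  by (auto simp: quat_complex_def qsnd_def complex_eq_iff)

text \<open>A commutator of quaternions is purely imaginary; its square is real, so its cube is
  purely imaginary again.\<close>

lemma qRe_cube_commutator: "qRe ((a * b - b * a) * (a * b - b * a) * (a * b - b * a)) = 0"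
proof -
  define d where "d = a * b - b * a"
  have "qRe d = 0" by (simp add: d_def)
  then have "qRe (d * d * d) = 0" by simp
  then show ?thesis by (simp add: d_def)
qed

text \<open>The expression is the trace of the cube of the matrix with rows \<open>x, y\<close> and
  \<open>z, w\<close>. By Cayley-Hamilton a traceless 2 x 2 matrix has scalar square, so its cube is
  a multiple of itself.\<close>

lemma traceless_cube_trace:
  fixes x y z w :: complex
  assumes "x + w = 0"
  shows "(x * x + y * z) * x + (x * y + y * w) * z + ((z * x + w * z) * y + (z * y + w * w) * w) = 0"
proof -
  have "w = - x" using assms by (simp add: add_eq_0_iff)
  then show ?thesis by (simp add: algebra_simps)
qed

lemma qRe_eq: "qRe x = Re (qfst x)"
  by (simp add: qfst_def)

lemma M_seq_cube_trace:
  assumes A: "A \<in> M_seq \<sigma>" and B: "B \<in> M_seq \<sigma>" and ots: "one_two_sequence \<sigma>"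
  shows "qTr (commutator A B * commutator A B * commutator A B) = 0"
proof -
  let ?D = "commutator A B"
  let ?n = "sum_list \<sigma>"
  note bA = M_seq_block_upper[OF A] and bB = M_seq_block_upper[OF B]
  have D: "block_upper \<sigma> ?D"
    unfolding commutator_def using bA bB by (intro block_upper_minus block_upper_mult)
  note DD = block_upper_mult[OF D D]
  note DDD = block_upper_mult[OF DD D]
  have c: "A \<in> carrier_mat ?n ?n" "B \<in> carrier_mat ?n ?n" using bA bB by (auto simp: block_upper_def)
  have blk: "(\<Sum>r<\<sigma> ! i. qRe ((?D * ?D * ?D) $$ (boff \<sigma> i + r, boff \<sigma> i + r))) = 0"
    if i: "i < length \<sigma>" for i
  proof -
    let ?o = "boff \<sigma> i"
    define a b d where "a = (\<lambda>r s. A $$ (?o + r, ?o + s))" and "b = (\<lambda>r s. B $$ (?o + r, ?o + s))"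
      and "d = (\<lambda>r s. ?D $$ (?o + r, ?o + s))"
    have dD: "d r s = (\<Sum>q<\<sigma> ! i. a r q * b q s) - (\<Sum>q<\<sigma> ! i. b r q * a q s)"
      if rs: "r < \<sigma> ! i" "s < \<sigma> ! i" for r s
    proof -
      have "d r s = (A * B) $$ (?o + r, ?o + s) - (B * A) $$ (?o + r, ?o + s)"
        unfolding d_def commutator_def using c boff_less(2)[OF i] rs
        by (intro index_minus_mat) auto
      then show ?thesis
        using block_mult_index[OF bA bB i order_refl rs] block_mult_index[OF bB bA i order_refl rs]
        by (simp add: a_def b_def)
    qed
    have d3: "(?D * ?D * ?D) $$ (?o + r, ?o + r) = (\<Sum>q<\<sigma> ! i. (\<Sum>p<\<sigma> ! i. d r p * d p q) * d q r)"
      if r: "r < \<sigma> ! i" for r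
      using block_mult_index[OF DD D i order_refl r r] block_mult_index[OF D D i order_refl r]
      by (simp add: d_def)
    have "\<sigma> ! i = 1 \<or> \<sigma> ! i = 2" using ots i nth_mem by (auto simp: one_two_sequence_def)
    then show ?thesis
    proof
      assume 1: "\<sigma> ! i = 1"
      then show ?thesis using d3[of 0] dD[of 0 0] qRe_cube_commutator[of "a 0 0" "b 0 0"] by simp
    next
      assume 2: "\<sigma> ! i = 2"
      have ab: "qsnd (a r s) = 0" "qsnd (b r s) = 0" if "r < 2" "s < 2" for r s
        using M_seq_diag[OF A i 2 that] M_seq_diag[OF B i 2 that] by (auto simp: a_def b_def quat_complexD)
      have sum2: "(\<Sum>q<2. f q) = f 0 + f 1" for f :: "nat \<Rightarrow> 'x :: comm_monoid_add"
        by (simp add: numeral_2_eq_2 lessThan_Suc add.commute)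
      note dd = dD[unfolded 2 sum2]
      have ds: "qsnd (d r s) = 0" if "r < 2" "s < 2" for r s
        using that by (simp add: dd qpair_mult ab)
      \<comment> \<open>The entries lie in the commutative subfield of complex numbers, so the
        commutator has trace zero; quaternionic entries would give only a vanishing real
        part.\<close>
      have tr: "qfst (d 0 0) + qfst (d 1 1) = 0"
        by (simp add: dd qpair_mult ab)
      have "(\<Sum>r<2. qRe ((?D * ?D * ?D) $$ (?o + r, ?o + r))) =
        Re (qfst ((\<Sum>q<2. (\<Sum>p<2. d 0 p * d p q) * d q 0) + (\<Sum>q<2. (\<Sum>p<2. d 1 p * d p q) * d q 1)))"
        using d3[of 0] d3[of 1] 2 by (simp add: qRe_eq sum2)
      also have "\<dots> = 0"
        using traceless_cube_trace[OF tr, of "qfst (d 0 1)" "qfst (d 1 0)"]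
        by (simp add: sum2 qpair_mult ds)
      finally show ?thesis using 2 by simp
    qed
  qed
  have "dim_row (?D * ?D * ?D) = ?n" using DDD by (auto simp: block_upper_def)
  moreover have "qRe (\<Sum>t<?n. (?D * ?D * ?D) $$ (t, t)) = (\<Sum>t<?n. qRe ((?D * ?D * ?D) $$ (t, t)))"
    by (simp add: qRe_eq qpair_sum)
  moreover have "\<dots> = 0" unfolding sum_boff using blk by (intro sum.neutral) auto
  ultimately show ?thesis by (simp add: qTr_real)
qed

text \<open>The sum of the diagonal entries itself is not invariant under similarity over a
  noncommutative ring; invariance of \<open>qTr\<close> is obtained from the complex trace of
  \<open>qchi\<close>.\<close>

lemma qTr_similar_eq_0:
  assumes P: "P \<in> carrier_mat n n" and Q: "Q \<in> carrier_mat n n" and QP: "Q * P = 1\<^sub>m n"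
    and Z: "Z \<in> carrier_mat n n" and z: "qTr (P * Z * Q) = 0"
  shows "qTr Z = 0"
proof -
  have "mat_trace (qchi n (P * Z * Q)) = mat_trace (qchi n P * (qchi n Z * qchi n Q))"
    using P Q Z by (simp add: qchi_mult assoc_mult_mat[of _ n n _ n _ n])
  also have "\<dots> = mat_trace (qchi n Z * qchi n Q * qchi n P)"
    by (rule mat_trace_mult_comm) auto
  also have "qchi n Z * qchi n Q * qchi n P = qchi n (Z * (Q * P))"
    using P Q Z by (simp add: qchi_mult assoc_mult_mat[of _ n n _ n _ n]
        assoc_mult_mat[of _ "2 * n" "2 * n" _ "2 * n" _ "2 * n"])
  also have "Z * (Q * P) = Z" using Z QP by simp
  finally show ?thesis using z P Q Z qTr_eq_0_iff[of "P * Z * Q" n] qTr_eq_0_iff[OF Z] by simp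
qed

lemma cube_trace_if_quasi_triangularizable:
  assumes S: "S \<subseteq> carrier_mat n n" and q: "quasi_triangularizable n S" and AB: "A \<in> S" "B \<in> S"
  shows "qTr (commutator A B ^\<^sub>m 3) = 0"
proof -
  obtain P Q \<sigma> where P: "P \<in> carrier_mat n n" and Q: "Q \<in> carrier_mat n n"
    and PQ: "Q * P = 1\<^sub>m n" and ots: "one_two_sequence \<sigma>"
    and M': "(\<lambda>A. P * A * Q) ` S \<subseteq> M_seq \<sigma>"
    using q unfolding quasi_triangularizable_def inverts_mat_def by (metis carrier_matD(1))
  have M: "P * A * Q \<in> M_seq \<sigma>" if "A \<in> S" for A using M' that by blast
  have c: "A \<in> carrier_mat n n" "B \<in> carrier_mat n n" using AB S by auto
  have mult: "(P * X * Q) * (P * Y * Q) = P * (X * Y) * Q"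
    if X: "X \<in> carrier_mat n n" and Y: "Y \<in> carrier_mat n n" for X Y
  proof -
    have "(P * X * Q) * (P * Y * Q) = P * X * (Q * P) * (Y * Q)"
      using P Q X Y by (simp add: assoc_mult_mat[of _ n n _ n _ n])
    also have "\<dots> = P * (X * Y) * Q"
      unfolding PQ using P Q X Y by (simp add: assoc_mult_mat[of _ n n _ n _ n])
    finally show ?thesis .
  qed
  let ?D = "commutator A B"
  have D: "?D \<in> carrier_mat n n" using c by simp
  have "commutator (P * A * Q) (P * B * Q) = P * ?D * Q"
    unfolding commutator_def mult[OF c] mult[OF c(2,1)] using P Q c
    by (simp add: mult_minus_distrib_mat[of _ n n _ n] minus_mult_distrib_mat[of _ n n _ _ n])
  then have "commutator (P * A * Q) (P * B * Q) * commutator (P * A * Q) (P * B * Q) * commutator (P * A * Q) (P * B * Q)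
      = P * (?D * ?D * ?D) * Q"
    using D by (simp add: mult)
  then have "qTr (P * (?D * ?D * ?D) * Q) = 0"
    using M_seq_cube_trace[OF M[OF AB(1)] M[OF AB(2)] ots] by simp
  then have "qTr (?D * ?D * ?D) = 0" using qTr_similar_eq_0[OF P Q PQ] D by simp
  moreover have "?D ^\<^sub>m 3 = ?D * ?D * ?D" using D by (simp add: numeral_3_eq_3)
  ultimately show ?thesis by simp
qed

theorem theorem5p10:
  fixes n :: nat and \<A> :: "quat mat set"
  assumes "unital_real_subalgebra n \<A>"
  shows "quasi_triangularizable n \<A> \<longleftrightarrow>
    (\<forall>A\<in>\<A>. \<forall>B\<in>\<A>. qTr (commutator A B ^\<^sub>m 3) = 0)"
proof
  assume "quasi_triangularizable n \<A>"
  moreover have "\<A> \<subseteq> carrier_mat n n" using assms by (simp add: unital_real_subalgebra_def)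
  ultimately show "\<forall>A\<in>\<A>. \<forall>B\<in>\<A>. qTr (commutator A B ^\<^sub>m 3) = 0"
    using cube_trace_if_quasi_triangularizable by blast
next
  assume "\<forall>A\<in>\<A>. \<forall>B\<in>\<A>. qTr (commutator A B ^\<^sub>m 3) = 0"
  then interpret cube_free_quat_algebra n \<A>
    using assms by unfold_locales auto
  show "quasi_triangularizable n \<A>" by (rule quasi_triangularizable)
qed

end
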